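(* Let $n\ge 2$, $0<\lambda\le\Lambda$, $S\ge 0$. There exists $\epsilon>0$ depending only on $n,\lambda,\Lambda,S$ such that the following holds. Let $Lu=a^{ij}(x)u_{ij}+b^i(x)u_i$ be an operator on $B_1\subset\mathbb{R}^n$ with measurable coefficients satisfying $\lambda I\le (a^{ij}(x))\le\Lambda I$ and $\|b\|_{L^n(B_1)}=S$. If $0\le\gamma<\epsilon$, and $u\in W^{2,n}(B_1)$ satisfies $L_\gamma u\le 0$ in $B_1$ (that is, $Lu\le 0$ where $|\nabla u|>\gamma$) and $u\ge 0$ on $\partial B_1$, then $$\sup_{B_1}u^-\le 1.$$
   Context: $B_r$ is the ball of radius $r$ centered at $0$ in $\mathbb{R}^n$. $u^-(x)=-\min\{u(x),0\}$. Repeated indices are summed; $(a^{ij}(x))$ is symmetric; $b=(b^1,\dots,b^n)$. "$L_\gamma u\le 0$" means that $Lu\le 0$ holds only at points where $|\nabla u|>\gamma$ (in the Lebesgue point sense, i.e. for almost every $x$ with $|\nabla u(x)|>\gamma$). Functions in $W^{2,n}(B_1)$ are identified with their continuous representatives, which are continuous on $\overline{B_1}$. *)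

theory Defs
  imports "HOL-Analysis.Analysis"
begin

definition Lp_space :: "real \<Rightarrow> (real^'n) set \<Rightarrow> (real^'n \<Rightarrow> 'b::euclidean_space) set" where
  "Lp_space p U = {f. f \<in> borel_measurable (lebesgue_on U)
      \<and> integrable (lebesgue_on U) (\<lambda>x. norm (f x) powr p)}"

text \<open>Only meaningful for members of \<open>Lp_space p U\<close>: the Bochner integral of a
  non-integrable function is 0.\<close>
definition Lp_norm :: "real \<Rightarrow> (real^'n) set \<Rightarrow> (real^'n \<Rightarrow> 'b::euclidean_space) \<Rightarrow> real" where
  "Lp_norm p U f = (LINT x|lebesgue_on U. norm (f x) powr p) powr (1 / p)"

definition pderiv_at :: "'n \<Rightarrow> (real^'n \<Rightarrow> real) \<Rightarrow> real^'n \<Rightarrow> real" where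
  "pderiv_at i f x = frechet_derivative f (at x) (axis i 1)"

primrec iter_pderiv :: "'n list \<Rightarrow> (real^'n \<Rightarrow> real) \<Rightarrow> real^'n \<Rightarrow> real" where
  "iter_pderiv [] f = f"
| "iter_pderiv (i # js) f = pderiv_at i (iter_pderiv js f)"

text \<open>Differentiability of all iterated partial derivatives is \<open>C\<^sup>\<infinity>\<close> regularity:
  each of them is then also continuous.\<close>
definition smooth_fun :: "(real^'n \<Rightarrow> real) \<Rightarrow> bool" where
  "smooth_fun f \<longleftrightarrow> (\<forall>js x. iter_pderiv js f differentiable (at x))"

definition test_functions :: "(real^'n) set \<Rightarrow> (real^'n \<Rightarrow> real) set" where
  "test_functions U = {\<phi>. smooth_fun \<phi> \<and> compact (closure {x. \<phi> x \<noteq> 0})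
      \<and> closure {x. \<phi> x \<noteq> 0} \<subseteq> U}"

definition locally_integrable_on :: "(real^'n \<Rightarrow> real) \<Rightarrow> (real^'n) set \<Rightarrow> bool" where
  "locally_integrable_on f U \<longleftrightarrow> (\<forall>K. compact K \<and> K \<subseteq> U \<longrightarrow> set_integrable lebesgue K f)"

text \<open>A list of coordinate indices plays the role of a multi-index, so \<open>[i, j]\<close> stands for
  the mixed second derivative in the directions \<open>i\<close> and \<open>j\<close>.\<close>
definition has_weak_deriv ::
    "(real^'n) set \<Rightarrow> 'n list \<Rightarrow> (real^'n \<Rightarrow> real) \<Rightarrow> (real^'n \<Rightarrow> real) \<Rightarrow> bool" where
  "has_weak_deriv U js u v \<longleftrightarrow> locally_integrable_on u U \<and> locally_integrable_on v U \<and>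
     (\<forall>\<phi> \<in> test_functions U.
        (LINT x:U|lebesgue. u x * iter_pderiv js \<phi> x)
          = (-1) ^ length js * (LINT x:U|lebesgue. v x * \<phi> x))"

definition sobolev :: "nat \<Rightarrow> real \<Rightarrow> (real^'n) set \<Rightarrow> (real^'n \<Rightarrow> real) set" where
  "sobolev k p U = {u. \<forall>js. length js \<le> k \<longrightarrow>
      (\<exists>v. has_weak_deriv U js u v \<and> v \<in> Lp_space p U)}"

text \<open>Weak derivatives are determined only almost everywhere, so versions of the weak gradient
  and Hessian are carried as explicit functions.\<close>
definition is_weak_gradient ::
    "(real^'n) set \<Rightarrow> (real^'n \<Rightarrow> real) \<Rightarrow> (real^'n \<Rightarrow> real^'n) \<Rightarrow> bool" where
  "is_weak_gradient U u Du \<longleftrightarrow> (\<forall>i. has_weak_deriv U [i] u (\<lambda>x. Du x $ i))"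

definition is_weak_hessian ::
    "(real^'n) set \<Rightarrow> (real^'n \<Rightarrow> real) \<Rightarrow> (real^'n \<Rightarrow> real^'n^'n) \<Rightarrow> bool" where
  "is_weak_hessian U u D2u \<longleftrightarrow> (\<forall>i j. has_weak_deriv U [i, j] u (\<lambda>x. D2u x $ i $ j))"

definition loewner_le :: "real^'n^'n \<Rightarrow> real^'n^'n \<Rightarrow> bool" where
  "loewner_le A B \<longleftrightarrow> (\<forall>\<xi>. \<xi> \<bullet> (A *v \<xi>) \<le> \<xi> \<bullet> (B *v \<xi>))"

text \<open>\<open>Lu = a\<^sup>i\<^sup>j u\<^sub>i\<^sub>j + b\<^sup>i u\<^sub>i\<close>, with \<open>Du\<close> and \<open>D2u\<close> the gradient and Hessian of \<open>u\<close>.\<close>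
definition nondiv_op ::
    "(real^'n \<Rightarrow> real^'n^'n) \<Rightarrow> (real^'n \<Rightarrow> real^'n) \<Rightarrow> (real^'n \<Rightarrow> real^'n)
      \<Rightarrow> (real^'n \<Rightarrow> real^'n^'n) \<Rightarrow> real^'n \<Rightarrow> real" where
  "nondiv_op a b Du D2u x =
     (\<Sum>i\<in>UNIV. \<Sum>j\<in>UNIV. a x $ i $ j * D2u x $ i $ j) + (\<Sum>i\<in>UNIV. b x $ i * Du x $ i)"

text \<open>\<open>L\<^sub>\<gamma> u \<le> 0\<close>: the inequality is required only where the gradient is larger than \<open>\<gamma>\<close>.\<close>
definition large_gradient_supersolution ::
    "(real^'n) set \<Rightarrow> real \<Rightarrow> (real^'n \<Rightarrow> real^'n^'n) \<Rightarrow> (real^'n \<Rightarrow> real^'n)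
      \<Rightarrow> (real^'n \<Rightarrow> real^'n) \<Rightarrow> (real^'n \<Rightarrow> real^'n^'n) \<Rightarrow> bool" where
  "large_gradient_supersolution U \<gamma> a b Du D2u \<longleftrightarrow>
     (AE x in lebesgue_on U. norm (Du x) > \<gamma> \<longrightarrow> nondiv_op a b Du D2u x \<le> 0)"

definition neg_part :: "(real^'n \<Rightarrow> real) \<Rightarrow> real^'n \<Rightarrow> real" where
  "neg_part u x = - min (u x) 0"

end

theory Submission
  imports Defs "HOL-Probability.Probability_Measure"
begin

text \<open>
  Suppose \<open>u < -1\<close> somewhere. Then for every \<open>p\<close> with \<open>|p| \<le> 1/2\<close> the function \<open>u - p \<bullet> x\<close> has an
  interior minimum, where formally \<open>Du = p\<close> and \<open>D\<^sup>2u \<ge> 0\<close>. Where moreover \<open>|Du| > \<gamma>\<close>, the inequality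
  \<open>Lu \<le> 0\<close> gives \<open>det D\<^sup>2u \<le> C (tr (a D\<^sup>2u))\<^sup>n \<le> C |b|\<^sup>n |Du|\<^sup>n\<close>. Integrating the weight \<open>|p|\<^bsup>-n\<^esup>\<close>
  over \<open>\<gamma>' \<le> |p| \<le> 1/2\<close>, with \<open>\<gamma>' > \<gamma>\<close>, and changing variables \<open>p = Du\<close> bounds it by \<open>C S\<^sup>n\<close>; but this
  integral grows like \<open>log (1/\<gamma>')\<close>, so \<open>\<gamma>'\<close> cannot be too small.

  Since \<open>u\<close> is only in \<open>W\<^bsup>2,n\<^esup>\<close>, the argument is run on its mollifications \<open>v\<close>. Their Hessians converge in
  \<open>L\<^sup>n\<close>, and the points where \<open>|Dv| \<ge> \<gamma>'\<close> although \<open>|Du| \<le> \<gamma>\<close> contribute nothing in the limit,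
  because \<open>Dv\<close> converges to \<open>Du\<close> in measure.
\<close>

section \<open>Translation and mollification in L^p\<close>

text \<open>The weight is dictated by the drift: dividing |b|^n |Du|^n by |Du|^n leaves |b|^n, whose
  integral is S^n. That the weight just fails to be integrable at 0 is what beats an arbitrarily
  large S. Each dyadic annulus contributes at least half the volume of the unit ball, so \<epsilon>
  can be 2^-(N+1) as soon as N times that amount exceeds n! (4 / lam)^n S^n. The slope bound 1/2 is
  matched to the depth 1: points of a ball of radius r < 1 are less than 2 apart, so tilting by such
  a slope cannot undo a drop of 1.

  Rough constants suffice, which keeps eigenvalues out of the proof: det A \<le> n! (tr A)^n comes
  from the Leibniz formula, and tr (a A) \<ge> lam tr A from a Cholesky induction.

  The obstacle is that contact points are found for the mollification, while the inequality is known
  only for u. The gap \<gamma>' - \<gamma> is the margin by which the two gradients may differ; it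
  stays fixed in the limit, because the error terms carry the factor (2 Lam / \<gamma>')^n.
  Mollifying also forces a retreat to a smaller ball, and the excess of -u over 1 pays for the
  boundary values lost there.\<close>

lemma lborel_integral_shift:
  fixes f :: "'a::euclidean_space \<Rightarrow> 'b::{banach, second_countable_topology}"
  assumes "f \<in> borel_measurable borel"
  shows "(LINT y|lborel. f (z + y)) = (LINT y|lborel. f y)"
    and "integrable lborel (\<lambda>y. f (z + y)) \<longleftrightarrow> integrable lborel f"
proof -
  have "(LINT y|distr lborel borel ((+) z). f y) = (LINT y|lborel. f (z + y))"
    by (rule integral_distr) (use assms in auto)
  then show "(LINT y|lborel. f (z + y)) = (LINT y|lborel. f y)"
    by (simp add: lborel_distr_plus)
  have "integrable (distr lborel borel ((+) z)) f \<longleftrightarrow> integrable lborel (\<lambda>y. f (z + y))"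
    by (rule integrable_distr_eq) (use assms in auto)
  then show "integrable lborel (\<lambda>y. f (z + y)) \<longleftrightarrow> integrable lborel f"
    by (simp add: lborel_distr_plus)
qed

lemma borel_measurable_integrable_borel: "integrable lborel f \<Longrightarrow> f \<in> borel_measurable borel"
  by (drule borel_measurable_integrable) simp

text \<open>The set is squeezed between a compact \<open>K\<close> and an open \<open>U\<close> with
  \<open>U - K\<close> small. Once \<open>z\<close> is shorter than the distance from
  \<open>K\<close> to the complement of \<open>U\<close>, the two indicators can differ at
  \<open>y\<close> only if \<open>y\<close> or \<open>z + y\<close> lies in
  \<open>D = U - K\<close>, so the integral is at most twice the measure of
  \<open>D\<close>.\<close>

lemma L1_translation_indicator:
  fixes A :: "'a::euclidean_space set"
  assumes A: "A \<in> sets borel" "emeasure lborel A < \<infinity>" and "e > 0"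
  shows "\<exists>d>0. \<forall>z. norm z < d \<longrightarrow>
    (LINT y|lborel. norm (indicator A (z + y) - indicator A y :: real)) < e"
proof -
  have Am: "A \<in> lmeasurable"
    using A by (simp add: fmeasurable_def)
  obtain U where U: "open U" "A \<subseteq> U" "U - A \<in> lmeasurable" "emeasure lebesgue (U - A) < ennreal (e/8)"
    by (rule sets_lebesgue_outer_open[of A "e/8"]) (use Am \<open>e > 0\<close> in auto)
  obtain C where C: "closed C" "C \<subseteq> A" "A - C \<in> lmeasurable" "emeasure lebesgue (A - C) < ennreal (e/16)"
    by (rule sets_lebesgue_inner_closed[of A "e/16"]) (use Am \<open>e > 0\<close> in auto)
  have Cl: "C \<in> lmeasurable"
    using fmeasurableI2[OF Am C(2)] C(1) by auto
  \<comment> \<open>The inner approximation \<open>C\<close> is closed but possibly unbounded;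
    intersecting it with a large ball makes it compact at a small loss of measure.\<close>
  have "(\<lambda>n. measure lebesgue (C \<inter> cball 0 (real n))) \<longlonglongrightarrow> measure lebesgue (\<Union>n. C \<inter> cball 0 (real n))"
  proof (rule Lim_measure_incseq)
    show "range (\<lambda>n. C \<inter> cball 0 (real n)) \<subseteq> sets lebesgue"
      using C(1) by (auto intro!: lborelD borel_closed)
    show "incseq (\<lambda>n. C \<inter> cball 0 (real n))" by (auto simp: incseq_def)
    have "emeasure lebesgue (\<Union>n. C \<inter> cball 0 (real n)) \<le> emeasure lebesgue C"
      by (rule emeasure_mono) (use C(1) in auto)
    then show "emeasure lebesgue (\<Union>n. C \<inter> cball 0 (real n)) \<noteq> \<infinity>"
      using Cl by (auto simp: fmeasurable_def top_unique)
  qed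
  also have "(\<Union>n. C \<inter> cball 0 (real n)) = C"
    by (auto simp: real_arch_simple)
  finally have "\<forall>\<^sub>F n in sequentially. measure lebesgue C - e/16 < measure lebesgue (C \<inter> cball 0 (real n))"
    using \<open>e > 0\<close> by (intro order_tendstoD) auto
  then obtain N where N: "measure lebesgue C - e/16 < measure lebesgue (C \<inter> cball 0 (real N))"
    by (auto simp: eventually_sequentially)
  have mAC: "measure lebesgue (A - C) < e/16"
    using C(3,4) \<open>e > 0\<close> by (simp add: emeasure_eq_measure2 ennreal_less_iff)
  define K where "K = C \<inter> cball 0 (real N)"
  have K: "compact K" "K \<subseteq> A" "K \<in> lmeasurable" "measure lebesgue A < measure lebesgue K + e/8"
  proof -
    show "compact K" unfolding K_def using C(1) by (simp add: closed_Int_compact)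
    then show "K \<in> lmeasurable" by (rule lmeasurable_compact)
    show "K \<subseteq> A" using C by (auto simp: K_def)
    have "measure lebesgue (A - C) = measure lebesgue A - measure lebesgue C"
      by (rule measurable_measure_Diff) (use Am Cl C in \<open>auto simp: fmeasurableD\<close>)
    then show "measure lebesgue A < measure lebesgue K + e/8"
      using N mAC unfolding K_def by simp
  qed
  define D where "D = U - K"
  have Db [measurable]: "D \<in> sets borel"
    unfolding D_def using U(1) K(1) by (intro sets.Diff borel_open borel_closed compact_imp_closed)
  have Dl: "D \<in> lmeasurable"
  proof -
    have "D = (U - A) \<union> (A - K)" unfolding D_def using U(2) K(2) by auto
    then show ?thesis using U(3) Am K(3) by (auto intro: fmeasurable.Un fmeasurable_Diff fmeasurableD)
  qed
  have mUA: "measure lebesgue (U - A) < e/8"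
    using U(3,4) \<open>e > 0\<close> by (simp add: emeasure_eq_measure2 ennreal_less_iff)
  have mAK: "measure lebesgue (A - K) < e/8"
    using K Am by (subst measurable_measure_Diff) (auto simp: fmeasurableD)
  have "measure lebesgue D \<le> measure lebesgue ((U - A) \<union> (A - K))"
    unfolding D_def by (rule measure_mono_fmeasurable) (use U K Am in auto)
  also have "\<dots> \<le> measure lebesgue (U - A) + measure lebesgue (A - K)"
    by (rule measure_Un_le) (use U K Am in auto)
  finally have mD: "measure lebesgue D < e/4" using mUA mAK by simp
  have mD': "measure lborel D = measure lebesgue D" using Db by simp
  have Di: "integrable lborel (indicator D :: 'a \<Rightarrow> real)"
    using Dl Db by (simp add: fmeasurable_def)
  obtain d where d: "d > 0" "\<And>x y. x \<in> K \<Longrightarrow> dist x y < d \<Longrightarrow> y \<in> U"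
  \<comment> \<open>\<open>setdist\<close> is 0 by convention when one of the sets is empty, so
    these cases are split off; any \<open>d\<close> works in them.\<close>
  proof (cases "K = {} \<or> - U = {}")
    case True then show ?thesis using that[of 1] by (metis ComplI empty_iff zero_less_one)
  next
    case False
    have "setdist K (-U) > 0"
      using False K U setdist_gt_0_compact_closed[of K "-U"] by auto
    moreover have "y \<in> U" if "x \<in> K" "dist x y < setdist K (-U)" for x y
      using setdist_le_dist[OF that(1), of y "-U"] that(2) by force
    ultimately show ?thesis using that by blast
  qed
  have "(LINT y|lborel. norm (indicator A (z + y) - indicator A y :: real)) < e" if z: "norm z < d" for z
  proof -
    have "(LINT y|lborel. norm (indicator A (z + y) - indicator A y :: real))
       \<le> (LINT y|lborel. indicator D (z + y) + indicator D y)"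
    proof (rule integral_mono_AE')
      show "integrable lborel (\<lambda>y. indicator D (z + y) + indicator D y :: real)"
        using Di lborel_integral_shift(2)[of "indicator D :: 'a \<Rightarrow> real" z] by auto
      show "AE y in lborel. norm (indicator A (z + y) - indicator A y :: real) \<le> indicator D (z + y) + indicator D y"
      proof (rule AE_I2)
        fix y :: 'a
        have "dist (z+y) y < d" "dist y (z+y) < d" using z by (auto simp: dist_norm)
        then show "norm (indicator A (z + y) - indicator A y :: real) \<le> indicator D (z + y) + indicator D y"
          using d(2)[of "z+y" y] d(2)[of y "z+y"] U(2) K(2)
          unfolding D_def indicator_def by auto
      qed
    qed auto
    also have "\<dots> = 2 * measure lborel D"
      using Di lborel_integral_shift[of "indicator D :: 'a \<Rightarrow> real" z] by auto
    finally show ?thesis using mD mD' \<open>e > 0\<close> by linarith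
  qed
  then show ?thesis using d by blast
qed

text \<open>Indicators are settled, and the property survives sums and limits: if \<open>s i\<close>
  is close to \<open>f\<close> in L^1, then so are their translates, by the same amount, because the
  integral is translation invariant.\<close>

lemma L1_translation:
  fixes h :: "'a::euclidean_space \<Rightarrow> real"
  assumes "integrable lborel h"
  shows "\<forall>e>0. \<exists>d>0. \<forall>z. norm z < d \<longrightarrow> (LINT y|lborel. norm (h (z + y) - h y)) < e"
  using assms
proof (induction rule: integrable_induct)
  case (base A c)
  show ?case
  proof (intro allI impI)
    fix e :: real assume "e > 0"
    then have "e / (norm c + 1) > 0" by (intro divide_pos_pos) (auto simp: add_nonneg_pos)
    from L1_translation_indicator[OF _ base(2) this] base(1) obtain d where d: "d > 0"
      "\<And>z. norm z < d \<Longrightarrow> (LINT y|lborel. norm (indicator A (z + y) - indicator A y :: real)) < e / (norm c + 1)"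
      by auto
    have "(LINT y|lborel. norm (indicator A (z + y) *\<^sub>R c - indicator A y *\<^sub>R c)) < e" if "norm z < d" for z
    proof -
      have "(LINT y|lborel. norm (indicator A (z + y) *\<^sub>R c - indicator A y *\<^sub>R c))
        = (LINT y|lborel. norm (indicator A (z + y) - indicator A y :: real)) * norm c"
        by (subst integral_mult_left_zero[symmetric]) (simp flip: left_diff_distrib add: abs_mult)
      also have "\<dots> \<le> (LINT y|lborel. norm (indicator A (z + y) - indicator A y :: real)) * (norm c + 1)"
        by (intro mult_left_mono) auto
      also have "\<dots> < e"
        using d(2)[OF that] by (simp add: pos_less_divide_eq add_nonneg_pos)
      finally show ?thesis .
    qed
    with d(1) show "\<exists>d>0. \<forall>z. norm z < d \<longrightarrow> (LINT y|lborel. norm (indicator A (z + y) *\<^sub>R c - indicator A y *\<^sub>R c)) < e"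
      by blast
  qed
next
  case (add f g)
  show ?case
  proof (intro allI impI)
    fix e :: real assume "e > 0"
    then have "e/2 > 0" by simp
    obtain d1 where d1: "d1 > 0" "\<And>z. norm z < d1 \<Longrightarrow> (LINT y|lborel. norm (f (z + y) - f y)) < e/2"
      using add.IH(1) \<open>e/2 > 0\<close> by blast
    obtain d2 where d2: "d2 > 0" "\<And>z. norm z < d2 \<Longrightarrow> (LINT y|lborel. norm (g (z + y) - g y)) < e/2"
      using add.IH(2) \<open>e/2 > 0\<close> by blast
    note [measurable] = borel_measurable_integrable_borel[OF add.hyps(1)] borel_measurable_integrable_borel[OF add.hyps(2)]
    have "(LINT y|lborel. norm (f (z + y) + g (z + y) - (f y + g y))) < e" if "norm z < min d1 d2" for z
    proof -
      have i: "integrable lborel (\<lambda>y. norm (f (z + y) - f y))" "integrable lborel (\<lambda>y. norm (g (z + y) - g y))"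
        using lborel_integral_shift(2)[of f z] lborel_integral_shift(2)[of g z] add.hyps
        by auto
      have "(LINT y|lborel. norm (f (z + y) + g (z + y) - (f y + g y)))
        \<le> (LINT y|lborel. norm (f (z + y) - f y) + norm (g (z + y) - g y))"
        by (rule integral_mono_AE') (use i in auto)
      then show ?thesis using d1(2)[of z] d2(2)[of z] that i by simp
    qed
    then show "\<exists>d>0. \<forall>z. norm z < d \<longrightarrow> (LINT y|lborel. norm (f (z + y) + g (z + y) - (f y + g y))) < e"
      using d1(1) d2(1) by (intro exI[of _ "min d1 d2"]) auto
  qed
next
  case (lim f s)
  note hm [measurable] = borel_measurable_integrable_borel[OF lim.hyps(4)]
  note sm [measurable] = borel_measurable_integrable_borel[OF lim.hyps(1)]
  show ?case
  proof (intro allI impI)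
    fix e :: real assume "e > 0"
    have "(\<lambda>i. LINT y|lborel. norm (s i y - f y)) \<longlonglongrightarrow> (LINT (y::'a)|lborel. norm (0::real))"
    proof (rule integral_dominated_convergence[where w="\<lambda>y. 3 * norm (f y)"])
      show "AE x in lborel. (\<lambda>i. norm (s i x - f x)) \<longlonglongrightarrow> norm (0::real)"
        using lim.hyps(2) by (intro AE_I2 tendsto_norm LIM_zero) auto
      show "AE x in lborel. norm (norm (s i x - f x)) \<le> 3 * norm (f x)" for i
      proof (rule AE_I2)
        fix x :: 'a
        have "norm (s i x) \<le> 2 * norm (f x)" using lim.hyps(3)[of x i] by auto
        then show "norm (norm (s i x - f x)) \<le> 3 * norm (f x)"
          using norm_triangle_ineq4[of "s i x" "f x"] by simp
      qed
    qed (use lim.hyps(4) in auto)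
    then have "(\<lambda>i. LINT y|lborel. norm (s i y - f y)) \<longlonglongrightarrow> 0" by simp
    then have "\<forall>\<^sub>F i in sequentially. (LINT y|lborel. norm (s i y - f y)) < e/3"
      using \<open>e > 0\<close> by (intro order_tendstoD) auto
    then obtain i where i: "(LINT y|lborel. norm (s i y - f y)) < e/3"
      using eventually_happens sequentially_bot by blast
    obtain d where d: "d > 0" "\<And>z. norm z < d \<Longrightarrow> (LINT y|lborel. norm (s i (z + y) - s i y)) < e/3"
    proof -
      have "e/3 > 0" using \<open>e > 0\<close> by simp
      then show ?thesis using that lim.IH[of i] by blast
    qed
    have "(LINT y|lborel. norm (f (z + y) - f y)) < e" if "norm z < d" for z
    proof -
      have I: "integrable lborel (\<lambda>y. norm (s i y - f y))" using lim.hyps(4) lim.hyps(1)[of i] by auto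
      have I2: "integrable lborel (\<lambda>y. norm (s i (z+y) - f (z+y)))"
        by (subst lborel_integral_shift(2)) (use I in auto)
      have I3: "integrable lborel (\<lambda>y. norm (s i (z + y) - s i y))"
        using lborel_integral_shift(2)[OF sm, of i z] lim.hyps(1)[of i] by (intro integrable_norm Bochner_Integration.integrable_diff) auto
      have "(LINT y|lborel. norm (f (z + y) - f y))
        \<le> (LINT y|lborel. norm (s i (z + y) - f (z + y)) + norm (s i (z+y) - s i y) + norm (s i y - f y))"
        by (rule integral_mono_AE') (use I I2 I3 in auto)
      also have "\<dots> = (LINT y|lborel. norm (s i (z + y) - f (z + y))) + (LINT y|lborel. norm (s i (z+y) - s i y)) + (LINT y|lborel. norm (s i y - f y))"
        using I I2 I3 by simp
      also have "(LINT y|lborel. norm (s i (z + y) - f (z + y))) = (LINT y|lborel. norm (s i y - f y))"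
        by (rule lborel_integral_shift(1)) measurable
      finally show ?thesis using i d(2)[OF that] by linarith
    qed
    then show "\<exists>d>0. \<forall>z. norm z < d \<longrightarrow> (LINT y|lborel. norm (f (z + y) - f y)) < e"
      using d(1) by blast
  qed
qed

section \<open>Continuity of translations in L^p\<close>

lemma power_sum3_le:
  fixes x y z :: real
  assumes "0 \<le> x" "0 \<le> y" "0 \<le> z"
  shows "(x + y + z) ^ p \<le> 3 ^ p * (x ^ p + y ^ p + z ^ p)"
proof -
  define m where "m = max x (max y z)"
  have "(x + y + z) ^ p \<le> (3 * m) ^ p"
    by (rule power_mono) (use assms in \<open>auto simp: m_def\<close>)
  also have "\<dots> = 3 ^ p * m ^ p" by (simp add: power_mult_distrib)
  also have "m ^ p \<le> x ^ p + y ^ p + z ^ p"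
    using assms by (auto simp: m_def max_def)
  finally show ?thesis by simp
qed

lemma power_sum2_le:
  fixes x y :: real
  assumes "0 \<le> x" "0 \<le> y"
  shows "(x + y) ^ p \<le> 2 ^ p * (x ^ p + y ^ p)"
proof -
  define m where "m = max x y"
  have "(x + y) ^ p \<le> (2 * m) ^ p"
    by (rule power_mono) (use assms in \<open>auto simp: m_def\<close>)
  also have "\<dots> = 2 ^ p * m ^ p" by (simp add: power_mult_distrib)
  also have "m ^ p \<le> x ^ p + y ^ p"
    using assms by (auto simp: m_def max_def)
  finally show ?thesis by simp
qed

lemma integrable_Lp_translation:
  fixes h :: "'a::euclidean_space \<Rightarrow> real"
  assumes [measurable]: "h \<in> borel_measurable borel" and "integrable lborel (\<lambda>x. \<bar>h x\<bar> ^ p)"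
  shows "integrable lborel (\<lambda>y. \<bar>h (z + y) - h y\<bar> ^ p)"
proof (rule Bochner_Integration.integrable_bound)
  show "integrable lborel (\<lambda>y. 2 ^ p * (\<bar>h (z + y)\<bar> ^ p + \<bar>h y\<bar> ^ p))"
    using assms lborel_integral_shift(2)[of "\<lambda>x. \<bar>h x\<bar> ^ p" z] by auto
  show "AE y in lborel. norm (\<bar>h (z + y) - h y\<bar> ^ p) \<le> norm (2 ^ p * (\<bar>h (z + y)\<bar> ^ p + \<bar>h y\<bar> ^ p))"
  proof (rule AE_I2)
    fix y
    have "\<bar>h (z + y) - h y\<bar> ^ p \<le> (\<bar>h (z + y)\<bar> + \<bar>h y\<bar>) ^ p"
      by (rule power_mono) auto
    also have "\<dots> \<le> 2 ^ p * (\<bar>h (z + y)\<bar> ^ p + \<bar>h y\<bar> ^ p)"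
      by (rule power_sum2_le) auto
    finally show "norm (\<bar>h (z + y) - h y\<bar> ^ p) \<le> norm (2 ^ p * (\<bar>h (z + y)\<bar> ^ p + \<bar>h y\<bar> ^ p))"
      by (simp add: abs_mult)
  qed
qed measurable

text \<open>Truncation at height \<open>M\<close> reduces the continuity of translations in \<open>L\<^sup>p\<close> to that in \<open>L\<^sup>1\<close>.\<close>
lemma Lp_translation:
  fixes h :: "'a::euclidean_space \<Rightarrow> real"
  assumes "integrable lborel h" and hp: "integrable lborel (\<lambda>x. \<bar>h x\<bar> ^ p)" and "p \<ge> 1" and "e > 0"
  shows "\<exists>d>0. \<forall>z. norm z < d \<longrightarrow> (LINT y|lborel. \<bar>h (z + y) - h y\<bar> ^ p) < e"
proof -
  note hm [measurable] = borel_measurable_integrable_borel[OF assms(1)]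
  define T where "T M t = max (- M) (min M t)" for M t :: real
  have [measurable]: "T M \<in> borel_measurable borel" for M
    unfolding T_def by measurable
  have Tb: "\<bar>t - T M t\<bar> \<le> \<bar>t\<bar>" if "M \<ge> 0" for M t
    using that by (auto simp: T_def max_def min_def)
  have "(\<lambda>n. LINT y|lborel. \<bar>h y - T (real n) (h y)\<bar> ^ p) \<longlonglongrightarrow> (LINT (y::'a)|lborel. (0::real))"
  proof (rule integral_dominated_convergence[where w="\<lambda>y. \<bar>h y\<bar> ^ p"])
    show "AE y in lborel. (\<lambda>n. \<bar>h y - T (real n) (h y)\<bar> ^ p) \<longlonglongrightarrow> 0"
    proof (rule AE_I2)
      fix y
      obtain N where N: "\<bar>h y\<bar> \<le> real N" using real_arch_simple by blast
      have "\<forall>\<^sub>F n in sequentially. \<bar>h y - T (real n) (h y)\<bar> ^ p = 0"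
        unfolding eventually_sequentially
      proof (intro exI[of _ N] allI impI)
        fix n assume "N \<le> n"
        then have "\<bar>h y\<bar> \<le> real n" using N by linarith
        then show "\<bar>h y - T (real n) (h y)\<bar> ^ p = 0"
          using \<open>p \<ge> 1\<close> by (auto simp: T_def)
      qed
      then show "(\<lambda>n. \<bar>h y - T (real n) (h y)\<bar> ^ p) \<longlonglongrightarrow> 0"
        by (rule tendsto_eventually)
    qed
    show "AE y in lborel. norm (\<bar>h y - T (real n) (h y)\<bar> ^ p) \<le> \<bar>h y\<bar> ^ p" for n
      by (rule AE_I2) (auto intro!: power_mono Tb)
  qed (use hp in auto)
  moreover have "e / (3 * 3 ^ p) > 0" using \<open>e > 0\<close> by simp
  ultimately have "\<forall>\<^sub>F n in sequentially. (LINT y|lborel. \<bar>h y - T (real n) (h y)\<bar> ^ p) < e / (3 * 3 ^ p)"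
    by (intro order_tendstoD) auto
  then obtain n where n: "(LINT y|lborel. \<bar>h y - T (real n) (h y)\<bar> ^ p) < e / (3 * 3 ^ p)"
    using eventually_happens sequentially_bot by blast
  \<comment> \<open>Truncated values differ by at most \<open>2 * real n\<close> and truncation is
    1-Lipschitz, so the p-th power of their difference is at most \<open>c\<close> times the
    untruncated difference. One factor is kept for the L^1 estimate.\<close>
  define c where "c = (2 * real n) ^ (p - 1)"
  have "c \<ge> 0" by (simp add: c_def)
  have "e / (3 * 3 ^ p * (c + 1)) > 0" using \<open>e > 0\<close> \<open>c \<ge> 0\<close> by (simp add: add_nonneg_pos)
  then obtain d where d: "d > 0"
    "\<And>z. norm z < d \<Longrightarrow> (LINT y|lborel. norm (h (z + y) - h y)) < e / (3 * 3 ^ p * (c + 1))"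
    using L1_translation[OF assms(1)] by blast
  have "(LINT y|lborel. \<bar>h (z + y) - h y\<bar> ^ p) < e" if "norm z < d" for z
  proof -
    define g where "g y = \<bar>h y - T (real n) (h y)\<bar> ^ p" for y
    have gm [measurable]: "g \<in> borel_measurable borel" unfolding g_def by measurable
    have gi: "integrable lborel g" unfolding g_def
      by (rule Bochner_Integration.integrable_bound[OF hp]) (auto intro!: power_mono Tb)
    have gi2: "integrable lborel (\<lambda>y. g (z + y))"
      using lborel_integral_shift(2)[OF gm] gi by blast
    have hi: "integrable lborel (\<lambda>y. norm (h (z + y) - h y))"
      using lborel_integral_shift(2)[OF hm, of z] assms(1) by (intro integrable_norm Bochner_Integration.integrable_diff) auto
    have "(LINT y|lborel. \<bar>h (z + y) - h y\<bar> ^ p) \<le>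
      (LINT y|lborel. 3 ^ p * (g (z + y) + g y + c * norm (h (z + y) - h y)))"
    proof (rule integral_mono)
      show "integrable lborel (\<lambda>y. \<bar>h (z + y) - h y\<bar> ^ p)"
        by (rule integrable_Lp_translation[OF hm hp])
      show "integrable lborel (\<lambda>y. 3 ^ p * (g (z + y) + g y + c * norm (h (z + y) - h y)))"
        by (intro integrable_mult_right Bochner_Integration.integrable_add gi gi2 hi)
      fix y
      define a b where "a = h (z + y)" and "b = h y"
      have "\<bar>a - b\<bar> ^ p \<le> (\<bar>a - T (real n) a\<bar> + \<bar>b - T (real n) b\<bar> + \<bar>T (real n) a - T (real n) b\<bar>) ^ p"
        by (rule power_mono) auto
      also have "\<dots> \<le> 3 ^ p * (\<bar>a - T (real n) a\<bar> ^ p + \<bar>b - T (real n) b\<bar> ^ p + \<bar>T (real n) a - T (real n) b\<bar> ^ p)"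
        by (rule power_sum3_le) auto
      also have "\<bar>T (real n) a - T (real n) b\<bar> ^ p = \<bar>T (real n) a - T (real n) b\<bar> ^ (p - 1) * \<bar>T (real n) a - T (real n) b\<bar>"
        using \<open>p \<ge> 1\<close> by (metis power_minus_mult zero_less_one order_less_le_trans)
      also have "\<dots> \<le> c * \<bar>a - b\<bar>"
        unfolding c_def
        by (intro mult_mono power_mono) (auto simp: T_def max_def min_def)
      finally show "\<bar>h (z + y) - h y\<bar> ^ p \<le> 3 ^ p * (g (z + y) + g y + c * norm (h (z + y) - h y))"
        by (simp add: a_def b_def g_def)
    qed
    also have "\<dots> = 3 ^ p * ((LINT y|lborel. g (z + y)) + (LINT y|lborel. g y) + c * (LINT y|lborel. norm (h (z + y) - h y)))"
      using gi gi2 hi by simp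
    also have "(LINT y|lborel. g (z + y)) = (LINT y|lborel. g y)"
      by (rule lborel_integral_shift(1)[OF gm])
    also have "3 ^ p * ((LINT y|lborel. g y) + (LINT y|lborel. g y) + c * (LINT y|lborel. norm (h (z + y) - h y))) < 3 ^ p * (e / (3 * 3 ^ p) + e / (3 * 3 ^ p) + e / (3 * 3 ^ p))"
    proof (intro mult_strict_left_mono add_less_le_mono add_strict_mono)
      have "c * (LINT y|lborel. norm (h (z + y) - h y)) \<le> (c + 1) * (e / (3 * 3 ^ p * (c + 1)))"
        using d(2)[OF that] \<open>c \<ge> 0\<close> by (intro mult_mono) auto
      also have "\<dots> = e / (3 * 3 ^ p)"
      proof -
        have "c + 1 \<noteq> 0" using \<open>c \<ge> 0\<close> by linarith
        then show ?thesis by simp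
      qed
      finally show "c * (LINT y|lborel. norm (h (z + y) - h y)) \<le> e / (3 * 3 ^ p)" .
    qed (use n in \<open>auto simp: g_def\<close>)
    also have "\<dots> = e" by (simp add: field_simps)
    finally show ?thesis .
  qed
  then show ?thesis using d(1) by blast
qed

text \<open>The kernel is evaluated at \<open>x - y\<close>, so the value at \<open>y\<close> is the
  pairing of \<open>h\<close> with the kernel translated to \<open>y\<close>, exactly as in the
  definition of a weak derivative. The price is a minus sign for every derivative in
  \<open>y\<close>.\<close>

definition conv :: "('a::euclidean_space \<Rightarrow> real) \<Rightarrow> ('a \<Rightarrow> real) \<Rightarrow> 'a \<Rightarrow> real" where
  "conv h \<phi> y = (LINT x|lborel. h x * \<phi> (x - y))"

lemma conv_borel:
  assumes [measurable]: "h \<in> borel_measurable borel" "\<phi> \<in> borel_measurable borel"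
  shows "conv h \<phi> y = (LINT z|lborel. h (z + y) * \<phi> z)"
proof -
  have "conv h \<phi> y = (LINT z|lborel. h (y + z) * \<phi> (y + z - y))"
    unfolding conv_def by (rule lborel_integral_shift(1)[symmetric]) measurable
  then show ?thesis by (simp add: add.commute)
qed

text \<open>An odd power is convex only on the half-line; the triangle inequality reduces the claim
  to nonnegative arguments.\<close>

lemma convex_on_abs_power: "convex_on UNIV (\<lambda>x::real. \<bar>x\<bar> ^ p)"
proof (cases "p = 0")
  case True then show ?thesis by (simp add: convex_on_const)
next
  case False
  show ?thesis
  proof (rule convex_onI)
    fix t x y :: real assume t: "0 < t" "t < 1"
    have c: "convex_on {0..} (\<lambda>x::real. x ^ p)"
      using convex_power_odd[of p] convex_on_subset[OF convex_power_even[of p], of "{0..}"] by auto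
    have "\<bar>(1 - t) *\<^sub>R x + t *\<^sub>R y\<bar> ^ p \<le> ((1 - t) * \<bar>x\<bar> + t * \<bar>y\<bar>) ^ p"
    proof (rule power_mono)
      show "\<bar>(1 - t) *\<^sub>R x + t *\<^sub>R y\<bar> \<le> (1 - t) * \<bar>x\<bar> + t * \<bar>y\<bar>"
        using t abs_triangle_ineq[of "(1 - t) * x" "t * y"] by (simp add: abs_mult)
    qed simp
    also have "\<dots> \<le> (1 - t) * \<bar>x\<bar> ^ p + t * \<bar>y\<bar> ^ p"
      using convex_onD[OF c, of t "\<bar>x\<bar>" "\<bar>y\<bar>"] t by simp
    finally show "\<bar>(1 - t) *\<^sub>R x + t *\<^sub>R y\<bar> ^ p \<le> (1 - t) * \<bar>x\<bar> ^ p + t * \<bar>y\<bar> ^ p" .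
  qed simp
qed

text \<open>With \<phi> as a probability density, \<open>conv h \<phi> y - h y\<close> is the mean
  of \<open>h (z + y) - h y\<close>. Jensen's inequality moves the p-th power inside the mean, and
  exchanging the integrals leaves a mean of translation differences over \<open>norm z < d\<close>,
  each at most \<open>e\<close>.\<close>

lemma Lp_mollify_bound:
  fixes h \<phi> :: "'a::euclidean_space \<Rightarrow> real"
  assumes hi: "integrable lborel h" and hp: "integrable lborel (\<lambda>x. \<bar>h x\<bar> ^ p)"
    and \<phi>i: "integrable lborel \<phi>" and \<phi>1: "(LINT x|lborel. \<phi> x) = 1"
    and \<phi>0: "\<And>x. 0 \<le> \<phi> x" and \<phi>B: "\<And>x. \<phi> x \<le> B" and \<phi>d: "\<And>x. norm x \<ge> d \<Longrightarrow> \<phi> x = 0"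
    and e: "\<And>z. norm z < d \<Longrightarrow> (LINT y|lborel. \<bar>h (z + y) - h y\<bar> ^ p) \<le> e"
    and "e \<ge> 0"
  shows "integrable lborel (\<lambda>y. \<bar>conv h \<phi> y - h y\<bar> ^ p)" (is ?I)
    and "(LINT y|lborel. \<bar>conv h \<phi> y - h y\<bar> ^ p) \<le> e" (is ?B)
proof -
  note hm [measurable] = borel_measurable_integrable_borel[OF hi]
  note \<phi>m [measurable] = borel_measurable_integrable_borel[OF \<phi>i]
  let ?M = "density lborel (\<lambda>x. ennreal (\<phi> x))"
  interpret prob_space ?M
  proof
    have "emeasure ?M (space ?M) = (\<integral>\<^sup>+x. ennreal (\<phi> x) \<partial>lborel)"
      by (simp add: emeasure_density)
    also have "\<dots> = 1" using \<phi>i \<phi>1 \<phi>0 by (subst nn_integral_eq_integral) auto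
    finally show "emeasure ?M (space ?M) = 1" .
  qed
  have B0: "B \<ge> 0" using \<phi>0 \<phi>B by (meson order_trans)
  have bi: "integrable lborel (\<lambda>z. \<phi> z * f z)" if "integrable lborel f" for f :: "'a \<Rightarrow> real"
  proof (rule Bochner_Integration.integrable_bound)
    show "integrable lborel (\<lambda>z. B * f z)" using that by simp
    show "(\<lambda>z. \<phi> z * f z) \<in> borel_measurable lborel"
      using borel_measurable_integrable_borel[OF that] by measurable
    show "AE z in lborel. norm (\<phi> z * f z) \<le> norm (B * f z)"
      using \<phi>0 \<phi>B B0 by (auto simp: abs_mult intro!: mult_right_mono)
  qed
  have J: "\<bar>conv h \<phi> y - h y\<bar> ^ p \<le> (LINT z|lborel. \<phi> z * \<bar>h (z + y) - h y\<bar> ^ p)"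
    and Ji: "integrable lborel (\<lambda>z. \<phi> z * \<bar>h (z + y) - h y\<bar> ^ p)" for y
  proof -
    have h1: "integrable lborel (\<lambda>z. h (z + y))"
      using lborel_integral_shift(2)[OF hm, of y] hi by (simp add: add.commute)
    have h2: "integrable lborel (\<lambda>z. \<bar>h (z + y)\<bar> ^ p)"
      using lborel_integral_shift(2)[of "\<lambda>x. \<bar>h x\<bar> ^ p" y] hp by (simp add: add.commute)
    have i1: "integrable lborel (\<lambda>z. \<phi> z * (h (z + y) - h y))"
      using bi[OF h1] \<phi>i by (simp add: right_diff_distrib)
    show i2: "integrable lborel (\<lambda>z. \<phi> z * \<bar>h (z + y) - h y\<bar> ^ p)"
    proof (rule Bochner_Integration.integrable_bound)
      show "integrable lborel (\<lambda>z. 2 ^ p * (\<phi> z * \<bar>h (z + y)\<bar> ^ p) + 2 ^ p * (\<phi> z * \<bar>h y\<bar> ^ p))"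
        using bi[OF h2] \<phi>i by simp
      show "AE z in lborel. norm (\<phi> z * \<bar>h (z + y) - h y\<bar> ^ p) \<le> norm (2 ^ p * (\<phi> z * \<bar>h (z + y)\<bar> ^ p) + 2 ^ p * (\<phi> z * \<bar>h y\<bar> ^ p))"
      proof (rule AE_I2)
        fix z
        have "\<bar>h (z + y) - h y\<bar> ^ p \<le> (\<bar>h (z + y)\<bar> + \<bar>h y\<bar>) ^ p"
          by (rule power_mono) auto
        also have "\<dots> \<le> 2 ^ p * (\<bar>h (z + y)\<bar> ^ p + \<bar>h y\<bar> ^ p)"
          by (rule power_sum2_le) auto
        finally have "\<phi> z * \<bar>h (z + y) - h y\<bar> ^ p \<le> \<phi> z * (2 ^ p * (\<bar>h (z + y)\<bar> ^ p + \<bar>h y\<bar> ^ p))"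
          using \<phi>0 by (rule mult_left_mono)
        moreover have "0 \<le> \<phi> z * \<bar>h (z + y) - h y\<bar> ^ p" using \<phi>0 by simp
        ultimately show "norm (\<phi> z * \<bar>h (z + y) - h y\<bar> ^ p) \<le> norm (2 ^ p * (\<phi> z * \<bar>h (z + y)\<bar> ^ p) + 2 ^ p * (\<phi> z * \<bar>h y\<bar> ^ p))"
          by (simp add: algebra_simps)
      qed
    qed measurable
    have Mint: "integrable ?M g \<longleftrightarrow> integrable lborel (\<lambda>z. \<phi> z * g z)"
      and Meq: "integral\<^sup>L ?M g = (LINT z|lborel. \<phi> z * g z)"
      if "g \<in> borel_measurable borel" for g :: "'a \<Rightarrow> real"
      using that \<phi>0 by (simp_all add: integrable_density integral_density)
    have "\<bar>expectation (\<lambda>z. h (z + y) - h y)\<bar> ^ p \<le> expectation (\<lambda>z. \<bar>h (z + y) - h y\<bar> ^ p)"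
      by (rule jensens_inequality[where I=UNIV]) (use i1 i2 convex_on_abs_power in \<open>auto simp: Mint\<close>)
    moreover have "expectation (\<lambda>z. h (z + y) - h y) = (LINT z|lborel. \<phi> z * (h (z + y) - h y))"
      by (rule Meq) measurable
    moreover have "\<dots> = (LINT z|lborel. \<phi> z * h (z + y)) - h y"
      using bi[OF h1] \<phi>i \<phi>1 by (simp add: right_diff_distrib)
    moreover have "(LINT z|lborel. \<phi> z * h (z + y)) = conv h \<phi> y"
      by (subst conv_borel) (auto simp: mult.commute)
    moreover have "expectation (\<lambda>z. \<bar>h (z + y) - h y\<bar> ^ p) = (LINT z|lborel. \<phi> z * \<bar>h (z + y) - h y\<bar> ^ p)"
      by (rule Meq) measurable
    ultimately show "\<bar>conv h \<phi> y - h y\<bar> ^ p \<le> (LINT z|lborel. \<phi> z * \<bar>h (z + y) - h y\<bar> ^ p)" by simp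
  qed
  have [measurable]: "conv h \<phi> \<in> borel_measurable borel"
  proof -
    have "(\<lambda>y. LINT z|lborel. h (z + y) * \<phi> z) \<in> borel_measurable lborel" by measurable
    moreover have "conv h \<phi> = (\<lambda>y. LINT z|lborel. h (z + y) * \<phi> z)"
      by (rule ext, rule conv_borel) measurable
    ultimately show ?thesis by simp
  qed
  have le: "(\<integral>\<^sup>+y. ennreal (\<bar>conv h \<phi> y - h y\<bar> ^ p) \<partial>lborel) \<le> ennreal e"
  proof -
    have "(\<integral>\<^sup>+y. ennreal (\<bar>conv h \<phi> y - h y\<bar> ^ p) \<partial>lborel)
      \<le> (\<integral>\<^sup>+y. (\<integral>\<^sup>+z. ennreal (\<phi> z * \<bar>h (z + y) - h y\<bar> ^ p) \<partial>lborel) \<partial>lborel)"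
    proof (rule nn_integral_mono)
      fix y
      have "(\<integral>\<^sup>+z. ennreal (\<phi> z * \<bar>h (z + y) - h y\<bar> ^ p) \<partial>lborel) = ennreal (LINT z|lborel. \<phi> z * \<bar>h (z + y) - h y\<bar> ^ p)"
        by (rule nn_integral_eq_integral) (use Ji \<phi>0 in auto)
      then show "ennreal (\<bar>conv h \<phi> y - h y\<bar> ^ p) \<le> (\<integral>\<^sup>+z. ennreal (\<phi> z * \<bar>h (z + y) - h y\<bar> ^ p) \<partial>lborel)"
        using J[of y] by (simp add: ennreal_leI)
    qed
    also have "\<dots> = (\<integral>\<^sup>+z. (\<integral>\<^sup>+y. ennreal (\<phi> z * \<bar>h (z + y) - h y\<bar> ^ p) \<partial>lborel) \<partial>lborel)"
      by (rule lborel_pair.Fubini') measurable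
    also have "\<dots> \<le> (\<integral>\<^sup>+z. ennreal (\<phi> z * e) \<partial>lborel)"
    proof (rule nn_integral_mono)
      fix z
      show "(\<integral>\<^sup>+y. ennreal (\<phi> z * \<bar>h (z + y) - h y\<bar> ^ p) \<partial>lborel) \<le> ennreal (\<phi> z * e)"
      proof (cases "norm z < d")
        case True
        have "(\<integral>\<^sup>+y. ennreal (\<phi> z * \<bar>h (z + y) - h y\<bar> ^ p) \<partial>lborel) = ennreal (LINT y|lborel. \<phi> z * \<bar>h (z + y) - h y\<bar> ^ p)"
          by (rule nn_integral_eq_integral) (use integrable_Lp_translation[OF hm hp] \<phi>0 in auto)
        then show ?thesis using e[OF True] \<phi>0[of z] by (auto intro!: ennreal_leI mult_left_mono)
      next
        case False
        then show ?thesis by (simp add: \<phi>d)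
      qed
    qed
    also have "\<dots> = ennreal (LINT z|lborel. \<phi> z * e)"
      by (rule nn_integral_eq_integral) (use \<phi>i \<phi>0 \<open>e \<ge> 0\<close> in auto)
    also have "\<dots> = ennreal e" using \<phi>1 by simp
    finally show ?thesis .
  qed
  show ?I
  proof (rule integrableI_bounded)
    show "(\<integral>\<^sup>+y. ennreal (norm (\<bar>conv h \<phi> y - h y\<bar> ^ p)) \<partial>lborel) < \<infinity>"
      using le by (simp add: le_less_trans[OF le] power_abs)
  qed measurable
  then have "(\<integral>\<^sup>+y. ennreal (\<bar>conv h \<phi> y - h y\<bar> ^ p) \<partial>lborel) = ennreal (LINT y|lborel. \<bar>conv h \<phi> y - h y\<bar> ^ p)"
    by (rule nn_integral_eq_integral) auto
  with le \<open>e \<ge> 0\<close> show ?B by simp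
qed

section \<open>Bump functions\<close>

text \<open>The power in the denominator is there for differentiation: the derivative of a member of
  the family is a linear combination of the members with indices \<open>k + 1\<close> and
  \<open>k + 2\<close>.\<close>

definition exp_flat :: "nat \<Rightarrow> real \<Rightarrow> real" where
  "exp_flat k t = (if t > 0 then exp (- (1 / t)) / t ^ k else 0)"

lemma exp_flat_tendsto_0: "(exp_flat k \<longlongrightarrow> 0) (at_right 0)"
proof -
  have "((\<lambda>t::real. inverse t ^ k / exp (inverse t)) \<longlongrightarrow> 0) (at_right 0)"
    by (rule filterlim_compose[OF tendsto_power_div_exp_0 filterlim_inverse_at_top_right])
  moreover have "\<forall>\<^sub>F t in at_right 0. inverse t ^ k / exp (inverse t) = exp_flat k t"
    using eventually_at_right_less[of 0]
    by eventually_elim (simp add: exp_flat_def exp_minus divide_simps)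
  ultimately show ?thesis
    by (blast intro: Lim_transform_eventually)
qed

text \<open>Only \<open>t = 0\<close> needs an argument: there the difference quotient is
  \<open>exp_flat (k + 1)\<close> on the right, which tends to 0, and vanishes on the left.\<close>

lemma exp_flat_has_derivative:
  "(exp_flat k has_real_derivative exp_flat (k + 2) t - real k * exp_flat (k + 1) t) (at t)"
proof -
  consider "t > 0" | "t < 0" | "t = 0" by linarith
  then show ?thesis
  proof cases
    case 1
    have d: "((\<lambda>t. exp (- (1 / t)) / t ^ k) has_real_derivative exp_flat (k + 2) t - real k * exp_flat (k + 1) t) (at t)"
      using 1 by (cases k) (auto intro!: derivative_eq_intros simp: exp_flat_def field_simps power2_eq_square,
        metis power_eq_if One_nat_def)
    have e: "\<forall>\<^sub>F s in nhds t. exp (- (1 / s)) / s ^ k = exp_flat k s"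
      using 1 by (intro eventually_nhds_in_open[of "{0<..}", THEN eventually_mono]) (auto simp: exp_flat_def)
    show ?thesis
      by (rule iffD1[OF DERIV_cong_ev[OF refl e refl] d])
  next
    case 2
    have d: "((\<lambda>t. 0) has_real_derivative exp_flat (k + 2) t - real k * exp_flat (k + 1) t) (at t)"
      using 2 by (auto simp: exp_flat_def)
    have e: "\<forall>\<^sub>F s in nhds t. 0 = exp_flat k s"
      using 2 by (intro eventually_nhds_in_open[of "{..<0}", THEN eventually_mono]) (auto simp: exp_flat_def)
    show ?thesis
      by (rule iffD1[OF DERIV_cong_ev[OF refl e refl] d])
  next
    case 3
    have r: "((\<lambda>s. exp_flat k s / s) \<longlongrightarrow> 0) (at_right 0)"
    proof (rule Lim_transform_eventually[OF exp_flat_tendsto_0[of "k + 1"]])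
      show "\<forall>\<^sub>F s in at_right 0. exp_flat (k + 1) s = exp_flat k s / s"
        using eventually_at_right_less[of 0]
        by eventually_elim (simp add: exp_flat_def)
    qed
    have l: "((\<lambda>s. exp_flat k s / s) \<longlongrightarrow> 0) (at_left 0)"
    proof (rule Lim_transform_eventually[OF tendsto_const])
      show "\<forall>\<^sub>F s in at_left 0. 0 = exp_flat k s / s"
        unfolding eventually_at_left_field by (intro exI[of _ "-1"]) (auto simp: exp_flat_def)
    qed
    have "((\<lambda>s. exp_flat k s / s) \<longlongrightarrow> 0) (at 0)"
      using filterlim_split_at[OF l r] .
    then show ?thesis
      using 3 unfolding has_field_derivative_iff by (simp add: exp_flat_def)
  qed
qed

text \<open>The generators are chosen so that the class is closed under partial derivatives.\<close>
inductive_set bump_class :: "real^'n \<Rightarrow> real \<Rightarrow> (real^'n \<Rightarrow> real) set" for y :: "real^'n" and c :: real where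
  base: "(\<lambda>x. exp_flat k (c - (x - y) \<bullet> (x - y))) \<in> bump_class y c"
| add: "f \<in> bump_class y c \<Longrightarrow> g \<in> bump_class y c \<Longrightarrow> (\<lambda>x. f x + g x) \<in> bump_class y c"
| coord: "f \<in> bump_class y c \<Longrightarrow> (\<lambda>x. (x - y) $ i * f x) \<in> bump_class y c"
| scale: "f \<in> bump_class y c \<Longrightarrow> (\<lambda>x. r * f x) \<in> bump_class y c"

lemma pderiv_at_eqI:
  assumes "(f has_derivative f') (at x)"
  shows "pderiv_at i f x = f' (axis i 1)"
  unfolding pderiv_at_def using frechet_derivative_at[OF assms] by simp

lemma bump_class_base_has_derivative:
  "((\<lambda>x. exp_flat k (c - (x - y) \<bullet> (x - y))) has_derivative
     (\<lambda>t. (exp_flat (k + 2) (c - (x - y) \<bullet> (x - y)) - real k * exp_flat (k + 1) (c - (x - y) \<bullet> (x - y)))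
          * (- 2 * ((x - y) \<bullet> t)))) (at x)"
proof -
  have "((\<lambda>x. c - (x - y) \<bullet> (x - y)) has_derivative (\<lambda>t. - 2 * ((x - y) \<bullet> t))) (at x)"
    by (auto intro!: derivative_eq_intros simp: inner_commute)
  from has_derivative_compose[OF this exp_flat_has_derivative[unfolded has_field_derivative_def]]
  show ?thesis by simp
qed

lemma bump_class_pderiv:
  assumes "f \<in> bump_class y c"
  shows "(\<forall>x. f differentiable (at x)) \<and> pderiv_at i f \<in> bump_class y c"
  using assms
proof induction
  case (base k)
  let ?s = "\<lambda>x. c - (x - y) \<bullet> (x - y)"
  have "pderiv_at i (\<lambda>x. exp_flat k (?s x)) =
    (\<lambda>x. (-2) * ((x - y) $ i * (exp_flat (k + 2) (?s x) + (- real k) * exp_flat (k + 1) (?s x))))"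
    by (rule ext, subst pderiv_at_eqI[OF bump_class_base_has_derivative]) (simp add: inner_axis algebra_simps)
  moreover have "\<dots> \<in> bump_class y c"
    by (intro bump_class.intros)
  moreover have "(\<lambda>x. exp_flat k (?s x)) differentiable (at x)" for x
    using bump_class_base_has_derivative by (rule differentiableI)
  ultimately show ?case by simp
next
  case (add f g)
  then have d: "(f has_derivative frechet_derivative f (at x)) (at x)" "(g has_derivative frechet_derivative g (at x)) (at x)" for x
    by (simp_all add: frechet_derivative_works)
  have "pderiv_at i (\<lambda>x. f x + g x) = (\<lambda>x. pderiv_at i f x + pderiv_at i g x)"
    by (rule ext, subst pderiv_at_eqI[OF has_derivative_add[OF d]]) (simp add: pderiv_at_def)
  with add show ?case by (auto intro: bump_class.intros)
next
  case (coord f j)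
  then have d: "(f has_derivative frechet_derivative f (at x)) (at x)" for x
    by (simp_all add: frechet_derivative_works)
  have c: "((\<lambda>x. (x - y) $ j) has_derivative (\<lambda>t. t $ j)) (at x)" for x
    by (auto intro!: derivative_eq_intros bounded_linear.has_derivative[OF bounded_linear_vec_nth])
  have "pderiv_at i (\<lambda>x. (x - y) $ j * f x) = (\<lambda>x. (x - y) $ j * pderiv_at i f x + axis i 1 $ j * f x)"
    by (rule ext, subst pderiv_at_eqI[OF has_derivative_mult[OF c d]]) (simp add: pderiv_at_def)
  moreover have "(\<lambda>x. (x - y) $ j * f x) differentiable at x" for x
    using has_derivative_mult[OF c d] by (auto simp: differentiable_def)
  moreover have "(\<lambda>x. (x - y) $ j * pderiv_at i f x + axis i 1 $ j * f x) \<in> bump_class y c"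
    using coord by (intro bump_class.intros) auto
  ultimately show ?case by (simp only:) blast
next
  case (scale f r)
  then have d: "(f has_derivative frechet_derivative f (at x)) (at x)" for x
    by (simp_all add: frechet_derivative_works)
  have "pderiv_at i (\<lambda>x. r * f x) = (\<lambda>x. r * pderiv_at i f x)"
    by (rule ext, subst pderiv_at_eqI[OF has_derivative_mult_right[OF d]]) (simp add: pderiv_at_def)
  with scale show ?case by (auto intro: bump_class.intros)
qed

lemma bump_class_iter_pderiv: "f \<in> bump_class y c \<Longrightarrow> iter_pderiv js f \<in> bump_class y c"
  by (induction js) (auto simp: bump_class_pderiv)

lemma bump_class_smooth: "f \<in> bump_class y c \<Longrightarrow> smooth_fun f"
  unfolding smooth_fun_def using bump_class_iter_pderiv bump_class_pderiv by blast

lemma bump_class_support: "f \<in> bump_class y c \<Longrightarrow> (x - y) \<bullet> (x - y) \<ge> c \<Longrightarrow> f x = 0"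
  by (induction rule: bump_class.induct) (auto simp: exp_flat_def)

text \<open>The profile exp (-1 / (d^2 - |x|^2)); using the squared norm keeps it smooth at the
  origin.\<close>

definition bump :: "real \<Rightarrow> real^'n \<Rightarrow> real" where
  "bump d x = exp_flat 0 (d\<^sup>2 - x \<bullet> x)"

lemma bump_shift_in_class: "(\<lambda>x. bump d (x - y)) \<in> bump_class y (d\<^sup>2)"
  unfolding bump_def by (rule bump_class.base)

lemma bump_in_class: "bump d \<in> bump_class 0 (d\<^sup>2)"
  using bump_shift_in_class[of d 0] by simp

lemma bump_class_support_subset:
  assumes "f \<in> bump_class y (d\<^sup>2)" "d > 0"
  shows "closure {x. f x \<noteq> 0} \<subseteq> cball y d"
proof (rule closure_minimal)
  show "{x. f x \<noteq> 0} \<subseteq> cball y d"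
  proof
    fix x assume "x \<in> {x. f x \<noteq> 0}"
    then have "(x - y) \<bullet> (x - y) < d\<^sup>2"
      using bump_class_support[OF assms(1), of x] by force
    then have "norm (x - y) < d"
      using assms(2) by (simp add: norm_eq_sqrt_inner real_less_lsqrt)
    then show "x \<in> cball y d" by (simp add: dist_norm norm_minus_commute)
  qed
qed simp

lemma bump_class_test_function:
  assumes "f \<in> bump_class y (d\<^sup>2)" "d > 0" "cball y d \<subseteq> U"
  shows "f \<in> test_functions U"
proof -
  have "closure {x. f x \<noteq> 0} \<subseteq> cball y d"
    by (rule bump_class_support_subset[OF assms(1,2)])
  moreover have "compact (closure {x. f x \<noteq> 0})"
    using calculation compact_Int_closed[OF compact_cball, of "closure {x. f x \<noteq> 0}" y d]
    by (simp add: inf.absorb2)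
  ultimately show ?thesis
    using assms bump_class_smooth by (auto simp: test_functions_def)
qed

lemma bump_pderiv:
  "pderiv_at i (bump d) x = - 2 * (x $ i) * exp_flat 2 (d\<^sup>2 - x \<bullet> x)"
  unfolding bump_def
  using pderiv_at_eqI[OF bump_class_base_has_derivative[of 0 "d\<^sup>2" 0 x], of i]
  by (simp add: inner_axis numeral_2_eq_2)

text \<open>The mixed derivative is computed explicitly and the formula is symmetric in
  \<open>i\<close> and \<open>j\<close>. This is what makes the Hessians of the mollifications
  symmetric at every point, as the matrix lemmas require.\<close>

lemma bump_pderiv2_commute:
  "pderiv_at i (pderiv_at j (bump d)) x = pderiv_at j (pderiv_at i (bump d)) x"
proof -
  let ?D = "exp_flat 4 (d\<^sup>2 - x \<bullet> x) - 2 * exp_flat 3 (d\<^sup>2 - x \<bullet> x)"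
  have eq: "pderiv_at i (pderiv_at j (bump d)) x
      = 4 * (x $ i) * (x $ j) * ?D - 2 * (axis i 1 $ j) * exp_flat 2 (d\<^sup>2 - x \<bullet> x)" for i j
  proof -
    have *: "((\<lambda>x. - 2 * (x $ j) * exp_flat 2 (d\<^sup>2 - x \<bullet> x)) has_derivative
        (\<lambda>t. - 2 * (x $ j) * (?D * (- 2 * (x \<bullet> t))) + - 2 * (t $ j) * exp_flat 2 (d\<^sup>2 - x \<bullet> x))) (at x)"
      using bump_class_base_has_derivative[of 2 "d\<^sup>2" 0 x]
      by (intro has_derivative_mult has_derivative_mult_right bounded_linear.has_derivative[OF bounded_linear_vec_nth] has_derivative_ident)
         (simp add: eval_nat_numeral)
    have "pderiv_at j (bump d) = (\<lambda>x. - 2 * (x $ j) * exp_flat 2 (d\<^sup>2 - x \<bullet> x))"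
      by (rule ext, rule bump_pderiv)
    then show ?thesis using pderiv_at_eqI[OF *, of i] by (simp add: inner_axis algebra_simps)
  qed
  show ?thesis unfolding eq by (simp add: axis_def algebra_simps)
qed

lemma pderiv_at_shift:
  assumes "\<And>x. f differentiable (at x)"
  shows "pderiv_at i (\<lambda>x. f (x - y)) = (\<lambda>x. pderiv_at i f (x - y))"
proof
  fix x
  have f: "(f has_derivative frechet_derivative f (at (x - y))) (at (x - y))"
    using assms frechet_derivative_works by blast
  have "((\<lambda>x. x - y) has_derivative (\<lambda>t. t)) (at x)"
    by (auto intro!: derivative_eq_intros)
  from has_derivative_compose[OF this f]
  show "pderiv_at i (\<lambda>x. f (x - y)) x = pderiv_at i f (x - y)"
    by (subst pderiv_at_eqI) (auto simp: pderiv_at_def)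
qed

lemma iter_pderiv_shift:
  assumes "smooth_fun f"
  shows "iter_pderiv js (\<lambda>x. f (x - y)) = (\<lambda>x. iter_pderiv js f (x - y))"
  by (induction js) (use assms in \<open>auto simp: pderiv_at_shift smooth_fun_def\<close>)

section \<open>Convolution with the mollifier\<close>

text \<open>By uniform continuity of the partial derivatives, the first-order remainder of \<phi> is
  small relative to the increment uniformly in \<open>x\<close>; multiplied by the integrable
  \<open>h\<close> it stays small after integration. The sign comes from \<open>y\<close> entering
  through \<open>x - y\<close>.\<close>

lemma conv_has_derivative:
  fixes h \<phi> :: "real^'n \<Rightarrow> real" and P :: "'n \<Rightarrow> real^'n \<Rightarrow> real"
  assumes hi: "integrable lborel h"
    and der: "\<And>x. (\<phi> has_derivative (\<lambda>t. \<Sum>i\<in>UNIV. t $ i * P i x)) (at x)"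
    and ucont: "\<And>i. uniformly_continuous_on UNIV (P i)"
    and bP: "\<And>i. bounded (range (P i))" and b\<phi>: "bounded (range \<phi>)"
  shows "(conv h \<phi> has_derivative (\<lambda>t. \<Sum>i\<in>UNIV. t $ i * - conv h (P i) y)) (at y)"
proof -
  note hm [measurable] = borel_measurable_integrable_borel[OF hi]
  have "continuous_on UNIV \<phi>"
    using der by (meson has_derivative_continuous_on has_derivative_at_withinI)
  then have \<phi>m [measurable]: "\<phi> \<in> borel_measurable borel" by (rule borel_measurable_continuous_onI)
  have Pm [measurable]: "P i \<in> borel_measurable borel" for i
    by (rule borel_measurable_continuous_onI[OF uniformly_continuous_imp_continuous[OF ucont]])
  have int: "integrable lborel (\<lambda>x. h x * f (x - y))"
    if f: "f \<in> borel_measurable borel" "bounded (range f)" for f :: "real^'n \<Rightarrow> real" and y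
  proof -
    obtain B where B: "\<And>x. \<bar>f x\<bar> \<le> B" using f(2) by (auto simp: bounded_iff)
    then have "B \<ge> 0" by (meson abs_ge_zero order_trans)
    show ?thesis
    proof (rule Bochner_Integration.integrable_bound)
      show "integrable lborel (\<lambda>x. B * h x)" using hi by simp
      show "AE x in lborel. norm (h x * f (x - y)) \<le> norm (B * h x)"
        using B \<open>B \<ge> 0\<close> by (auto simp: abs_mult mult.commute[of "\<bar>h _\<bar>"] intro!: mult_right_mono)
      show "(\<lambda>x. h x * f (x - y)) \<in> borel_measurable lborel" using f(1) by measurable
    qed
  qed
  define I where "I = (LINT x|lborel. \<bar>h x\<bar>)"
  have "I \<ge> 0" by (simp add: I_def)
  define N where "N = real CARD('n)"
  have "N > 0" by (simp add: N_def)
  have lin: "bounded_linear (\<lambda>t. \<Sum>i\<in>UNIV. t $ i * Q i)" for Q :: "'n \<Rightarrow> real"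
    by (intro bounded_linear_sum bounded_linear_mult_const bounded_linear_vec_nth)
  show ?thesis
    unfolding has_derivative_at_alt
  proof (intro conjI allI impI)
    show "bounded_linear (\<lambda>t. \<Sum>i\<in>UNIV. t $ i * - conv h (P i) y)" by (rule lin)
    fix e :: real assume "e > 0"
    \<comment> \<open>\<open>N\<close> pays for the sum over the coordinates and \<open>I\<close>
      for the integral of \<open>h\<close>; the added 1 keeps the quotient meaningful when
      \<open>h\<close> vanishes.\<close>
    define e' where "e' = e / (N * (I + 1))"
    have "e' > 0" using \<open>e > 0\<close> \<open>I \<ge> 0\<close> \<open>N > 0\<close> by (simp add: e'_def add_nonneg_pos)
    then have "\<forall>i. \<exists>d>0. \<forall>x x'. dist x' x < d \<longrightarrow> dist (P i x') (P i x) < e'"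
      using ucont unfolding uniformly_continuous_on_def by auto
    then obtain \<delta> where \<delta>: "\<And>i. \<delta> i > 0" "\<And>i x x'. dist x' x < \<delta> i \<Longrightarrow> dist (P i x') (P i x) < e'"
      by metis
    define d where "d = Min (range \<delta>)"
    have "d > 0" unfolding d_def using \<delta>(1) by (subst Min_gr_iff) auto
    have d\<delta>: "d \<le> \<delta> i" for i unfolding d_def by (rule Min_le) auto
    have lin_approx: "\<bar>\<phi> (x - y') - \<phi> (x - y) + (\<Sum>i\<in>UNIV. (y' - y) $ i * P i (x - y))\<bar> \<le> norm (y' - y) * (N * e')"
      if "norm (y' - y) < d" for x y'
    proof -
      let ?S = "ball (x - y) d"
      have "norm (\<phi> (x - y') - \<phi> (x - y) - (\<Sum>i\<in>UNIV. ((x - y') - (x - y)) $ i * P i (x - y)))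
          \<le> norm ((x - y') - (x - y)) * (N * e')"
      proof (rule differentiable_bound_linearization[where S="?S" and f'="\<lambda>x t. \<Sum>i\<in>UNIV. t $ i * P i x"])
        show "x - y \<in> ?S" using \<open>d > 0\<close> by simp
        fix z assume "z \<in> ?S"
        show "(\<phi> has_derivative (\<lambda>t. \<Sum>i\<in>UNIV. t $ i * P i z)) (at z within ?S)"
          using der by (rule has_derivative_at_withinI)
      next
        fix t :: real assume t: "t \<in> {0..1}"
        have "norm (t *\<^sub>R (y - y')) \<le> norm (y' - y)"
          using t by (simp add: norm_minus_commute mult_left_le_one_le)
        then show "x - y + t *\<^sub>R (x - y' - (x - y)) \<in> ?S"
          using that by (simp add: dist_norm norm_minus_commute)
      next
        fix z assume z: "z \<in> ?S"
        show "onorm ((\<lambda>t. \<Sum>i\<in>UNIV. t $ i * P i z) - (\<lambda>t. \<Sum>i\<in>UNIV. t $ i * P i (x - y))) \<le> N * e'"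
        proof -

          have "(\<lambda>t. \<Sum>i\<in>UNIV. t $ i * P i z) - (\<lambda>t. \<Sum>i\<in>UNIV. t $ i * P i (x - y))
            = (\<lambda>t. \<Sum>i\<in>UNIV. t $ i * (P i z - P i (x - y)))"
            by (auto simp: fun_eq_iff sum_subtractf right_diff_distrib)
          moreover have "onorm (\<lambda>t. \<Sum>i\<in>UNIV. t $ i * (P i z - P i (x - y))) \<le> N * e'"
          proof (rule onorm_le)
            fix t :: "real^'n"
            have "norm (\<Sum>i\<in>UNIV. t $ i * (P i z - P i (x - y))) \<le> (\<Sum>i\<in>(UNIV::'n set). norm t * e')"
            proof (rule sum_norm_le)
              fix i
              have "\<bar>P i z - P i (x - y)\<bar> \<le> e'"
                using \<delta>(2)[of z "x - y" i] z d\<delta>[of i] by (auto simp: dist_real_def dist_commute)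
              then show "norm (t $ i * (P i z - P i (x - y))) \<le> norm t * e'"
                unfolding real_norm_def abs_mult using component_le_norm_cart[of t i] by (intro mult_mono) auto
            qed
            then show "norm (\<Sum>i\<in>UNIV. t $ i * (P i z - P i (x - y))) \<le> N * e' * norm t"
              by (simp add: N_def mult.commute mult.left_commute)
          qed
          ultimately show ?thesis
            by (simp only:)
        qed
      qed
      then show ?thesis
        by (simp add: norm_minus_commute left_diff_distrib sum_subtractf)
    qed
    show "\<exists>d>0. \<forall>y'. norm (y' - y) < d \<longrightarrow>
       norm (conv h \<phi> y' - conv h \<phi> y - (\<Sum>i\<in>UNIV. (y' - y) $ i * - conv h (P i) y)) \<le> e * norm (y' - y)"
    proof (intro exI[of _ d] conjI allI impI \<open>d > 0\<close>)
      fix y' assume y': "norm (y' - y) < d"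
      let ?F = "\<lambda>x. h x * \<phi> (x - y') - h x * \<phi> (x - y) + (\<Sum>i\<in>UNIV. (y' - y) $ i * (h x * P i (x - y)))"
      have iS: "integrable lborel (\<lambda>x. \<Sum>i\<in>UNIV. (y' - y) $ i * (h x * P i (x - y)))"
        by (intro Bochner_Integration.integrable_sum integrable_mult_right int Pm bP)
      have iD: "integrable lborel (\<lambda>x. h x * \<phi> (x - y') - h x * \<phi> (x - y))"
        by (intro Bochner_Integration.integrable_diff int \<phi>m b\<phi>)
      have "conv h \<phi> y' - conv h \<phi> y - (\<Sum>i\<in>UNIV. (y' - y) $ i * - conv h (P i) y)
         = conv h \<phi> y' - conv h \<phi> y + (\<Sum>i\<in>UNIV. (y' - y) $ i * conv h (P i) y)"
        by (simp add: sum_negf)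
      also have "\<dots> = (LINT x|lborel. ?F x)"
        using iS iD int[OF Pm bP] int[OF \<phi>m b\<phi>] unfolding conv_def by simp
      finally have eq: "conv h \<phi> y' - conv h \<phi> y - (\<Sum>i\<in>UNIV. (y' - y) $ i * - conv h (P i) y) = (LINT x|lborel. ?F x)" .
      have "norm (LINT x|lborel. ?F x) \<le> (LINT x|lborel. norm (?F x))" by (rule integral_norm_bound)
      also have "\<dots> \<le> (LINT x|lborel. \<bar>h x\<bar> * (norm (y' - y) * (N * e')))"
      proof (rule integral_mono)
        show "integrable lborel (\<lambda>x. norm (?F x))"
          by (intro integrable_norm Bochner_Integration.integrable_add iD iS)
        show "integrable lborel (\<lambda>x. \<bar>h x\<bar> * (norm (y' - y) * (N * e')))" using hi by simp
        fix x
        have "?F x = h x * (\<phi> (x - y') - \<phi> (x - y) + (\<Sum>i\<in>UNIV. (y' - y) $ i * P i (x - y)))"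
          by (simp add: algebra_simps sum_distrib_left)
        then show "norm (?F x) \<le> \<bar>h x\<bar> * (norm (y' - y) * (N * e'))"
          using lin_approx[OF y', of x] by (auto simp: abs_mult intro!: mult_left_mono)
      qed
      also have "\<dots> = I * (norm (y' - y) * (N * e'))" by (simp add: I_def)
      also have "\<dots> = (I / (I + 1)) * (e * norm (y' - y))"
        using \<open>I \<ge> 0\<close> \<open>N > 0\<close> by (simp add: e'_def)
      also have "\<dots> \<le> 1 * (e * norm (y' - y))"
        using \<open>I \<ge> 0\<close> \<open>e > 0\<close> by (intro mult_right_mono) auto
      finally show "norm (conv h \<phi> y' - conv h \<phi> y - (\<Sum>i\<in>UNIV. (y' - y) $ i * - conv h (P i) y)) \<le> e * norm (y' - y)"
        unfolding eq by simp
    qed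
  qed
qed

lemma has_derivative_pderiv_at:
  fixes f :: "real^'n \<Rightarrow> real"
  assumes "f differentiable (at x)"
  shows "(f has_derivative (\<lambda>t. \<Sum>i\<in>UNIV. t $ i * pderiv_at i f x)) (at x)"
proof -
  have d: "(f has_derivative frechet_derivative f (at x)) (at x)"
    using assms by (simp add: frechet_derivative_works)
  then interpret bounded_linear "frechet_derivative f (at x)" by (rule has_derivative_bounded_linear)
  have "frechet_derivative f (at x) t = (\<Sum>i\<in>UNIV. t $ i * pderiv_at i f x)" for t
  proof -
    have "t = (\<Sum>i\<in>UNIV. t $ i *\<^sub>R axis i 1)"
      using basis_expansion[of t] by (simp add: scalar_mult_eq_scaleR)
    then have "frechet_derivative f (at x) t = frechet_derivative f (at x) (\<Sum>i\<in>UNIV. t $ i *\<^sub>R axis i 1)" by simp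
    also have "\<dots> = (\<Sum>i\<in>UNIV. t $ i * pderiv_at i f x)"
      by (simp add: sum scaleR pderiv_at_def)
    finally show ?thesis .
  qed
  then have "frechet_derivative f (at x) = (\<lambda>t. \<Sum>i\<in>UNIV. t $ i * pderiv_at i f x)" by auto
  with d show ?thesis by simp
qed

lemma bump_class_continuous: "f \<in> bump_class y c \<Longrightarrow> continuous_on UNIV f"
  using bump_class_pderiv by (metis continuous_at_imp_continuous_on differentiable_imp_continuous_within)

lemma bump_class_norm_ge:
  assumes "f \<in> bump_class 0 (d\<^sup>2)" "d > 0" "norm x \<ge> d"
  shows "f x = 0"
proof (rule bump_class_support[OF assms(1)])
  have "d\<^sup>2 \<le> (norm x)\<^sup>2" using assms by (intro power_mono) auto
  then show "d\<^sup>2 \<le> (x - 0) \<bullet> (x - 0)" by (simp add: power2_norm_eq_inner)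
qed

lemma bump_class_uniformly_continuous:
  assumes "f \<in> bump_class 0 (d\<^sup>2)" "d > 0"
  shows "uniformly_continuous_on UNIV f" "bounded (range f)"
proof -
  have z: "f x = 0" if "norm x \<ge> d" for x using bump_class_norm_ge[OF assms that] .
  have c: "continuous_on (cball 0 (d + 1)) f"
    using bump_class_continuous[OF assms(1)] continuous_on_subset by blast
  have u: "uniformly_continuous_on (cball 0 (d + 1)) f"
    using compact_uniformly_continuous[OF c] by simp
  show "uniformly_continuous_on UNIV f"
    unfolding uniformly_continuous_on_def
  proof (intro allI impI)
    fix e :: real assume "e > 0"
    then obtain \<delta> where \<delta>: "\<delta> > 0" "\<And>x x'. norm x \<le> d + 1 \<Longrightarrow> norm x' \<le> d + 1 \<Longrightarrow> dist x' x < \<delta> \<Longrightarrow> dist (f x') (f x) < e"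
      using u unfolding uniformly_continuous_on_def by (auto simp: dist_norm)
    \<comment> \<open>Points less than 1 apart, one of them outside radius \<open>d + 1\<close>,
      both have norm at least \<open>d\<close>, where \<open>f\<close> vanishes. Elsewhere uniform
      continuity on the compact ball applies.\<close>
    have "dist (f x') (f x) < e" if "dist x' x < min \<delta> 1" for x x'
    proof (cases "norm x \<le> d + 1 \<and> norm x' \<le> d + 1")
      case True then show ?thesis using \<delta> that by auto
    next
      case False
      have "norm (x' - x) < 1" using that by (simp add: dist_norm)
      then have "norm x \<ge> d" "norm x' \<ge> d"
        using False norm_triangle_ineq2[of x x'] norm_triangle_ineq2[of x' x] by (auto simp: norm_minus_commute)
      then show ?thesis using z \<open>e > 0\<close> by simp
    qed
    then show "\<exists>\<delta>>0. \<forall>x\<in>UNIV. \<forall>x'\<in>UNIV. dist x' x < \<delta> \<longrightarrow> dist (f x') (f x) < e"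
      using \<delta>(1) by (intro exI[of _ "min \<delta> 1"]) auto
  qed
  have "range f \<subseteq> insert 0 (f ` cball 0 (d + 1))"
  proof
    fix v assume "v \<in> range f"
    then obtain x where "v = f x" by blast
    then show "v \<in> insert 0 (f ` cball 0 (d + 1))" using z[of x] by (cases "norm x \<le> d + 1") auto
  qed
  then show "bounded (range f)"
    using compact_imp_bounded[OF compact_continuous_image[OF c]] bounded_subset by (metis bounded_insert compact_cball)
qed

lemma conv_bump_has_derivative:
  fixes h :: "real^'n \<Rightarrow> real"
  assumes "integrable lborel h" "f \<in> bump_class 0 (d\<^sup>2)" "d > 0"
  shows "(conv h f has_derivative (\<lambda>t. \<Sum>i\<in>UNIV. t $ i * - conv h (pderiv_at i f) y)) (at y)"
proof (rule conv_has_derivative)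
  show "(f has_derivative (\<lambda>t. \<Sum>i\<in>UNIV. t $ i * pderiv_at i f x)) (at x)" for x
    using assms bump_class_pderiv has_derivative_pderiv_at by blast
  have "pderiv_at i f \<in> bump_class 0 (d\<^sup>2)" for i
    using assms bump_class_pderiv by blast
  then show "uniformly_continuous_on UNIV (pderiv_at i f)" "bounded (range (pderiv_at i f))" for i
    using bump_class_uniformly_continuous assms(3) by blast+
  show "bounded (range f)" using bump_class_uniformly_continuous assms by blast
qed (use assms in auto)

section \<open>The normalised mollifier\<close>

definition mollifier :: "real \<Rightarrow> real^'n \<Rightarrow> real" where
  "mollifier d x = bump d x / (LINT z|lborel. bump d (z :: real^'n))"

lemma mollifier_in_class: "mollifier d \<in> bump_class 0 (d\<^sup>2)"
  using bump_class.scale[OF bump_in_class, of "1 / (LINT z|lborel. bump d (z :: real^'n))"]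
  by (simp add: mollifier_def[abs_def])

lemma bump_class_integrable:
  assumes "f \<in> bump_class 0 (d\<^sup>2)" "d > 0"
  shows "integrable lborel f"
proof -
  have "integrable lborel (\<lambda>x. indicator (cball 0 d) x *\<^sub>R f x)"
    by (rule borel_integrable_compact) (use bump_class_continuous[OF assms(1)] in \<open>auto intro: continuous_on_subset\<close>)
  also have "(\<lambda>x. indicator (cball 0 d) x *\<^sub>R f x) = f"
    using bump_class_norm_ge[OF assms] by (auto simp: fun_eq_iff indicator_def)
  finally show ?thesis .
qed

lemma bump_nonneg: "bump d x \<ge> 0"
  by (simp add: bump_def exp_flat_def)

text \<open>\<open>mollifier\<close> divides by this integral. On the ball of radius
  \<open>d/2\<close> the bump is at least the constant \<open>c\<close>, its value on the bounding
  sphere.\<close>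

lemma bump_integral_pos:
  assumes "d > 0"
  shows "(LINT z|lborel. bump d (z :: real^'n)) > 0"
proof -
  define c where "c = exp (- (1 / (d\<^sup>2 - (d/2)\<^sup>2)))"
  have "c > 0" by (simp add: c_def)
  have "0 < c * measure lborel (ball (0::real^'n) (d/2))"
    using \<open>c > 0\<close> assms content_ball_pos[of "d/2" "0::real^'n"] by simp
  also have "\<dots> = (LINT z|lborel. c * indicator (ball (0::real^'n) (d/2)) z)"
    by simp
  also have "\<dots> \<le> (LINT z|lborel. bump d (z :: real^'n))"
  proof (rule integral_mono)
    show "integrable lborel (\<lambda>z. c * indicator (ball (0::real^'n) (d/2)) z)"
      by (intro integrable_mult_right integrable_real_indicator) (use emeasure_lborel_ball_finite in \<open>auto simp: top.not_eq_extremum\<close>)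
    show "integrable lborel (bump d :: real^'n \<Rightarrow> real)"
      by (rule bump_class_integrable[OF bump_in_class assms])
    fix z :: "real^'n"
    show "c * indicator (ball 0 (d/2)) z \<le> bump d z"
    proof (cases "norm z < d/2")
      case True
      then have zz: "z \<bullet> z \<le> (d/2)\<^sup>2"
        unfolding power2_norm_eq_inner[symmetric] by (intro power_mono) auto
      have pos: "d\<^sup>2 - (d/2)\<^sup>2 > 0" using assms by (simp add: power2_eq_square)
      with zz have "1 / (d\<^sup>2 - z \<bullet> z) \<le> 1 / (d\<^sup>2 - (d/2)\<^sup>2)"
        by (intro divide_left_mono mult_pos_pos) auto
      then show ?thesis using True zz pos by (simp add: bump_def exp_flat_def c_def)
    next
      case False then show ?thesis using bump_nonneg by simp
    qed
  qed
  finally show ?thesis .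
qed

lemma mollifier_nonneg: "d > 0 \<Longrightarrow> mollifier d (x :: real^'n) \<ge> 0"
  unfolding mollifier_def
  using bump_integral_pos[where 'n='n, of d] bump_nonneg[of d x] by simp

lemma mollifier_integral:
  assumes "d > 0" shows "(LINT z|lborel. mollifier d (z::real^'n)) = 1"
  using bump_integral_pos[OF assms, where 'n='n] by (simp add: mollifier_def)

text \<open>The test function is the mollifier translated to \<open>y\<close>.\<close>
lemma conv_weak_deriv:
  fixes u w h g :: "real^'n \<Rightarrow> real"
  assumes wd: "has_weak_deriv (ball 0 1) js u w"
    and hm [measurable]: "h \<in> borel_measurable borel" and gm [measurable]: "g \<in> borel_measurable borel"
    and h: "AE x in lebesgue. x \<in> ball 0 R \<longrightarrow> h x = u x"
    and g: "AE x in lebesgue. x \<in> ball 0 R \<longrightarrow> g x = w x"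
    and "d > 0" "norm y + d < R" "R \<le> 1"
  shows "conv h (iter_pderiv js (mollifier d)) y = (- 1) ^ length js * conv g (mollifier d) y"
proof -
  let ?\<rho> = "\<lambda>x. mollifier d (x - y)"
  have sub: "cball y d \<subseteq> ball 0 R" "cball y d \<subseteq> ball 0 1"
  proof -
    show "cball y d \<subseteq> ball 0 R"
    proof
      fix x assume "x \<in> cball y d"
      then have "norm (x - y) \<le> d" by (simp add: dist_norm norm_minus_commute)
      then show "x \<in> ball 0 R" using norm_triangle_ineq2[of x y] \<open>norm y + d < R\<close> by simp
    qed
    then show "cball y d \<subseteq> ball 0 1" using \<open>R \<le> 1\<close> by auto
  qed
  have cls: "?\<rho> \<in> bump_class y (d\<^sup>2)"
    using bump_class.scale[OF bump_shift_in_class, of "1 / (LINT z|lborel. bump d (z :: real^'n))" d y]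
    by (simp add: mollifier_def[abs_def])
  have test: "?\<rho> \<in> test_functions (ball 0 1)"
    by (rule bump_class_test_function[OF cls \<open>d > 0\<close> sub(2)])
  \<comment> \<open>A kernel \<open>f\<close> of the class vanishes outside radius \<open>d\<close>,
    so both integrals see only \<open>cball y d\<close>. There the Borel function \<open>k\<close>
    agrees almost everywhere with \<open>q\<close>, which allows the passage from
    \<open>lborel\<close> to \<open>lebesgue\<close>.\<close>
  have key: "conv k f y = (LINT x:ball 0 1|lebesgue. q x * f (x - y))"
    if f: "f \<in> bump_class 0 (d\<^sup>2)" and km [measurable]: "k \<in> borel_measurable borel"
      and q: "AE x in lebesgue. x \<in> ball 0 R \<longrightarrow> k x = q x" and ql: "locally_integrable_on q (ball 0 1)"
    for k f q
  proof -
    have fm [measurable]: "f \<in> borel_measurable borel"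
      using bump_class_continuous[OF f] by (rule borel_measurable_continuous_onI)
    have f0: "f (x - y) = 0" if "x \<notin> cball y d" for x
      using that bump_class_norm_ge[OF f \<open>d > 0\<close>, of "x - y"] by (simp add: dist_norm norm_minus_commute)
    have "set_integrable lebesgue (cball y d) q"
      using ql sub(2) by (simp add: locally_integrable_on_def)
    then have qm [measurable]: "(\<lambda>x. indicator (cball y d) x *\<^sub>R q x) \<in> borel_measurable lebesgue"
      unfolding set_integrable_def by (rule borel_measurable_integrable)
    have fm' [measurable]: "(\<lambda>x. f (x - y)) \<in> borel_measurable lebesgue"
      by (intro measurable_completion) measurable
    have km' [measurable]: "k \<in> borel_measurable lebesgue"
      by (intro measurable_completion) measurable
    have "conv k f y = (LINT x|lebesgue. k x * f (x - y))"
      unfolding conv_def by (rule integral_completion[symmetric]) measurable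
    also have "\<dots> = (LINT x|lebesgue. (indicator (cball y d) x *\<^sub>R q x) * f (x - y))"
    proof (rule integral_cong_AE)
      show "AE x in lebesgue. k x * f (x - y) = (indicator (cball y d) x *\<^sub>R q x) * f (x - y)"
        using q by eventually_elim (use f0 sub(1) in \<open>auto simp: indicator_def\<close>)
    qed measurable
    also have "\<dots> = (LINT x:ball 0 1|lebesgue. q x * f (x - y))"
      unfolding set_lebesgue_integral_def
      by (rule Bochner_Integration.integral_cong) (use f0 sub(2) in \<open>auto simp: indicator_def\<close>)
    finally show ?thesis .
  qed
  have "conv h (iter_pderiv js (mollifier d)) y = (LINT x:ball 0 1|lebesgue. u x * iter_pderiv js (mollifier d) (x - y))"
    by (rule key) (use wd h bump_class_iter_pderiv[OF mollifier_in_class] in \<open>auto simp: has_weak_deriv_def\<close>)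
  also have "\<dots> = (LINT x:ball 0 1|lebesgue. u x * iter_pderiv js ?\<rho> x)"
    by (simp add: iter_pderiv_shift[OF bump_class_smooth[OF mollifier_in_class]])
  also have "\<dots> = (- 1) ^ length js * (LINT x:ball 0 1|lebesgue. w x * ?\<rho> x)"
    using wd test by (simp add: has_weak_deriv_def)
  also have "(LINT x:ball 0 1|lebesgue. w x * ?\<rho> x) = conv g (mollifier d) y"
    by (rule key[symmetric]) (use wd g mollifier_in_class in \<open>auto simp: has_weak_deriv_def\<close>)
  finally show ?thesis .
qed

section \<open>Positive semidefinite matrices\<close>

text \<open>Only the quadratic form is constrained. Symmetry is carried as a separate hypothesis
  wherever off-diagonal entries have to be controlled.\<close>

definition psd :: "real^'n^'n \<Rightarrow> bool" where
  "psd A \<longleftrightarrow> (\<forall>\<xi>. 0 \<le> \<xi> \<bullet> (A *v \<xi>))"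

lemma matrix_inner_expand:
  fixes A :: "real^'n^'n"
  shows "\<xi> \<bullet> (A *v \<eta>) = (\<Sum>i\<in>UNIV. \<Sum>j\<in>UNIV. \<xi> $ i * A $ i $ j * \<eta> $ j)"
  by (simp add: inner_vec_def matrix_vector_mult_def sum_distrib_left mult.assoc)

lemma axis_inner_matrix:
  fixes A :: "real^'n^'n"
  shows "axis i 1 \<bullet> (A *v axis j 1) = A $ i $ j"
  by (simp add: matrix_vector_mult_basis inner_axis' column_def)

lemma psd_diag_nonneg: "psd A \<Longrightarrow> 0 \<le> A $ i $ i"
  unfolding psd_def using axis_inner_matrix[of i A i] by metis

text \<open>The quadratic form is tested on the sum and on the difference of the two axis
  vectors.\<close>

lemma psd_entry_le:
  fixes A :: "real^'n^'n"
  assumes "psd A" "transpose A = A"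
  shows "\<bar>A $ i $ j\<bar> \<le> (A $ i $ i + A $ j $ j) / 2"
proof -
  have sym: "A $ j $ i = A $ i $ j"
    using assms(2) by (metis transpose_def vec_lambda_beta)
  have "0 \<le> (axis i 1 + axis j 1) \<bullet> (A *v (axis i 1 + axis j 1))"
    and "0 \<le> (axis i 1 - axis j 1) \<bullet> (A *v (axis i 1 - axis j 1))"
    using assms(1) by (auto simp: psd_def)
  then show ?thesis
    by (simp add: matrix_vector_right_distrib matrix_vector_mult_diff_distrib inner_add_left inner_add_right
        inner_diff_left inner_diff_right axis_inner_matrix sym)
qed

lemma psd_entry_le_trace:
  fixes A :: "real^'n^'n"
  assumes "psd A" "transpose A = A"
  shows "\<bar>A $ i $ j\<bar> \<le> trace A"
proof -
  have "A $ k $ k \<le> trace A" for k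
    unfolding trace_def using psd_diag_nonneg[OF assms(1)] by (intro member_le_sum) auto
  from this[of i] this[of j] show ?thesis using psd_entry_le[OF assms, of i j] by simp
qed

text \<open>The Leibniz formula has n! terms, each a product of n entries bounded by the trace. This
  is a crude form of the inequality between geometric and arithmetic means of the eigenvalues; its
  constant only makes \<epsilon> smaller.\<close>

lemma psd_abs_det_le:
  fixes A :: "real^'n^'n"
  assumes "psd A" "transpose A = A"
  shows "\<bar>det A\<bar> \<le> fact CARD('n) * trace A ^ CARD('n)"
proof -
  let ?P = "{p. p permutes (UNIV :: 'n set)}"
  have "\<bar>det A\<bar> \<le> (\<Sum>p\<in>?P. \<bar>of_int (sign p) * (\<Prod>i\<in>UNIV. A $ i $ p i)\<bar>)"
    unfolding det_def by (rule sum_abs)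
  also have "\<dots> \<le> (\<Sum>p\<in>?P. trace A ^ CARD('n))"
  proof (rule sum_mono)
    fix p :: "'n \<Rightarrow> 'n"
    have "\<bar>of_int (sign p) * (\<Prod>i\<in>UNIV. A $ i $ p i)\<bar> = (\<Prod>i\<in>UNIV. \<bar>A $ i $ p i\<bar>)"
      by (simp add: abs_mult abs_prod sign_def)
    also have "\<dots> \<le> (\<Prod>i\<in>(UNIV::'n set). trace A)"
      by (rule prod_mono) (use psd_entry_le_trace[OF assms] in auto)
    finally show "\<bar>of_int (sign p) * (\<Prod>i\<in>UNIV. A $ i $ p i)\<bar> \<le> trace A ^ CARD('n)" by simp
  qed
  also have "\<dots> = fact CARD('n) * trace A ^ CARD('n)"
    by (simp add: card_permutations[of UNIV "CARD('n)"])
  finally show ?thesis .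
qed

text \<open>The induction is a Cholesky decomposition: each step splits off a rank-one matrix and annihilates a
  diagonal entry.\<close>
lemma psd_trace_mult_nonneg:
  fixes P A :: "real^'n^'n"
  assumes "psd P" "psd A" "transpose A = A"
  shows "0 \<le> (\<Sum>i\<in>UNIV. \<Sum>j\<in>UNIV. P $ i $ j * A $ i $ j)"
  using assms(2,3)
proof (induction "card {k. A $ k $ k \<noteq> 0}" arbitrary: A rule: less_induct)
  case less
  have sym: "A $ j $ i = A $ i $ j" for i j
    using less.prems(2) by (metis transpose_def vec_lambda_beta)
  show ?case
  proof (cases "\<exists>k. A $ k $ k \<noteq> 0")
    case False
    then have "A $ i $ j = 0" for i j
      using psd_entry_le[OF less.prems, of i j] by auto
    then show ?thesis by simp
  next
    case True
    then obtain k where "A $ k $ k \<noteq> 0" by blast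
    then have k: "A $ k $ k > 0" using psd_diag_nonneg[OF less.prems(1), of k] by linarith
    define c where "c = (\<chi> i. A $ i $ k)"
    \<comment> \<open>The Schur complement of the pivot \<open>A $ k $ k\<close>, with
      \<open>c\<close> the k-th column.\<close>
    define B where "B = (\<chi> i j. A $ i $ j - c $ i * c $ j / A $ k $ k)"
    have rank1: "\<xi> \<bullet> (B *v \<xi>) = \<xi> \<bullet> (A *v \<xi>) - (c \<bullet> \<xi>)\<^sup>2 / A $ k $ k" for \<xi>
    proof -
      have "(c \<bullet> \<xi>)\<^sup>2 / A $ k $ k = (\<Sum>i\<in>UNIV. \<Sum>j\<in>UNIV. \<xi> $ i * (c $ i * c $ j / A $ k $ k) * \<xi> $ j)"
        by (simp add: inner_vec_def power2_eq_square sum_product sum_divide_distrib mult_ac)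
      then show ?thesis
        by (simp add: matrix_inner_expand B_def sum_subtractf[symmetric] algebra_simps)
    qed
    have Ac: "axis k 1 \<bullet> (A *v \<xi>) = c \<bullet> \<xi>" "\<xi> \<bullet> (A *v axis k 1) = c \<bullet> \<xi>" for \<xi>
    proof -
      have "axis k 1 \<bullet> (A *v \<xi>) = (A *v \<xi>) $ k" by (simp add: inner_axis')
      then show "axis k 1 \<bullet> (A *v \<xi>) = c \<bullet> \<xi>"
        by (simp add: matrix_vector_mult_def inner_vec_def c_def sym)
      have "A *v axis k 1 = c"
        by (simp add: matrix_vector_mult_basis column_def c_def)
      then show "\<xi> \<bullet> (A *v axis k 1) = c \<bullet> \<xi>" by (simp add: inner_commute)
    qed
    have psdB: "psd B"
      unfolding psd_def
    proof
      fix \<xi> :: "real^'n"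
      \<comment> \<open>This \<open>s\<close> minimises the form of \<open>A\<close> over \<xi> - s
        e_k, and the minimum is the form of \<open>B\<close> at \<xi>.\<close>
      define s where "s = (c \<bullet> \<xi>) / A $ k $ k"
      have "0 \<le> (\<xi> - s *\<^sub>R axis k 1) \<bullet> (A *v (\<xi> - s *\<^sub>R axis k 1))"
        using less.prems(1) by (auto simp: psd_def)
      also have "\<dots> = \<xi> \<bullet> (A *v \<xi>) - 2 * s * (c \<bullet> \<xi>) + s\<^sup>2 * A $ k $ k"
        by (simp add: matrix_vector_mult_diff_distrib matrix_vector_mult_scaleR inner_diff_left inner_diff_right
            Ac axis_inner_matrix power2_eq_square algebra_simps)
          (simp add: axis_inner_matrix[symmetric] Ac)
      also have "\<dots> = \<xi> \<bullet> (B *v \<xi>)"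
        using k by (simp add: rank1 s_def power2_eq_square field_simps)
      finally show "0 \<le> \<xi> \<bullet> (B *v \<xi>)" .
    qed
    have symB: "transpose B = B"
      by (simp add: B_def transpose_def vec_eq_iff sym mult.commute)
    \<comment> \<open>Diagonal entries of \<open>B\<close> are nonnegative and at most those of
      \<open>A\<close>, so a zero on the diagonal stays zero, and the k-th entry becomes a new
      one.\<close>
    have "{i. B $ i $ i \<noteq> 0} \<subset> {i. A $ i $ i \<noteq> 0}"
    proof (rule psubsetI)
      show "{i. B $ i $ i \<noteq> 0} \<subseteq> {i. A $ i $ i \<noteq> 0}"
      proof
        fix i assume i: "i \<in> {i. B $ i $ i \<noteq> 0}"
        have "0 \<le> (c $ i)\<^sup>2 / A $ k $ k" using k by simp
        then show "i \<in> {i. A $ i $ i \<noteq> 0}"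
          using i psd_diag_nonneg[OF psdB, of i] by (auto simp: B_def power2_eq_square)
      qed
      have "B $ k $ k = 0" using k by (simp add: B_def c_def)
      then show "{i. B $ i $ i \<noteq> 0} \<noteq> {i. A $ i $ i \<noteq> 0}"
        using k by (metis (mono_tags, lifting) mem_Collect_eq order_less_irrefl)
    qed
    then have "card {i. B $ i $ i \<noteq> 0} < card {i. A $ i $ i \<noteq> 0}"
      by (rule psubset_card_mono[rotated]) simp
    then have IH: "0 \<le> (\<Sum>i\<in>UNIV. \<Sum>j\<in>UNIV. P $ i $ j * B $ i $ j)"
      using less.hyps psdB symB by blast
    have "(\<Sum>i\<in>UNIV. \<Sum>j\<in>UNIV. P $ i $ j * A $ i $ j)
      = (\<Sum>i\<in>UNIV. \<Sum>j\<in>UNIV. P $ i $ j * B $ i $ j) + (c \<bullet> (P *v c)) / A $ k $ k"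
    proof -
      have "(c \<bullet> (P *v c)) / A $ k $ k = (\<Sum>i\<in>UNIV. \<Sum>j\<in>UNIV. P $ i $ j * (c $ i * c $ j / A $ k $ k))"
        by (simp add: matrix_inner_expand sum_divide_distrib mult_ac)
      moreover have "P $ i $ j * A $ i $ j = P $ i $ j * B $ i $ j + P $ i $ j * (c $ i * c $ j / A $ k $ k)" for i j
        by (simp add: B_def right_diff_distrib)
      ultimately show ?thesis by (simp only: sum.distrib)
    qed
    moreover have "0 \<le> (c \<bullet> (P *v c)) / A $ k $ k"
      using assms(1) k by (auto simp: psd_def)
    ultimately show ?thesis using IH by simp
  qed
qed

text \<open>Ellipticity says that \<open>a - mat lam\<close> is positive semidefinite, so its
  entrywise pairing with \<open>A\<close> is nonnegative. An upper bound on the second-order part of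
  the operator thus becomes one on the trace.\<close>

lemma elliptic_trace_ge:
  fixes a A :: "real^'n^'n"
  assumes "loewner_le (mat lam) a" "psd A" "transpose A = A"
  shows "lam * trace A \<le> (\<Sum>i\<in>UNIV. \<Sum>j\<in>UNIV. a $ i $ j * A $ i $ j)"
proof -
  have "psd (a - mat lam)"
    using assms(1) by (simp add: psd_def loewner_le_def matrix_vector_mult_diff_rdistrib inner_diff_right)
  from psd_trace_mult_nonneg[OF this assms(2,3)]
  have "0 \<le> (\<Sum>i\<in>UNIV. \<Sum>j\<in>UNIV. a $ i $ j * A $ i $ j) - (\<Sum>i\<in>UNIV. \<Sum>j\<in>UNIV. (mat lam :: real^'n^'n) $ i $ j * A $ i $ j)"
    by (simp add: left_diff_distrib sum_subtractf)
  also have "(\<Sum>i\<in>UNIV. \<Sum>j\<in>UNIV. (mat lam :: real^'n^'n) $ i $ j * A $ i $ j) = lam * trace A"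
    by (simp add: mat_def trace_def sum_distrib_left if_distrib[of "\<lambda>x. x * _"] cong: if_cong)
  finally show ?thesis by simp
qed

text \<open>This controls the error made when the Hessian of the mollification is exchanged for that
  of the solution. Axis vectors give the diagonal, and \<open>psd_entry_le\<close> the rest.\<close>

lemma elliptic_entry_le:
  fixes a :: "real^'n^'n"
  assumes "0 \<le> lam" "loewner_le (mat lam) a" "loewner_le a (mat Lam)" "transpose a = a"
  shows "\<bar>a $ i $ j\<bar> \<le> Lam"
proof -
  have m: "mat c *v \<xi> = c *\<^sub>R \<xi>" for c and \<xi> :: "real^'n"
    by (simp add: mat_def matrix_vector_mult_def vec_eq_iff if_distrib[of "\<lambda>x. x * _"] cong: if_cong)
  have "psd a"
    unfolding psd_def
  proof
    fix \<xi> :: "real^'n"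
    have "0 \<le> \<xi> \<bullet> (mat lam *v \<xi>)" using assms(1) by (simp add: m)
    also have "\<dots> \<le> \<xi> \<bullet> (a *v \<xi>)" using assms(2) by (simp add: loewner_le_def)
    finally show "0 \<le> \<xi> \<bullet> (a *v \<xi>)" .
  qed
  then have "\<bar>a $ i $ j\<bar> \<le> (a $ i $ i + a $ j $ j) / 2"
    using assms(4) by (rule psd_entry_le)
  moreover have "a $ k $ k \<le> Lam" for k
    using assms(3)[unfolded loewner_le_def, rule_format, of "axis k 1"]
    by (simp add: axis_inner_matrix m inner_axis_axis)
  from this[of i] this[of j] have "(a $ i $ i + a $ j $ j) / 2 \<le> Lam" by simp
  ultimately show ?thesis by linarith
qed

section \<open>The area inequality\<close>

text \<open>Change of variables with Jacobian matrix \<open>M x\<close>. It is only an inequality,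
  since \<open>g\<close> may take a value several times. The determinant is then replaced by a power
  of the trace, and continuity on the compact \<open>S\<close> makes every integrand
  integrable.\<close>

lemma area_inequality_wellorder:
  fixes g :: "real^'m::{finite,wellorder} \<Rightarrow> real^'m::_" and M :: "real^'m::_ \<Rightarrow> real^'m::_^'m::_"
  assumes S: "compact S"
    and der: "\<And>x. (g has_derivative (\<lambda>t. M x *v t)) (at x)"
    and contM: "continuous_on S M"
    and psd: "\<And>x. x \<in> S \<Longrightarrow> psd (M x)" and sym: "\<And>x. x \<in> S \<Longrightarrow> transpose (M x) = M x"
    and contf: "continuous_on (g ` S) f" and nonneg: "\<And>x. x \<in> S \<Longrightarrow> 0 \<le> f (g x)"
  shows "(LINT y:g ` S|lborel. f y) \<le> fact CARD('m) * (LINT x:S|lborel. trace (M x) ^ CARD('m) * f (g x))"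
proof -
  have contg: "continuous_on S g"
    using der by (meson has_derivative_continuous_on has_derivative_at_withinI)
  have contfg: "continuous_on S (\<lambda>x. f (g x))"
    using continuous_on_compose2[OF contf contg] by simp
  have ent: "continuous_on S (\<lambda>x. M x $ i $ j)" for i j
    using contM by (intro continuous_on_component)
  have contdet: "continuous_on S (\<lambda>x. \<bar>det (M x)\<bar> * f (g x))"
    unfolding det_def by (intro continuous_intros contfg ent)
  have conttr: "continuous_on S (\<lambda>x. trace (M x) ^ CARD('m) * f (g x))"
    unfolding trace_def by (intro continuous_intros contfg ent)
  have si: "set_integrable lborel S k" if "continuous_on S k" for k :: "real^'m::_ \<Rightarrow> real"
    unfolding set_integrable_def by (rule borel_integrable_compact[OF S that])
  have sig: "set_integrable lborel (g ` S) f"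
    unfolding set_integrable_def by (rule borel_integrable_compact[OF compact_continuous_image[OF contg S] contf])
  have mat: "matrix (\<lambda>t. M x *v t) = M x" for x by simp
  have "(LINT y:g ` S|lborel. f y) = integral (g ` S) f"
    by (rule set_borel_integral_eq_integral(2)[OF sig])
  also have "\<dots> \<le> integral S (\<lambda>x. \<bar>det (matrix (\<lambda>t. M x *v t))\<bar> * f (g x))"
  proof (rule conjunct2[OF integral_on_image_ubound_nonneg])
    show "(\<lambda>x. \<bar>det (matrix (\<lambda>t. M x *v t))\<bar> * f (g x)) integrable_on S"
      unfolding mat by (rule set_borel_integral_eq_integral(1)[OF si[OF contdet]])
  qed (use nonneg has_derivative_at_withinI[OF der] in auto)
  also have "\<dots> = (LINT x:S|lborel. \<bar>det (M x)\<bar> * f (g x))"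
    unfolding mat by (rule set_borel_integral_eq_integral(2)[OF si[OF contdet], symmetric])
  also have "\<dots> \<le> (LINT x:S|lborel. fact CARD('m) * (trace (M x) ^ CARD('m) * f (g x)))"
  proof (rule set_integral_mono)
    show "set_integrable lborel S (\<lambda>x. fact CARD('m) * (trace (M x) ^ CARD('m) * f (g x)))"
      by (intro set_integrable_mult_right si conttr)
    fix x assume x: "x \<in> S"
    show "\<bar>det (M x)\<bar> * f (g x) \<le> fact CARD('m) * (trace (M x) ^ CARD('m) * f (g x))"
      using mult_right_mono[OF psd_abs_det_le[OF psd[OF x] sym[OF x]] nonneg[OF x]] by (simp add: mult.assoc)
  qed (rule si[OF contdet])
  also have "\<dots> = fact CARD('m) * (LINT x:S|lborel. trace (M x) ^ CARD('m) * f (g x))"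
    by (rule set_integral_mult_right)
  finally show ?thesis .
qed

text \<open>The library's change of variables formulas need a well-ordered index type.\<close>
typedef ('n::finite) wo_index = "{..<CARD('n)}"
  by (rule exI[of _ 0]) simp

instantiation wo_index :: (finite) "{finite,wellorder}"
begin

definition less_eq_wo_index :: "'a wo_index \<Rightarrow> 'a wo_index \<Rightarrow> bool" where
  "x \<le> y \<longleftrightarrow> Rep_wo_index x \<le> Rep_wo_index y"

definition less_wo_index :: "'a wo_index \<Rightarrow> 'a wo_index \<Rightarrow> bool" where
  "x < y \<longleftrightarrow> Rep_wo_index x < Rep_wo_index y"

instance
proof
  show "finite (UNIV :: 'a wo_index set)"
    using type_definition.univ[OF type_definition_wo_index] by (metis finite_imageI finite_lessThan)
  fix P and a :: "'a wo_index"
  assume *: "\<And>x::'a wo_index. (\<And>y. y < x \<Longrightarrow> P y) \<Longrightarrow> P x"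
  show "P a"
    by (induction "Rep_wo_index a" arbitrary: a rule: less_induct) (metis * less_wo_index_def)
qed (auto simp: less_eq_wo_index_def less_wo_index_def Rep_wo_index_inject)

end

lemma card_wo_index: "CARD('n::finite wo_index) = CARD('n)"
  using type_definition.card[OF type_definition_wo_index[where 'n='n]] by simp

section \<open>The area inequality for an arbitrary finite index type\<close>

lemma prod_Basis_vec: "(\<Prod>b\<in>(Basis :: (real^'n) set). f b) = (\<Prod>i\<in>UNIV. f (axis i 1))"
proof -
  have B: "(Basis :: (real^'n) set) = range (\<lambda>i. axis i 1)"
    by (auto simp: Basis_vec_def)
  have "inj (\<lambda>i :: 'n. axis i (1::real))"
    by (auto simp: inj_def axis_eq_axis)
  then show ?thesis unfolding B by (subst prod.reindex) auto
qed

text \<open>Relabelling the coordinates turns boxes into boxes with the same side lengths, and the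
  volumes of boxes determine \<open>lborel\<close>.\<close>

lemma lborel_distr_reindex:
  fixes \<sigma> :: "'m::finite \<Rightarrow> 'n::finite"
  assumes "bij \<sigma>"
  shows "distr lborel borel (\<lambda>x :: real^'n. \<chi> k. x $ \<sigma> k) = lborel" (is "distr _ _ ?R = _")
proof (rule lborel_eqI[symmetric])
  have cR: "continuous_on UNIV ?R"
    by (intro continuous_intros)
  then have Rm [measurable]: "?R \<in> borel_measurable borel"
    by (rule borel_measurable_continuous_onI)
  fix l u :: "real^'m"
  assume lu: "\<And>b. b \<in> Basis \<Longrightarrow> l \<bullet> b \<le> u \<bullet> b"
  define l' u' where "l' = (\<chi> i. l $ inv \<sigma> i)" and "u' = (\<chi> i. u $ inv \<sigma> i)"
  have inv: "inv \<sigma> (\<sigma> k) = k" "\<sigma> (inv \<sigma> i) = i" for k i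
    using assms by (simp_all add: bij_is_inj bij_is_surj surj_f_inv_f)
  have "?R -` box l u = box l' u'"
  proof (rule set_eqI)
    fix x
    have "(\<forall>k. l $ k < x $ \<sigma> k \<and> x $ \<sigma> k < u $ k) \<longleftrightarrow> (\<forall>i. l $ inv \<sigma> i < x $ i \<and> x $ i < u $ inv \<sigma> i)"
      using inv by metis
    then show "x \<in> ?R -` box l u \<longleftrightarrow> x \<in> box l' u'"
      by (simp add: mem_box_cart l'_def u'_def)
  qed
  then have "emeasure (distr lborel borel ?R) (box l u) = emeasure lborel (box l' u')"
    by (subst emeasure_distr) auto
  also have "\<dots> = (\<Prod>b\<in>Basis. (u' - l') \<bullet> b)"
  proof (rule emeasure_lborel_box)
    fix b :: "real^'n" assume "b \<in> Basis"
    then obtain i where b: "b = axis i 1" by (auto simp: Basis_vec_def)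
    have "axis (inv \<sigma> i) 1 \<in> (Basis :: (real^'m) set)" by (simp add: axis_in_Basis_iff)
    from lu[OF this] show "l' \<bullet> b \<le> u' \<bullet> b"
      by (simp add: b inner_axis l'_def u'_def)
  qed
  also have "(\<Prod>b\<in>Basis. (u' - l') \<bullet> b) = (\<Prod>i\<in>UNIV. u $ inv \<sigma> i - l $ inv \<sigma> i)"
    by (simp add: prod_Basis_vec inner_axis l'_def u'_def)
  also have "\<dots> = (\<Prod>k\<in>UNIV. u $ k - l $ k)"
    by (rule prod.reindex_bij_betw[OF bij_imp_bij_inv[OF assms], of "\<lambda>k. u $ k - l $ k"])
  also have "\<dots> = (\<Prod>b\<in>Basis. (u - l) \<bullet> b)"
    by (simp add: prod_Basis_vec inner_axis)
  finally show "emeasure (distr lborel borel ?R) (box l u) = (\<Prod>b\<in>Basis. (u - l) \<bullet> b)" .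
qed simp

text \<open>Everything is transported along a relabelling of the coordinates, which preserves
  Lebesgue measure, inner products and traces.\<close>

lemma area_inequality:
  fixes g :: "real^'n::finite \<Rightarrow> real^'n" and M :: "real^'n \<Rightarrow> real^'n^'n"
  assumes S: "compact S"
    and der: "\<And>x. (g has_derivative (\<lambda>t. M x *v t)) (at x)"
    and contM: "continuous_on S M"
    and psd: "\<And>x. x \<in> S \<Longrightarrow> psd (M x)" and sym: "\<And>x. x \<in> S \<Longrightarrow> transpose (M x) = M x"
    and contf: "continuous_on (g ` S) f" and nonneg: "\<And>x. x \<in> S \<Longrightarrow> 0 \<le> f (g x)"
  shows "(LINT y:g ` S|lborel. f y) \<le> fact CARD('n) * (LINT x:S|lborel. trace (M x) ^ CARD('n) * f (g x))"
proof -
  obtain \<sigma> :: "'n wo_index \<Rightarrow> 'n" where \<sigma>: "bij \<sigma>"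
    using finite_same_card_bij[of "UNIV :: 'n wo_index set" "UNIV :: 'n set"] card_wo_index[where 'n='n]
    by auto
  have inv: "inv \<sigma> (\<sigma> k) = k" "\<sigma> (inv \<sigma> i) = i" for k i
    using \<sigma> by (simp_all add: bij_is_inj bij_is_surj surj_f_inv_f)
  define R :: "real^'n \<Rightarrow> real^'n wo_index" where "R x = (\<chi> k. x $ \<sigma> k)" for x
  define R' :: "real^'n wo_index \<Rightarrow> real^'n" where "R' z = (\<chi> i. z $ inv \<sigma> i)" for z
  have RR: "R' (R x) = x" "R (R' z) = z" for x z
    by (simp_all add: R_def R'_def vec_eq_iff inv)
  have blR: "bounded_linear R"
    unfolding R_def by (intro linear_conv_bounded_linear[THEN iffD1] linearI) (simp_all add: vec_eq_iff)
  have blR': "bounded_linear R'"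
    unfolding R'_def by (intro linear_conv_bounded_linear[THEN iffD1] linearI) (simp_all add: vec_eq_iff)
  have cR: "continuous_on T R" and cR': "continuous_on T' R'" for T T'
    using blR blR' by (simp_all add: linear_continuous_on)
  have [measurable]: "R \<in> borel_measurable borel"
    using cR by (rule borel_measurable_continuous_onI)
  have distrR: "distr lborel borel R = lborel"
    using lborel_distr_reindex[OF \<sigma>] by (simp add: R_def[abs_def])
  have sum\<sigma>: "(\<Sum>k\<in>UNIV. F (\<sigma> k)) = (\<Sum>i\<in>UNIV. F i)" for F :: "'n \<Rightarrow> real"
    by (rule sum.reindex_bij_betw[OF \<sigma>])
  have int: "(LINT z:R ` T|lborel. F (R' z)) = (LINT x:T|lborel. F x)"
    if T: "compact T" and F: "continuous_on T F" for T and F :: "real^'n \<Rightarrow> real"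
  proof -
    have cRT: "compact (R ` T)" by (rule compact_continuous_image[OF cR T])
    have "continuous_on (R ` T) (\<lambda>z. F (R' z))"
      by (rule continuous_on_compose2[OF F cR']) (auto simp: RR)
    then have m: "(\<lambda>z. indicator (R ` T) z *\<^sub>R F (R' z)) \<in> borel_measurable borel"
      using borel_integrable_compact[OF cRT] borel_measurable_integrable by fastforce
    have "(LINT z:R ` T|lborel. F (R' z)) = (LINT z|distr lborel borel R. indicator (R ` T) z *\<^sub>R F (R' z))"
      unfolding distrR set_lebesgue_integral_def ..
    also have "\<dots> = (LINT x|lborel. indicator (R ` T) (R x) *\<^sub>R F (R' (R x)))"
      by (rule integral_distr) (use m in auto)
    also have "\<dots> = (LINT x:T|lborel. F x)"
    proof -
      have "R x \<in> R ` T \<longleftrightarrow> x \<in> T" for x using RR by (metis image_iff)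
      then show ?thesis unfolding set_lebesgue_integral_def by (simp add: RR indicator_def)
    qed
    finally show ?thesis .
  qed
  define G where "G z = R (g (R' z))" for z
  \<comment> \<open>The matrix of \<open>M (R' z)\<close> in the relabelled coordinates, that is,
    the derivative of \<open>G\<close> at \<open>z\<close>.\<close>
  define N :: "real^'n wo_index \<Rightarrow> real^'n wo_index^'n wo_index" where "N z = (\<chi> k l. M (R' z) $ \<sigma> k $ \<sigma> l)" for z
  have NM: "N z *v t = R (M (R' z) *v R' t)" for z t
  proof -
    have "(\<Sum>l\<in>UNIV. M (R' z) $ \<sigma> k $ \<sigma> l * t $ l) = (\<Sum>i\<in>UNIV. M (R' z) $ \<sigma> k $ i * t $ inv \<sigma> i)" for k
      using sum\<sigma>[of "\<lambda>i. M (R' z) $ \<sigma> k $ i * t $ inv \<sigma> i"] by (simp add: inv)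
    then show ?thesis by (simp add: matrix_vector_mult_def N_def R_def R'_def vec_eq_iff)
  qed
  have inner: "t \<bullet> R x = R' t \<bullet> x" for t x
    unfolding inner_vec_def R_def R'_def using sum\<sigma>[of "\<lambda>i. t $ inv \<sigma> i * x $ i"] by (simp add: inv)
  have tr: "trace (N z) = trace (M (R' z))" for z
    unfolding trace_def N_def using sum\<sigma>[of "\<lambda>i. M (R' z) $ i $ i"] by simp
  have contg: "continuous_on S g"
    using der by (meson has_derivative_continuous_on has_derivative_at_withinI)
  have GS: "G ` (R ` S) = R ` (g ` S)" by (auto simp: G_def RR image_iff)
  have "(LINT y:G ` (R ` S)|lborel. f (R' y)) \<le> fact CARD('n wo_index) *
      (LINT z:R ` S|lborel. trace (N z) ^ CARD('n wo_index) * f (R' (G z)))"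
  proof (rule area_inequality_wellorder)
    show "compact (R ` S)" by (rule compact_continuous_image[OF cR S])
    show "(G has_derivative (\<lambda>t. N z *v t)) (at z)" for z
      unfolding G_def NM
      by (intro bounded_linear.has_derivative[OF blR] has_derivative_compose[OF _ der]
          bounded_linear.has_derivative[OF blR'] has_derivative_ident)
    have "continuous_on (R ` S) (\<lambda>z. M (R' z))"
      by (rule continuous_on_compose2[OF contM cR']) (auto simp: RR)
    then show "continuous_on (R ` S) N"
      unfolding N_def by (intro continuous_on_vec_lambda continuous_on_component)
    show "psd (N z)" if "z \<in> R ` S" for z
      using that psd unfolding psd_def NM inner by (auto simp: RR)
    show "transpose (N z) = N z" if z: "z \<in> R ` S" for z
    proof -
      have "transpose (M (R' z)) = M (R' z)" using z sym by (auto simp: RR)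
      then have "transpose (M (R' z)) $ i $ j = M (R' z) $ i $ j" for i j by simp
      then have "M (R' z) $ j $ i = M (R' z) $ i $ j" for i j by (simp add: transpose_def)
      then show ?thesis by (simp add: N_def transpose_def vec_eq_iff)
    qed
    show "continuous_on (G ` (R ` S)) (\<lambda>y. f (R' y))"
      by (rule continuous_on_compose2[OF contf cR']) (auto simp: GS RR)
    show "0 \<le> f (R' (G z))" if "z \<in> R ` S" for z
      using that nonneg by (auto simp: G_def RR)
  qed
  also have "(LINT y:G ` (R ` S)|lborel. f (R' y)) = (LINT y:g ` S|lborel. f y)"
    unfolding GS by (rule int[OF compact_continuous_image[OF contg S] contf])
  also have "(LINT z:R ` S|lborel. trace (N z) ^ CARD('n wo_index) * f (R' (G z))) =
      (LINT z:R ` S|lborel. (\<lambda>x. trace (M x) ^ CARD('n) * f (g x)) (R' z))"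
    by (simp add: tr G_def RR card_wo_index)
  also have "\<dots> = (LINT x:S|lborel. trace (M x) ^ CARD('n) * f (g x))"
  proof (rule int[OF S])
    have "continuous_on S (\<lambda>x. f (g x))"
      using continuous_on_compose2[OF contf contg] by simp
    then show "continuous_on S (\<lambda>x. trace (M x) ^ CARD('n) * f (g x))"
      unfolding trace_def using contM by (intro continuous_intros continuous_on_component) auto
  qed
  finally show ?thesis by (simp add: card_wo_index)
qed

section \<open>Mollification of weak derivatives\<close>

lemma mollifier_translation_bound:
  fixes h :: "real^'n \<Rightarrow> real"
  assumes hi: "integrable lborel h" and hp: "integrable lborel (\<lambda>x. \<bar>h x\<bar> ^ p)" and "d > 0"
    and e: "\<And>z. norm z < d \<Longrightarrow> (LINT y|lborel. \<bar>h (z + y) - h y\<bar> ^ p) \<le> e" and "e \<ge> 0"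
  shows "integrable lborel (\<lambda>y. \<bar>conv h (mollifier d) y - h y\<bar> ^ p)"
    and "(LINT y|lborel. \<bar>conv h (mollifier d) y - h y\<bar> ^ p) \<le> e"
proof -
  have "bounded (range (mollifier d :: real^'n \<Rightarrow> real))"
    by (rule bump_class_uniformly_continuous(2)[OF mollifier_in_class \<open>d > 0\<close>])
  then obtain B where B: "\<And>x :: real^'n. \<bar>mollifier d x\<bar> \<le> B" by (auto simp: bounded_iff)
  have B': "mollifier d x \<le> B" for x :: "real^'n" using B[of x] by simp
  have z: "mollifier d x = 0" if "norm x \<ge> d" for x :: "real^'n"
    by (rule bump_class_norm_ge[OF mollifier_in_class \<open>d > 0\<close> that])
  note * = hi hp bump_class_integrable[OF mollifier_in_class \<open>d > 0\<close>] mollifier_integral[OF \<open>d > 0\<close>]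
    mollifier_nonneg[OF \<open>d > 0\<close>] B' z e \<open>e \<ge> 0\<close>
  show "integrable lborel (\<lambda>y. \<bar>conv h (mollifier d) y - h y\<bar> ^ p)"
    by (rule Lp_mollify_bound(1)[OF *])
  show "(LINT y|lborel. \<bar>conv h (mollifier d) y - h y\<bar> ^ p) \<le> e"
    by (rule Lp_mollify_bound(2)[OF *])
qed

text \<open>For an arbitrary radius the translation differences need not be small, but they are
  bounded uniformly in \<open>z\<close> by a multiple of the integral of the p-th power, and a bound
  is all that integrability takes.\<close>

lemma mollify_integrable:
  fixes h :: "real^'n \<Rightarrow> real"
  assumes hi: "integrable lborel h" and hp: "integrable lborel (\<lambda>x. \<bar>h x\<bar> ^ p)" and "d > 0"
  shows "integrable lborel (\<lambda>y. \<bar>conv h (mollifier d) y - h y\<bar> ^ p)"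
proof -
  have hm: "h \<in> borel_measurable borel" by (rule borel_measurable_integrable_borel[OF hi])
  define e where "e = 2 * 2 ^ p * (LINT y|lborel. \<bar>h y\<bar> ^ p)"
  have "(LINT y|lborel. \<bar>h (z + y) - h y\<bar> ^ p) \<le> e" for z
  proof -
    have m: "(\<lambda>x. \<bar>h x\<bar> ^ p) \<in> borel_measurable borel" using hm by measurable
    have i: "integrable lborel (\<lambda>y. \<bar>h (z + y)\<bar> ^ p)"
      using lborel_integral_shift(2)[OF m, of z] hp by blast
    have "(LINT y|lborel. \<bar>h (z + y) - h y\<bar> ^ p) \<le> (LINT y|lborel. 2 ^ p * (\<bar>h (z + y)\<bar> ^ p + \<bar>h y\<bar> ^ p))"
    proof (rule integral_mono)
      show "integrable lborel (\<lambda>y. \<bar>h (z + y) - h y\<bar> ^ p)" by (rule integrable_Lp_translation[OF hm hp])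
      show "integrable lborel (\<lambda>y. 2 ^ p * (\<bar>h (z + y)\<bar> ^ p + \<bar>h y\<bar> ^ p))"
        by (intro integrable_mult_right Bochner_Integration.integrable_add i hp)
      fix y
      have "\<bar>h (z + y) - h y\<bar> ^ p \<le> (\<bar>h (z + y)\<bar> + \<bar>h y\<bar>) ^ p" by (rule power_mono) auto
      also have "\<dots> \<le> 2 ^ p * (\<bar>h (z + y)\<bar> ^ p + \<bar>h y\<bar> ^ p)" by (rule power_sum2_le) auto
      finally show "\<bar>h (z + y) - h y\<bar> ^ p \<le> 2 ^ p * (\<bar>h (z + y)\<bar> ^ p + \<bar>h y\<bar> ^ p)" .
    qed
    also have "\<dots> = 2 ^ p * ((LINT y|lborel. \<bar>h (z + y)\<bar> ^ p) + (LINT y|lborel. \<bar>h y\<bar> ^ p))"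
      using i hp by simp
    also have "(LINT y|lborel. \<bar>h (z + y)\<bar> ^ p) = (LINT y|lborel. \<bar>h y\<bar> ^ p)"
      by (rule lborel_integral_shift(1)[OF m])
    finally show ?thesis by (simp add: e_def)
  qed
  moreover have "e \<ge> 0" by (simp add: e_def)
  ultimately show ?thesis
    by (rule mollifier_translation_bound(1)[OF hi hp \<open>d > 0\<close>])
qed

lemma mollify_tendsto:
  fixes h :: "real^'n \<Rightarrow> real"
  assumes hi: "integrable lborel h" and hp: "integrable lborel (\<lambda>x. \<bar>h x\<bar> ^ p)" and "p \<ge> 1"
    and d: "\<And>k. d k > 0" "d \<longlonglongrightarrow> 0"
  shows "(\<lambda>k. LINT y|lborel. \<bar>conv h (mollifier (d k)) y - h y\<bar> ^ p) \<longlonglongrightarrow> 0"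
proof (rule LIMSEQ_I)
  fix e :: real assume "e > 0"
  then have "e / 2 > 0" by simp
  from Lp_translation[OF hi hp \<open>p \<ge> 1\<close> this] obtain \<delta> where \<delta>: "\<delta> > 0"
    "\<And>z. norm z < \<delta> \<Longrightarrow> (LINT y|lborel. \<bar>h (z + y) - h y\<bar> ^ p) < e / 2" by blast
  have "\<forall>\<^sub>F k in sequentially. d k < \<delta>"
    using d(2) \<open>\<delta> > 0\<close> by (intro order_tendstoD)
  then obtain N where N: "\<And>k. k \<ge> N \<Longrightarrow> d k < \<delta>" by (auto simp: eventually_sequentially)
  show "\<exists>no. \<forall>k\<ge>no. norm ((LINT y|lborel. \<bar>conv h (mollifier (d k)) y - h y\<bar> ^ p) - 0) < e"
  proof (intro exI[of _ N] allI impI)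
    fix k assume "k \<ge> N"
    have "(LINT y|lborel. \<bar>h (z + y) - h y\<bar> ^ p) \<le> e / 2" if "norm z < d k" for z
      using \<delta>(2)[of z] N[OF \<open>k \<ge> N\<close>] that by simp
    then have "(LINT y|lborel. \<bar>conv h (mollifier (d k)) y - h y\<bar> ^ p) \<le> e / 2"
      by (rule mollifier_translation_bound(2)[OF hi hp d(1)]) (use \<open>e > 0\<close> in auto)
    moreover have "0 \<le> (LINT y|lborel. \<bar>conv h (mollifier (d k)) y - h y\<bar> ^ p)" by simp
    ultimately show "norm ((LINT y|lborel. \<bar>conv h (mollifier (d k)) y - h y\<bar> ^ p) - 0) < e"
      using \<open>e > 0\<close> by simp
  qed
qed

text \<open>A mean of values within \<kappa> of \<open>c\<close> is within \<kappa> of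
  \<open>c\<close>. Unlike the integral estimates this holds at a prescribed point, which is what
  the comparison at \<open>x0\<close> and on a sphere calls for.\<close>

lemma conv_mollifier_close:
  fixes h :: "real^'n \<Rightarrow> real"
  assumes hi: "integrable lborel h" and "d > 0"
    and close: "\<And>z. norm z < d \<Longrightarrow> \<bar>h (z + y) - c\<bar> \<le> \<kappa>"
  shows "\<bar>conv h (mollifier d) y - c\<bar> \<le> \<kappa>"
proof -
  note hm [measurable] = borel_measurable_integrable_borel[OF hi]
  have mi: "integrable lborel (mollifier d :: real^'n \<Rightarrow> real)"
    by (rule bump_class_integrable[OF mollifier_in_class \<open>d > 0\<close>])
  note mm [measurable] = borel_measurable_integrable_borel[OF mi]
  have z: "mollifier d x = 0" if "norm x \<ge> d" for x :: "real^'n"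
    by (rule bump_class_norm_ge[OF mollifier_in_class \<open>d > 0\<close> that])
  have bd: "\<bar>(h (z + y) - c) * mollifier d z\<bar> \<le> \<kappa> * mollifier d z" for z
  proof (cases "norm z < d")
    case True
    then show ?thesis
      using close[OF True] mollifier_nonneg[OF \<open>d > 0\<close>, of z] by (simp add: abs_mult mult_right_mono)
  qed (simp add: z)
  have i: "integrable lborel (\<lambda>z. (h (z + y) - c) * mollifier d z)"
    by (rule Bochner_Integration.integrable_bound[of _ "\<lambda>z. \<kappa> * mollifier d z"])
      (use mi bd in \<open>auto intro: order_trans[OF _ abs_ge_self]\<close>)
  have eq: "h (z + y) * mollifier d z = (h (z + y) - c) * mollifier d z + c * mollifier d z" for z
    by (simp add: algebra_simps)
  have "conv h (mollifier d) y = (LINT z|lborel. h (z + y) * mollifier d z)"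
    by (rule conv_borel) measurable
  also have "\<dots> = (LINT z|lborel. (h (z + y) - c) * mollifier d z) + c"
    unfolding eq using i mi mollifier_integral[OF \<open>d > 0\<close>, where 'n='n] by simp
  finally have "\<bar>conv h (mollifier d) y - c\<bar> = \<bar>LINT z|lborel. (h (z + y) - c) * mollifier d z\<bar>" by simp
  also have "\<dots> \<le> (LINT z|lborel. \<bar>(h (z + y) - c) * mollifier d z\<bar>)"
    by (rule integral_abs_bound)
  also have "\<dots> \<le> (LINT z|lborel. \<kappa> * mollifier d (z :: real^'n))"
    by (rule integral_mono) (use i mi bd in auto)
  also have "\<dots> = \<kappa>" using mollifier_integral[OF \<open>d > 0\<close>, where 'n='n] by simp
  finally show ?thesis .
qed

text \<open>Weak derivatives are Lebesgue measurable and only locally integrable on the open ball,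
  whereas the convolution estimates work with Borel functions integrable over the whole space.
  Cutting off to \<open>cball 0 R\<close> and changing the values on a null set bridges the
  two.\<close>

lemma borel_representative:
  fixes f :: "real^'n \<Rightarrow> real"
  assumes "locally_integrable_on f (ball 0 1)" "R < 1"
  obtains g where "integrable lborel g" "AE x in lebesgue. g x = indicator (cball 0 R) x * f x"
proof -
  have "cball (0 :: real^'n) R \<subseteq> ball 0 1" using assms(2) by auto
  then have "set_integrable lebesgue (cball 0 R) f"
    using assms(1) by (auto simp: locally_integrable_on_def)
  then have i: "integrable lebesgue (\<lambda>x. indicator (cball 0 R) x * f x)"
    by (simp add: set_integrable_def)
  obtain g where g: "g \<in> borel_measurable lborel" "AE x in lborel. indicator (cball 0 R) x * f x = g x"
    using completion_ex_borel_measurable_real[OF borel_measurable_integrable[OF i]] by blast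
  have AE: "AE x in lebesgue. g x = indicator (cball 0 R) x * f x"
    using AE_completion[OF g(2)] by (simp add: eq_commute)
  have "integrable lebesgue g"
    using integrable_cong_AE[THEN iffD1, OF _ _ _ i, of g] AE g(1) i
    by (auto simp: eq_commute measurable_completion)
  then have "integrable lborel g"
    using g(1) by (simp add: integrable_completion)
  with AE that show ?thesis by blast
qed

lemma Lp_representative:
  fixes f g :: "real^'n \<Rightarrow> real"
  assumes f: "f \<in> Lp_space (real n) (ball 0 1)" and "n \<ge> 1" "R < 1"
    and g: "integrable lborel g" "AE x in lebesgue. g x = indicator (cball 0 R) x * f x"
  shows "integrable lborel (\<lambda>x. \<bar>g x\<bar> ^ n)"
proof -
  have gm [measurable]: "g \<in> borel_measurable borel" by (rule borel_measurable_integrable_borel[OF g(1)])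
  have "integrable (lebesgue_on (ball 0 1)) (\<lambda>x. norm (f x) powr real n)"
    using f by (simp add: Lp_space_def)
  then have i: "integrable lebesgue (\<lambda>x. indicator (ball 0 1) x *\<^sub>R (norm (f x) powr real n))"
    by (subst (asm) integrable_restrict_space) auto
  have "integrable lebesgue (\<lambda>x. \<bar>g x\<bar> ^ n)"
  proof (rule Bochner_Integration.integrable_bound[OF i])
    show "(\<lambda>x. \<bar>g x\<bar> ^ n) \<in> borel_measurable lebesgue" by (intro measurable_completion) measurable
    show "AE x in lebesgue. norm (\<bar>g x\<bar> ^ n) \<le> norm (indicator (ball 0 1) x *\<^sub>R (norm (f x) powr real n))"
      using g(2)
    proof eventually_elim
      case (elim x)
      show ?case
      proof (cases "x \<in> cball 0 R")
        case True
        then have "x \<in> ball 0 1" using \<open>R < 1\<close> by auto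
        then show ?thesis using elim True \<open>n \<ge> 1\<close>
          by (cases "f x = 0") (auto simp: powr_realpow power_abs power_0_left)
      qed (use elim \<open>n \<ge> 1\<close> in \<open>auto simp: power_0_left\<close>)
    qed
  qed
  moreover have "(\<lambda>x. \<bar>g x\<bar> ^ n) \<in> borel_measurable lborel" by measurable
  ultimately show ?thesis by (simp add: integrable_completion)
qed

text \<open>On \<open>ball 0 r\<close> the mollifications of \<open>w\<close> and \<open>w'\<close>
  coincide, both being determined by \<open>u\<close> tested against derivatives of the mollifier;
  they converge in L^1 to \<open>w\<close> and \<open>w'\<close>. It is needed because
  \<open>sobolev\<close> provides some version in L^n, while the gradient and Hessian are given as
  versions of their own.\<close>

lemma weak_deriv_unique:
  fixes u w w' :: "real^'n \<Rightarrow> real"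
  assumes w: "has_weak_deriv (ball 0 1) js u w" and w': "has_weak_deriv (ball 0 1) js u w'"
    and "r < 1"
  shows "AE x in lebesgue. x \<in> ball 0 r \<longrightarrow> w x = w' x"
proof -
  define R where "R = (r + 1) / 2"
  have R: "r < R" "R < 1" using \<open>r < 1\<close> by (auto simp: R_def)
  obtain h where h: "integrable lborel h" "AE x in lebesgue. h x = indicator (cball 0 R) x * u x"
    using borel_representative[of u R] w R by (auto simp: has_weak_deriv_def)
  obtain g where g: "integrable lborel g" "AE x in lebesgue. g x = indicator (cball 0 R) x * w x"
    using borel_representative[of w R] w R by (auto simp: has_weak_deriv_def)
  obtain g' where g': "integrable lborel g'" "AE x in lebesgue. g' x = indicator (cball 0 R) x * w' x"
    using borel_representative[of w' R] w' R by (auto simp: has_weak_deriv_def)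
  note [measurable] = borel_measurable_integrable_borel[OF h(1)] borel_measurable_integrable_borel[OF g(1)]
    borel_measurable_integrable_borel[OF g'(1)]
  have eqs: "AE x in lebesgue. x \<in> ball 0 R \<longrightarrow> h x = u x" "AE x in lebesgue. x \<in> ball 0 R \<longrightarrow> g x = w x"
    "AE x in lebesgue. x \<in> ball 0 R \<longrightarrow> g' x = w' x"
    using h(2) g(2) g'(2) by (eventually_elim, simp add: indicator_def)+
  \<comment> \<open>The shift by 2 keeps the radius strictly below \<open>R - r\<close> already at
    \<open>k = 0\<close>.\<close>
  define d where "d k = (R - r) / real (k + 2)" for k
  have d0: "d k > 0" for k using R by (simp add: d_def)
  have dR: "d k < R - r" for k using R by (simp add: d_def divide_less_eq)
  have dlim: "d \<longlonglongrightarrow> 0"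
    unfolding d_def using LIMSEQ_ignore_initial_segment[OF lim_const_over_n, of "R - r" 2] by simp
  let ?D = "\<lambda>g k y. \<bar>conv g (mollifier (d k)) y - g y\<bar>"
  have i: "integrable lborel (?D g k)" "integrable lborel (?D g' k)" for k
    using mollify_integrable[of g 1 "d k"] mollify_integrable[of g' 1 "d k"] g(1) g'(1) d0 by auto
  have conv_eq: "conv g (mollifier (d k)) y = conv g' (mollifier (d k)) y" if "y \<in> ball 0 r" for k y
  proof -
    have n: "norm y + d k < R" using that dR[of k] by simp
    have "(-1) ^ length js * conv g (mollifier (d k)) y = conv h (iter_pderiv js (mollifier (d k))) y"
      by (rule conv_weak_deriv[OF w _ _ eqs(1,2) d0 n, symmetric]) (use R in auto)
    also have "\<dots> = (-1) ^ length js * conv g' (mollifier (d k)) y"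
      by (rule conv_weak_deriv[OF w' _ _ eqs(1,3) d0 n]) (use R in auto)
    finally show ?thesis by simp
  qed
  let ?F = "\<lambda>y. indicator (ball 0 r) y * \<bar>g y - g' y\<bar>"
  have Fi: "integrable lborel ?F"
    by (rule Bochner_Integration.integrable_bound[of _ "\<lambda>y. \<bar>g y - g' y\<bar>"])
       (use g(1) g'(1) in \<open>auto simp: indicator_def\<close>)
  have "(LINT y|lborel. ?F y) \<le> 0"
  proof (rule LIMSEQ_le_const)
    show "(\<lambda>k. (LINT y|lborel. ?D g k y) + (LINT y|lborel. ?D g' k y)) \<longlonglongrightarrow> 0"
      using tendsto_add[OF mollify_tendsto[of g 1 d] mollify_tendsto[of g' 1 d]] g(1) g'(1) d0 dlim by simp
    show "\<exists>N. \<forall>k\<ge>N. (LINT y|lborel. ?F y) \<le> (LINT y|lborel. ?D g k y) + (LINT y|lborel. ?D g' k y)"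
    proof (intro exI[of _ 0] allI impI)
      fix k
      have "(LINT y|lborel. ?F y) \<le> (LINT y|lborel. ?D g k y + ?D g' k y)"
      proof (rule integral_mono[OF Fi Bochner_Integration.integrable_add[OF i]])
        fix y show "?F y \<le> ?D g k y + ?D g' k y"
          using conv_eq[of y k] by (cases "y \<in> ball 0 r") auto
      qed
      then show "(LINT y|lborel. ?F y) \<le> (LINT y|lborel. ?D g k y) + (LINT y|lborel. ?D g' k y)"
        using i by simp
    qed
  qed
  moreover have "0 \<le> (LINT y|lborel. ?F y)" by simp
  ultimately have "(LINT y|lborel. ?F y) = 0" by simp
  then have "AE y in lborel. ?F y = 0"
    by (subst (asm) integral_nonneg_eq_0_iff_AE[OF Fi]) auto
  then have "AE y in lebesgue. ?F y = 0" by (rule AE_completion)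
  with eqs(2,3) show ?thesis
    by eventually_elim (use R in \<open>auto simp: indicator_def\<close>)
qed

text \<open>Along a subsequence \<open>q\<close> tends to 0 almost everywhere, so each point
  eventually leaves the sets where \<open>q\<close> is at least \<delta>; dominated convergence with
  \<open>F\<close> as majorant does the rest. It will be applied with \<open>q\<close> the distance
  of two gradients and \<open>F\<close> a power of the Hessian.\<close>

lemma L1_tendsto_bad_set_subseq:
  fixes q :: "nat \<Rightarrow> 'a \<Rightarrow> real" and F :: "'a \<Rightarrow> real"
  assumes q: "\<And>k. integrable M (q k)" "(\<lambda>k. LINT x|M. \<bar>q k x\<bar>) \<longlonglongrightarrow> 0"
    and F: "integrable M F" and "\<delta> > 0"
  obtains s where "strict_mono s" "(\<lambda>k. LINT x|M. indicator {x. q (s k) x \<ge> \<delta>} x * F x) \<longlonglongrightarrow> 0"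
    "\<And>k. integrable M (\<lambda>x. indicator {x. q k x \<ge> \<delta>} x * F x)"
proof -
  have [measurable]: "q k \<in> borel_measurable M" for k using q(1) by simp
  have [measurable]: "F \<in> borel_measurable M" using F by simp
  obtain s where s: "strict_mono s" "AE x in M. (\<lambda>k. q (s k) x) \<longlonglongrightarrow> 0"
    using tendsto_L1_AE_subseq[where u=q, OF q(1)] q(2) by auto
  have m: "(\<lambda>x. indicator {x. q k x \<ge> \<delta>} x * F x) \<in> borel_measurable M" for k
  proof -
    have "(\<lambda>x. if q k x \<ge> \<delta> then F x else 0) \<in> borel_measurable M" by measurable
    then show ?thesis by (rule measurable_cong[THEN iffD1, rotated]) (auto simp: indicator_def)
  qed
  have b: "AE x in M. norm (indicator {x. q k x \<ge> \<delta>} x * F x) \<le> norm (F x)" for k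
    by (auto simp: indicator_def)
  have "(\<lambda>k. LINT x|M. indicator {x. q (s k) x \<ge> \<delta>} x * F x) \<longlonglongrightarrow> (LINT x|M. 0)"
  proof (rule integral_dominated_convergence[where w="\<lambda>x. norm (F x)"])
    show "AE x in M. (\<lambda>k. indicator {x. q (s k) x \<ge> \<delta>} x * F x) \<longlonglongrightarrow> 0"
      using s(2)
    proof eventually_elim
      case (elim x)
      have "\<forall>\<^sub>F k in sequentially. q (s k) x < \<delta>"
        using elim \<open>\<delta> > 0\<close> by (intro order_tendstoD)
      then have "\<forall>\<^sub>F k in sequentially. indicator {x. q (s k) x \<ge> \<delta>} x * F x = 0"
        by eventually_elim (auto simp: indicator_def)
      then show ?case by (rule tendsto_eventually)
    qed
  qed (use F m b in auto)
  then show ?thesis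
    using that s(1) Bochner_Integration.integrable_bound[OF F m b] by simp
qed

section \<open>Contact points and the weight on annuli\<close>

text \<open>This takes the place of the convex envelope in the usual proof.\<close>
lemma interior_minimum_tilted:
  fixes v :: "real^'n \<Rightarrow> real" and G :: "real^'n \<Rightarrow> real^'n" and M :: "real^'n \<Rightarrow> real^'n^'n"
  assumes dv: "\<And>x. (v has_derivative (\<lambda>t. t \<bullet> G x)) (at x)"
    and dG: "\<And>x. (G has_derivative (\<lambda>t. M x *v t)) (at x)"
    and x0: "x0 \<in> cball 0 r"
    and bd: "\<And>x. x \<in> sphere 0 r \<Longrightarrow> v x0 - p \<bullet> x0 < v x - p \<bullet> x"
  obtains y where "y \<in> ball 0 r" "G y = p" "psd (M y)"
proof -
  have "continuous_on (cball 0 r) (\<lambda>x. v x - p \<bullet> x)"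
    using dv by (intro continuous_intros) (meson has_derivative_continuous_on has_derivative_at_withinI)
  then have "\<exists>y\<in>cball 0 r. \<forall>x\<in>cball 0 r. v y - p \<bullet> y \<le> v x - p \<bullet> x"
    using x0 by (intro continuous_attains_inf) (auto simp del: cball_eq_empty)
  then obtain y where y: "y \<in> cball 0 r" "\<And>x. x \<in> cball 0 r \<Longrightarrow> v y - p \<bullet> y \<le> v x - p \<bullet> x"
    by blast
  have "y \<notin> sphere 0 r" using bd[of y] y(2)[OF x0] by auto
  with y(1) have yb: "y \<in> ball 0 r" by auto
  then obtain \<epsilon> where \<epsilon>: "\<epsilon> > 0" "ball y \<epsilon> \<subseteq> ball 0 r"
    using openE[OF open_ball] by blast
  define \<phi> where "\<phi> \<xi> t = v (y + t *\<^sub>R \<xi>) - p \<bullet> (y + t *\<^sub>R \<xi>)" for \<xi> t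
  define \<phi>' where "\<phi>' \<xi> t = (G (y + t *\<^sub>R \<xi>) - p) \<bullet> \<xi>" for \<xi> t
  have line: "((\<lambda>t. y + t *\<^sub>R \<xi>) has_derivative (\<lambda>t. t *\<^sub>R \<xi>)) (at t)" for \<xi> t
    by (auto intro!: derivative_eq_intros)
  have d1: "(\<phi> \<xi> has_real_derivative \<phi>' \<xi> t) (at t)" for \<xi> t
  proof -
    have "(\<phi> \<xi> has_derivative (\<lambda>s. (s *\<^sub>R \<xi>) \<bullet> G (y + t *\<^sub>R \<xi>) - p \<bullet> (s *\<^sub>R \<xi>))) (at t)"
      unfolding \<phi>_def
      by (intro has_derivative_diff has_derivative_compose[OF line dv] bounded_linear.has_derivative[OF bounded_linear_inner_right] line)
    then show ?thesis
      unfolding has_field_derivative_def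
      by (rule has_derivative_eq_rhs) (auto simp: \<phi>'_def fun_eq_iff inner_diff_left inner_commute algebra_simps)
  qed
  have d2: "(\<phi>' \<xi> has_real_derivative \<xi> \<bullet> (M y *v \<xi>)) (at 0)" for \<xi>
  proof -
    have "(\<phi>' \<xi> has_derivative (\<lambda>s. (M (y + 0 *\<^sub>R \<xi>) *v (s *\<^sub>R \<xi>) - 0) \<bullet> \<xi>)) (at 0)"
      unfolding \<phi>'_def
      by (intro bounded_linear.has_derivative[OF bounded_linear_inner_left] has_derivative_diff has_derivative_const
          has_derivative_compose[OF line dG])
    then show ?thesis
      unfolding has_field_derivative_def
      by (rule has_derivative_eq_rhs) (auto simp: fun_eq_iff matrix_vector_mult_scaleR inner_commute mult.commute)
  qed
  have min: "\<exists>e>0. \<forall>t. \<bar>t\<bar> < e \<longrightarrow> \<phi> \<xi> 0 \<le> \<phi> \<xi> t" for \<xi>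
  proof (intro exI conjI allI impI)
    show "\<epsilon> / (norm \<xi> + 1) > 0" using \<epsilon>(1) by (simp add: add_nonneg_pos)
    fix t :: real assume t: "\<bar>t\<bar> < \<epsilon> / (norm \<xi> + 1)"
    have "\<bar>t\<bar> * norm \<xi> \<le> \<bar>t\<bar> * (norm \<xi> + 1)" by (intro mult_left_mono) auto
    also have "\<dots> < \<epsilon>" using t by (simp add: pos_less_divide_eq add_nonneg_pos)
    finally have "y + t *\<^sub>R \<xi> \<in> ball y \<epsilon>" by (simp add: dist_norm)
    then have "y + t *\<^sub>R \<xi> \<in> cball 0 r" using \<epsilon>(2) by auto
    from y(2)[OF this] show "\<phi> \<xi> 0 \<le> \<phi> \<xi> t" by (simp add: \<phi>_def)
  qed
  have crit: "\<phi>' \<xi> 0 = 0" for \<xi>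
  proof -
    obtain e where e: "e > 0" "\<And>t. \<bar>t\<bar> < e \<Longrightarrow> \<phi> \<xi> 0 \<le> \<phi> \<xi> t" using min by blast
    show ?thesis by (rule DERIV_local_min[OF d1 e(1)]) (use e(2) in auto)
  qed
  have Gp: "G y = p"
    using crit[of "G y - p"] by (simp add: \<phi>'_def)
  \<comment> \<open>A negative second derivative along \<xi>, at a zero of \<phi>', makes \<phi>'
    negative just to the right of 0, and the mean value theorem then produces a value below the
    minimum.\<close>
  have "psd (M y)"
    unfolding psd_def
  proof (rule allI, rule ccontr)
    fix \<xi> assume "\<not> 0 \<le> \<xi> \<bullet> (M y *v \<xi>)"
    then have "\<xi> \<bullet> (M y *v \<xi>) < 0" by simp
    from DERIV_neg_dec_right[OF d2 this] obtain e1 where e1: "e1 > 0"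
      "\<And>t. t > 0 \<Longrightarrow> t < e1 \<Longrightarrow> \<phi>' \<xi> t < 0" using crit[of \<xi>] by auto
    obtain e where e: "e > 0" "\<And>t. \<bar>t\<bar> < e \<Longrightarrow> \<phi> \<xi> 0 \<le> \<phi> \<xi> t" using min by blast
    define t where "t = min e e1 / 2"
    have t: "0 < t" "t < e" "t < e1" using e(1) e1(1) by (auto simp: t_def)
    obtain z where z: "z > 0" "z < t" "\<phi> \<xi> t - \<phi> \<xi> 0 = (t - 0) * \<phi>' \<xi> z"
      using MVT2[OF t(1) d1] by blast
    have "\<phi>' \<xi> z < 0" using e1(2) z t by simp
    then have "\<phi> \<xi> t < \<phi> \<xi> 0" using z(3) t(1) mult_pos_neg[of t "\<phi>' \<xi> z"] by simp
    then show False using e(2)[of t] t by simp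
  qed
  then show ?thesis using that yb Gp by blast
qed

text \<open>On an annulus between radii s/2 and s the weight is at least s^-n, while the volume is
  at least half that of the ball of radius s; the product does not depend on s. Between
  \<open>c\<close> and 1/2 there is room for \<open>N\<close> such dyadic annuli.\<close>

lemma annulus_integral_ge:
  fixes c :: real
  assumes "0 < c" "c \<le> (1/2) ^ (N + 1)"
  shows "real N * (measure lborel (cball (0::real^'n) 1) / 2)
    \<le> (LINT p:cball 0 (1/2) - ball 0 c|lborel. (1 / norm (p :: real^'n)) ^ CARD('n))"
proof -
  define n where "n = CARD('n)"
  have "n \<ge> 1" unfolding n_def by (simp add: Suc_leI)
  let ?f = "\<lambda>p :: real^'n. (1 / norm p) ^ n"
  define \<omega> where "\<omega> = measure lborel (cball (0::real^'n) 1)"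
  \<comment> \<open>\<open>Q k\<close> is the union of the \<open>k\<close> outermost annuli, empty
    for \<open>k = 0\<close>.\<close>
  define Q where "Q k = cball (0::real^'n) (1/2) - cball 0 ((1/2) ^ (k + 1))" for k :: nat
  define A where "A k = cball (0::real^'n) ((1/2) ^ (k + 1)) - cball 0 ((1/2) ^ (k + 2))" for k :: nat
  have si: "set_integrable lborel T ?f" if T: "T \<in> sets borel" "T \<subseteq> cball 0 (1/2) - ball 0 d" and "d > 0" for T d
  proof -
    have K: "compact (cball (0::real^'n) (1/2) - ball 0 d)" by (rule compact_diff) auto
    have "continuous_on (cball (0::real^'n) (1/2) - ball 0 d) ?f"
      using \<open>d > 0\<close> by (intro continuous_intros) auto
    then have "set_integrable lborel (cball 0 (1/2) - ball 0 d) ?f"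
      unfolding set_integrable_def by (rule borel_integrable_compact[OF K])
    then show ?thesis using T by (auto intro: set_integrable_subset)
  qed
  have half_pos: "(1/2 :: real) ^ j > 0" for j by simp
  have half_le: "(1/2 :: real) ^ (k + 1) \<le> 1/2" for k
    using power_decreasing[of 1 "k + 1" "1/2 :: real"] by simp
  have AQ: "Q k \<in> sets borel" "A k \<in> sets borel" for k by (auto simp: Q_def A_def)
  have sQ: "set_integrable lborel (Q k) ?f" for k
    by (rule si[OF AQ(1) _ half_pos[of "k + 1"]]) (auto simp: Q_def)
  have sA: "set_integrable lborel (A k) ?f" for k
    by (rule si[OF AQ(2) _ half_pos[of "k + 2"]]) (use half_le[of k] in \<open>auto simp: A_def\<close>)
  have cc: "measure lborel (cball (0::real^'n) s) = \<omega> * s ^ n" if "s \<ge> 0" for s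
    using that by (simp add: \<omega>_def n_def content_cball)
  have An: "\<omega> / 2 \<le> (LINT p:A k|lborel. ?f p)" for k
  proof -
    define s where "s = (1/2 :: real) ^ (k + 1)"
    have s: "s > 0" by (simp add: s_def)
    have Aeq: "A k = cball 0 s - cball 0 (s / 2)" by (simp add: A_def s_def)
    have "measure lborel (A k) = measure lborel (cball (0::real^'n) s) - measure lborel (cball (0::real^'n) (s / 2))"
      unfolding Aeq using s
      using emeasure_lborel_cball_finite[of "0::real^'n" s]
      by (intro measure_Diff) (auto simp: top.not_eq_extremum intro!: subset_cball)
    also have "\<dots> = \<omega> * s ^ n * (1 - (1/2) ^ n)"
      using s by (simp add: cc power_divide algebra_simps)
    finally have cA: "measure lborel (A k) = \<omega> * s ^ n * (1 - (1/2) ^ n)" .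
    have "(1/2 :: real) ^ n \<le> 1/2"
      using power_decreasing[OF \<open>n \<ge> 1\<close>, of "1/2 :: real"] by simp
    then have "\<omega> / 2 \<le> \<omega> * (1 - (1/2) ^ n)"
      using mult_left_mono[of "1/2" "1 - (1/2 :: real) ^ n" \<omega>] by (simp add: \<omega>_def)
    also have "\<dots> = (1 / s) ^ n * measure lborel (A k)"
      using s by (simp add: cA power_divide)
    also have "\<dots> = (LINT p:A k|lborel. (1 / s) ^ n)"
      by (simp add: set_lebesgue_integral_def)
    also have "\<dots> \<le> (LINT p:A k|lborel. ?f p)"
    proof (rule set_integral_mono[OF _ sA])
      have "emeasure lborel (A k) < \<infinity>"
        unfolding Aeq by (rule emeasure_bounded_finite) (auto intro: bounded_subset[OF bounded_cball])
      then show "set_integrable lborel (A k) (\<lambda>p. (1 / s) ^ n)"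
        unfolding set_integrable_def using AQ(2)[of k]
        by (intro integrable_scaleR_left integrable_real_indicator) auto
      fix p assume p: "p \<in> A k"
      then have "norm p > 0" "norm p \<le> s" using s by (auto simp: Aeq intro: less_trans[of _ "s/2"])
      then show "(1 / s) ^ n \<le> ?f p"
        using s by (intro power_mono divide_left_mono) auto
    qed
    finally show ?thesis .
  qed
  have main: "real k * (\<omega> / 2) \<le> (LINT p:Q k|lborel. ?f p)" for k
  proof (induction k)
    case 0 show ?case by (simp add: Q_def set_lebesgue_integral_def)
  next
    case (Suc k)
    have "Q (Suc k) = Q k \<union> A k"
    proof -
      have split: "cball (0::real^'n) (1/2) - cball 0 s2 = (cball 0 (1/2) - cball 0 s1) \<union> (cball 0 s1 - cball 0 s2)"
        if "s2 \<le> s1" "s1 \<le> 1/2" for s1 s2 :: real using that by auto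
      have "(1/2 :: real) ^ (k + 2) \<le> (1/2) ^ (k + 1)" by (rule power_decreasing) auto
      from split[OF this half_le[of k]] show ?thesis
        unfolding Q_def A_def by (simp only: add_Suc add_Suc_right numeral_2_eq_2 One_nat_def add_0_right)
    qed
    moreover have "Q k \<inter> A k = {}" by (auto simp: Q_def A_def)
    ultimately have "(LINT p:Q (Suc k)|lborel. ?f p) = (LINT p:Q k|lborel. ?f p) + (LINT p:A k|lborel. ?f p)"
      using set_integral_Un[OF _ sQ sA] by simp
    with Suc.IH An[of k] show ?case by (simp add: algebra_simps add_divide_distrib)
  qed
  have "real N * (\<omega> / 2) \<le> (LINT p:Q N|lborel. ?f p)" by (rule main)
  also have "\<dots> \<le> (LINT p:cball 0 (1/2) - ball 0 c|lborel. ?f p)"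
    unfolding set_lebesgue_integral_def
  proof (rule integral_mono)
    show "integrable lborel (\<lambda>p. indicat_real (Q N) p *\<^sub>R ?f p)" using sQ by (simp add: set_integrable_def)
    show "integrable lborel (\<lambda>p. indicat_real (cball 0 (1/2) - ball 0 c) p *\<^sub>R ?f p)"
      using si[of "cball 0 (1/2) - ball 0 c" c] assms(1) by (simp add: set_integrable_def)
    fix p
    have "Q N \<subseteq> cball 0 (1/2) - ball 0 c" using assms(2) by (auto simp: Q_def)
    then show "indicat_real (Q N) p *\<^sub>R ?f p \<le> indicat_real (cball 0 (1/2) - ball 0 c) p *\<^sub>R ?f p"
      by (auto simp: indicator_def)
  qed
  finally show ?thesis by (simp add: \<omega>_def n_def)
qed

section \<open>The Aleksandrov-Bakelman-Pucci estimate\<close>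

lemma sum_power_le:
  fixes x :: "'a \<Rightarrow> real"
  assumes "finite I" "I \<noteq> {}" "\<And>i. i \<in> I \<Longrightarrow> 0 \<le> x i"
  shows "(\<Sum>i\<in>I. x i) ^ p \<le> real (card I) ^ p * (\<Sum>i\<in>I. x i ^ p)"
proof -
  have "Max (x ` I) \<in> x ` I" using assms by (intro Max_in) auto
  then obtain j where j: "j \<in> I" "Max (x ` I) = x j" by auto
  have "x i \<le> x j" if "i \<in> I" for i
    using that assms(1) j(2) by (metis Max_ge finite_imageI imageI)
  then have "(\<Sum>i\<in>I. x i) \<le> real (card I) * x j"
    by (rule sum_bounded_above)
  then have "(\<Sum>i\<in>I. x i) ^ p \<le> (real (card I) * x j) ^ p"
    using assms(3) by (intro power_mono sum_nonneg)
  also have "\<dots> = real (card I) ^ p * x j ^ p" by (simp add: power_mult_distrib)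
  also have "x j ^ p \<le> (\<Sum>i\<in>I. x i ^ p)"
    using assms j(1) by (intro member_le_sum) auto
  finally show ?thesis by (simp add: mult_left_mono)
qed

text \<open>\<open>A\<close> and \<open>G\<close> are the Hessian and gradient of a mollification,
  \<open>w\<close> and \<open>D\<close> those of the solution. Exchanging \<open>A\<close> for
  \<open>w\<close> costs \<open>Lam * W\<close>. If \<open>G\<close> and \<open>D\<close> differ by
  less than the gap \<gamma>' - \<gamma>, then \<open>norm D > \<gamma>\<close> and the equation
  bounds the second-order term by the drift; otherwise that term is bounded crudely by
  \<open>Lam * H\<close>.\<close>

lemma supersolution_trace_bound:
  fixes a A w :: "real^'n^'n" and b G D :: "real^'n"
  assumes lam: "0 < lam" "lam \<le> Lam" and ell: "loewner_le (mat lam) a" "loewner_le a (mat Lam)" "transpose a = a"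
    and A: "psd A" "transpose A = A" and \<gamma>: "0 \<le> \<gamma>" "\<gamma> < \<gamma>'" and G: "\<gamma>' \<le> norm G"
    and pde: "norm D > \<gamma> \<Longrightarrow> (\<Sum>i\<in>UNIV. \<Sum>j\<in>UNIV. a $ i $ j * w $ i $ j) + (\<Sum>i\<in>UNIV. b $ i * D $ i) \<le> 0"
    and q: "norm (G - D) \<le> q"
  defines "W \<equiv> \<Sum>i\<in>UNIV. \<Sum>j\<in>UNIV. \<bar>A $ i $ j - w $ i $ j\<bar>"
    and "H \<equiv> \<Sum>i\<in>UNIV. \<Sum>j\<in>UNIV. \<bar>w $ i $ j\<bar>"
  shows "trace A ^ n * (1 / norm G) ^ n
    \<le> (1 / lam) ^ n * (4 ^ n * norm b ^ n + (2 * Lam / \<gamma>') ^ n * (W ^ n + (if q \<ge> \<gamma>' - \<gamma> then H ^ n else 0)))"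
proof -
  define N where "N = norm G"
  have N: "N > 0" "\<gamma>' \<le> N" "\<gamma>' > 0" using G \<gamma> by (auto simp: N_def)
  have WH: "W \<ge> 0" "H \<ge> 0" unfolding W_def H_def by (auto intro!: sum_nonneg)
  have Lam: "Lam > 0" using lam by simp
  define T where "T = (\<Sum>i\<in>UNIV. \<Sum>j\<in>UNIV. a $ i $ j * A $ i $ j)"
  have trT: "lam * trace A \<le> T" unfolding T_def by (rule elliptic_trace_ge[OF ell(1) A])
  have tr0: "0 \<le> trace A" unfolding trace_def by (intro sum_nonneg psd_diag_nonneg A)
  have a_le: "\<bar>a $ i $ j\<bar> \<le> Lam" for i j
    by (rule elliptic_entry_le[OF _ ell]) (use lam in simp)
  have entry: "(\<Sum>i\<in>UNIV. \<Sum>j\<in>UNIV. a $ i $ j * B $ i $ j) \<le> Lam * (\<Sum>i\<in>UNIV. \<Sum>j\<in>UNIV. \<bar>B $ i $ j\<bar>)" for B :: "real^'n^'n"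
    unfolding sum_distrib_left
  proof (intro sum_mono)
    fix i j
    have "a $ i $ j * B $ i $ j \<le> \<bar>a $ i $ j\<bar> * \<bar>B $ i $ j\<bar>" by (metis abs_ge_self abs_mult)
    also have "\<dots> \<le> Lam * \<bar>B $ i $ j\<bar>" by (rule mult_right_mono[OF a_le]) simp
    finally show "a $ i $ j * B $ i $ j \<le> Lam * \<bar>B $ i $ j\<bar>" .
  qed
  have Tsplit: "T \<le> (\<Sum>i\<in>UNIV. \<Sum>j\<in>UNIV. a $ i $ j * w $ i $ j) + Lam * W"
  proof -
    have "T = (\<Sum>i\<in>UNIV. \<Sum>j\<in>UNIV. a $ i $ j * w $ i $ j) + (\<Sum>i\<in>UNIV. \<Sum>j\<in>UNIV. a $ i $ j * (A - w) $ i $ j)"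
      unfolding T_def by (simp add: sum.distrib[symmetric] algebra_simps)
    then show ?thesis using entry[of "A - w"] by (simp add: W_def)
  qed
  \<comment> \<open>The error terms have no factor \<open>N\<close> to cancel the weight, so
    dividing by \<open>N\<close> costs 1/\<gamma>'.\<close>
  have pw: "X ^ n * (1 / N) ^ n \<le> (2 * Lam / \<gamma>') ^ n * Z ^ n" if "0 \<le> X" "X \<le> 2 * Lam * Z" "0 \<le> Z" for X Z
  proof -
    have "X * (1 / N) \<le> (2 * Lam * Z) * (1 / \<gamma>')"
      using that N Lam by (intro mult_mono) (auto simp: frac_le)
    then have "(X * (1 / N)) ^ n \<le> ((2 * Lam / \<gamma>') * Z) ^ n"
      using that N by (intro power_mono) auto
    then show ?thesis by (simp only: power_mult_distrib)
  qed
  have key: "(lam * trace A) ^ n * (1 / N) ^ n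
      \<le> 4 ^ n * norm b ^ n + (2 * Lam / \<gamma>') ^ n * (W ^ n + (if q \<ge> \<gamma>' - \<gamma> then H ^ n else 0))"
  proof (cases "q \<ge> \<gamma>' - \<gamma>")
    case True
    have "lam * trace A \<le> Lam * (H + W)"
      using trT Tsplit entry[of w] by (simp add: H_def distrib_left)
    also have "\<dots> \<le> 2 * Lam * max H W"
      using Lam by (simp add: max_def algebra_simps)
    finally have "(lam * trace A) ^ n * (1 / N) ^ n \<le> (2 * Lam / \<gamma>') ^ n * max H W ^ n"
      using pw[of "lam * trace A" "max H W"] lam tr0 WH by simp
    also have "max H W ^ n \<le> W ^ n + H ^ n" using WH by (auto simp: max_def)
    finally have "(lam * trace A) ^ n * (1 / N) ^ n \<le> (2 * Lam / \<gamma>') ^ n * (W ^ n + H ^ n)"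
      using Lam N by (simp add: mult_left_mono)
    moreover have "0 \<le> 4 ^ n * norm b ^ n" by simp
    ultimately show ?thesis using True by (simp add: add_increasing)
  next
    case False
    have GD: "norm (G - D) < \<gamma>' - \<gamma>" using False q by simp
    \<comment> \<open>The gradients differ by less than \<gamma>' - \<gamma>, which is at most
      \<gamma>' and hence at most \<open>N\<close>.\<close>
    have "norm D > \<gamma>" "norm D \<le> 2 * N"
      using GD norm_triangle_ineq2[of G D] norm_triangle_ineq2[of D G] N \<gamma>
      by (auto simp: norm_minus_commute N_def)
    have "lam * trace A \<le> norm b * norm D + Lam * W"
    proof -
      have "- (\<Sum>i\<in>UNIV. b $ i * D $ i) \<le> norm b * norm D"
        using Cauchy_Schwarz_ineq2[of b D] by (simp add: inner_vec_def)
      then show ?thesis using trT Tsplit pde[OF \<open>norm D > \<gamma>\<close>] by linarith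
    qed
    also have "\<dots> \<le> 2 * norm b * N + Lam * W"
      using mult_left_mono[OF \<open>norm D \<le> 2 * N\<close>, of "norm b"] by simp
    \<comment> \<open>Keeping only the larger summand lets n-th powers be taken term by term; this 2
      and the one from \<open>norm D \<le> 2 * N\<close> make up the factor 4.\<close>
    also have "\<dots> \<le> 2 * max (2 * norm b * N) (Lam * W)" by simp
    finally have le: "lam * trace A \<le> 2 * max (2 * norm b * N) (Lam * W)" .
    show ?thesis
    proof (cases "2 * norm b * N \<ge> Lam * W")
      case True
      then have "lam * trace A \<le> 4 * norm b * N" using le by simp
      then have "(lam * trace A) * (1 / N) \<le> 4 * norm b" using N by (simp add: divide_le_eq)
      then have "((lam * trace A) * (1 / N)) ^ n \<le> (4 * norm b) ^ n"
        using lam tr0 N by (intro power_mono) auto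
      then have "(lam * trace A) ^ n * (1 / N) ^ n \<le> 4 ^ n * norm b ^ n"
        by (simp only: power_mult_distrib)
      moreover have "0 \<le> (2 * Lam / \<gamma>') ^ n * (W ^ n + (if q \<ge> \<gamma>' - \<gamma> then H ^ n else 0))"
        using Lam N WH by simp
      ultimately show ?thesis by linarith
    next
      case F: False
      then have "lam * trace A \<le> 2 * Lam * W" using le by simp
      then have "(lam * trace A) ^ n * (1 / N) ^ n \<le> (2 * Lam / \<gamma>') ^ n * W ^ n"
        using pw[of "lam * trace A" W] lam tr0 WH by simp
      moreover have "0 \<le> 4 ^ n * norm b ^ n" by simp
      ultimately show ?thesis using False by (simp add: add_increasing)
    qed
  qed
  have "trace A ^ n * (1 / norm G) ^ n = (1 / lam) ^ n * ((lam * trace A) ^ n * (1 / N) ^ n)"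
    using lam by (simp add: N_def power_mult_distrib power_divide)
  also have "\<dots> \<le> (1 / lam) ^ n * (4 ^ n * norm b ^ n + (2 * Lam / \<gamma>') ^ n * (W ^ n + (if q \<ge> \<gamma>' - \<gamma> then H ^ n else 0)))"
    using lam by (intro mult_left_mono[OF key]) simp
  finally show ?thesis .
qed

section \<open>Symmetry of mollified Hessians, and representatives of Sobolev data\<close>

lemma mollifier_pderiv2_commute:
  "pderiv_at i (pderiv_at j (mollifier d :: real^'n \<Rightarrow> real)) = pderiv_at j (pderiv_at i (mollifier d))"
proof -
  define c where "c = 1 / (LINT z|lborel. bump d (z :: real^'n))"
  have scale: "pderiv_at i (\<lambda>x. c * f x) = (\<lambda>x. c * pderiv_at i f x)" if f: "f \<in> bump_class 0 (d\<^sup>2)" for i and f :: "real^'n \<Rightarrow> real"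
  proof
    fix x
    have "(f has_derivative frechet_derivative f (at x)) (at x)"
      using bump_class_pderiv[OF f] by (simp add: frechet_derivative_works)
    from pderiv_at_eqI[OF has_derivative_mult_right[OF this, of c]]
    show "pderiv_at i (\<lambda>x. c * f x) x = c * pderiv_at i f x" by (simp add: pderiv_at_def)
  qed
  have m: "(mollifier d :: real^'n \<Rightarrow> real) = (\<lambda>x. c * bump d x)" by (simp add: mollifier_def[abs_def] c_def)
  have "pderiv_at i (pderiv_at j (mollifier d :: real^'n \<Rightarrow> real)) = (\<lambda>x. c * pderiv_at i (pderiv_at j (bump d)) x)" for i j
    unfolding m scale[OF bump_in_class] scale[OF conjunct2[OF bump_class_pderiv[OF bump_in_class]]] ..
  then show ?thesis by (simp add: bump_pderiv2_commute[of i j])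
qed

text \<open>Membership in \<open>sobolev\<close> gives L^n integrability of some weak derivative;
  uniqueness transfers it to the version \<open>w\<close> at hand.\<close>

lemma sobolev_representative:
  fixes u :: "real^'n \<Rightarrow> real"
  assumes u: "u \<in> sobolev k (real n) (ball 0 1)" "length js \<le> k"
    and w: "has_weak_deriv (ball 0 1) js u w" and "n \<ge> 1" "R < 1"
  obtains g where "integrable lborel g" "integrable lborel (\<lambda>x. \<bar>g x\<bar> ^ n)"
    "AE x in lebesgue. x \<in> ball 0 R \<longrightarrow> g x = w x"
proof -
  obtain v where v: "has_weak_deriv (ball 0 1) js u v" "v \<in> Lp_space (real n) (ball 0 1)"
    using u by (auto simp: sobolev_def)
  obtain g where g: "integrable lborel g" "AE x in lebesgue. g x = indicator (cball 0 R) x * v x"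
    using borel_representative[of v R] v(1) \<open>R < 1\<close> by (auto simp: has_weak_deriv_def)
  have "AE x in lebesgue. x \<in> ball 0 R \<longrightarrow> g x = w x"
    using g(2) weak_deriv_unique[OF v(1) w \<open>R < 1\<close>]
    by eventually_elim (auto simp: indicator_def)
  with that g(1) Lp_representative[OF v(2) \<open>n \<ge> 1\<close> \<open>R < 1\<close> g] show ?thesis by blast
qed

text \<open>The estimates involve the drift only through its length, so one scalar Borel function
  with the right n-th moment can stand for it.\<close>

lemma Lp_norm_representative:
  fixes b :: "real^'n \<Rightarrow> real^'n"
  assumes b: "b \<in> Lp_space (real n) (ball 0 1)" and "n \<ge> 1"
  obtains \<beta> where "\<beta> \<in> borel_measurable borel" "AE x in lebesgue. \<beta> x = indicator (ball 0 1) x * norm (b x)"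
    "integrable lborel (\<lambda>x. \<beta> x ^ n)" "(LINT x|lborel. \<beta> x ^ n) = Lp_norm (real n) (ball 0 1) b ^ n"
proof -
  have bm: "b \<in> borel_measurable (lebesgue_on (ball 0 1))"
    and bi: "integrable (lebesgue_on (ball 0 1)) (\<lambda>x. norm (b x) powr real n)"
    using b by (auto simp: Lp_space_def)
  have "(\<lambda>x. norm (b x)) \<in> borel_measurable (lebesgue_on (ball 0 1))"
    using bm by measurable
  then have m: "(\<lambda>x. indicator (ball 0 1) x *\<^sub>R norm (b x)) \<in> borel_measurable lebesgue"
    by (subst (asm) borel_measurable_restrict_space_iff) auto
  obtain \<beta> where \<beta>: "\<beta> \<in> borel_measurable lborel" "AE x in lborel. indicator (ball 0 1) x *\<^sub>R norm (b x) = \<beta> x"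
    using completion_ex_borel_measurable_real[OF m] by blast
  have \<beta>m [measurable]: "\<beta> \<in> borel_measurable borel" using \<beta>(1) by simp
  have AE: "AE x in lebesgue. \<beta> x = indicator (ball 0 1) x * norm (b x)"
    using AE_completion[OF \<beta>(2)] by (simp add: eq_commute)
  have AEn: "AE x in lebesgue. indicator (ball 0 1) x *\<^sub>R (norm (b x) powr real n) = \<beta> x ^ n"
    using AE
  proof eventually_elim
    case (elim x)
    then show ?case using \<open>n \<ge> 1\<close>
      by (cases "b x = 0"; cases "x \<in> ball 0 1") (auto simp: powr_realpow power_0_left)
  qed
  have i: "integrable lebesgue (\<lambda>x. indicator (ball 0 1) x *\<^sub>R (norm (b x) powr real n))"
    using bi by (subst (asm) integrable_restrict_space) auto
  have \<beta>nm: "(\<lambda>x. \<beta> x ^ n) \<in> borel_measurable lborel" by measurable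
  have \<beta>nm': "(\<lambda>x. \<beta> x ^ n) \<in> borel_measurable lebesgue" by (rule measurable_completion[OF \<beta>nm])
  have "integrable lebesgue (\<lambda>x. \<beta> x ^ n)"
    by (rule integrable_cong_AE_imp[OF i \<beta>nm' AEn])
  then have I: "integrable lborel (\<lambda>x. \<beta> x ^ n)"
    using \<beta>nm by (simp add: integrable_completion)
  have "(LINT x|lborel. \<beta> x ^ n) = (LINT x|lebesgue. \<beta> x ^ n)"
    by (rule integral_completion[OF \<beta>nm, symmetric])
  also have "\<dots> = (LINT x|lebesgue. indicator (ball 0 1) x *\<^sub>R (norm (b x) powr real n))"
    by (rule integral_cong_AE) (use AEn \<beta>nm' i in auto)
  also have "\<dots> = (LINT x|lebesgue_on (ball 0 1). norm (b x) powr real n)"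
    by (rule integral_restrict_space[symmetric]) auto
  also have "\<dots> = Lp_norm (real n) (ball 0 1) b ^ n"
  proof -
    define J where "J = (LINT x|lebesgue_on (ball 0 1). norm (b x) powr real n)"
    have "J \<ge> 0" by (simp add: J_def)
    then have "(J powr (1 / real n)) ^ n = J"
      using \<open>n \<ge> 1\<close> by (cases "J = 0") (auto simp: powr_realpow[symmetric] powr_powr power_0_left)
    then show ?thesis by (simp add: Lp_norm_def J_def)
  qed
  finally show ?thesis using that \<beta>m AE I by blast
qed

text \<open>A point of the sphere of radius \<open>r\<close> is compared with its radial projection
  to the unit sphere, at distance 1 - r below the modulus of continuity \<delta>. The strict
  inequality \<open>r < 1\<close> leaves room for mollifying.\<close>

lemma uniform_boundary_layer:
  fixes u :: "real^'n \<Rightarrow> real"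
  assumes u: "continuous_on (cball 0 1) u" "\<forall>x\<in>sphere 0 1. u x \<ge> 0" and "\<kappa> > 0" "norm x0 < 1"
  obtains r \<delta> where "norm x0 < r" "0 < r" "r < 1" "\<delta> > 0" "\<And>x. x \<in> sphere 0 r \<Longrightarrow> u x \<ge> - \<kappa>"
    "\<And>x y. x \<in> cball 0 1 \<Longrightarrow> y \<in> cball 0 1 \<Longrightarrow> dist x y < \<delta> \<Longrightarrow> \<bar>u x - u y\<bar> \<le> \<kappa>"
proof -
  have "uniformly_continuous_on (cball 0 1) u"
    by (rule compact_uniformly_continuous[OF u(1)]) simp
  then obtain \<delta> where \<delta>: "\<delta> > 0"
    "\<And>x y. x \<in> cball 0 1 \<Longrightarrow> y \<in> cball 0 1 \<Longrightarrow> dist y x < \<delta> \<Longrightarrow> dist (u y) (u x) < \<kappa>"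
    using \<open>\<kappa> > 0\<close> unfolding uniformly_continuous_on_def by metis
  define r where "r = max ((norm x0 + 1) / 2) (1 - \<delta> / 2)"
  have r: "norm x0 < r" "0 < r" "r < 1" "1 - r < \<delta>"
  proof -
    have "(norm x0 + 1) / 2 \<le> r" "1 - \<delta> / 2 \<le> r" by (simp_all add: r_def)
    then have "norm x0 + 1 \<le> 2 * r" "2 - \<delta> \<le> 2 * r" by simp_all
    then show "norm x0 < r" "1 - r < \<delta>"
      using \<open>norm x0 < 1\<close> \<delta>(1) by simp_all
    then show "0 < r" using le_less_trans[OF norm_ge_zero] by blast
    show "r < 1" using \<open>norm x0 < 1\<close> \<delta>(1) by (simp add: r_def)
  qed
  have "u x \<ge> - \<kappa>" if "x \<in> sphere 0 r" for x
  proof -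
    have nx: "norm x = r" using that by simp
    define z where "z = (1 / r) *\<^sub>R x"
    have nz: "norm z = 1" using nx r by (simp add: z_def)
    have "x = r *\<^sub>R z" using r by (simp add: z_def)
    then have "dist x z = norm ((r - 1) *\<^sub>R z)" by (simp add: dist_norm algebra_simps)
    then have "dist x z < \<delta>" using nz r by simp
    then have "dist (u x) (u z) < \<kappa>" using \<delta>(2)[of z x] nz nx r by simp
    moreover have "u z \<ge> 0" using u(2) nz by simp
    ultimately show ?thesis by (simp add: dist_real_def)
  qed
  moreover have "\<bar>u x - u y\<bar> \<le> \<kappa>" if "x \<in> cball 0 1" "y \<in> cball 0 1" "dist x y < \<delta>" for x y
    using \<delta>(2)[OF that(2,1,3)] by (simp add: dist_real_def)
  ultimately show ?thesis using that r \<delta>(1) by blast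
qed

text \<open>For a slope in the annulus, tilting changes the difference between \<open>x0\<close> and
  the sphere by less than 1, so a tilted minimum is interior and \<open>G\<close> maps
  \<open>A\<close> onto the annulus. \<open>A\<close> records only the closed conditions that such
  minima satisfy, which makes it compact.\<close>

lemma abp_smooth:
  fixes v :: "real^'n \<Rightarrow> real" and G :: "real^'n \<Rightarrow> real^'n" and M :: "real^'n \<Rightarrow> real^'n^'n"
  assumes dv: "\<And>x. (v has_derivative (\<lambda>t. t \<bullet> G x)) (at x)"
    and dG: "\<And>x. (G has_derivative (\<lambda>t. M x *v t)) (at x)"
    and contM: "continuous_on UNIV M" and sym: "\<And>x. x \<in> cball 0 r \<Longrightarrow> transpose (M x) = M x"
    and x0: "x0 \<in> cball 0 r" "r < 1" and bd: "\<And>x. x \<in> sphere 0 r \<Longrightarrow> v x0 + 1 \<le> v x"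
    and "c > 0"
  defines "A \<equiv> {y \<in> cball 0 r. psd (M y) \<and> c \<le> norm (G y) \<and> norm (G y) \<le> 1/2}"
  shows "(LINT p:cball 0 (1/2) - ball 0 c|lborel. (1 / norm (p :: real^'n)) ^ CARD('n))
      \<le> fact CARD('n) * (LINT x:A|lborel. trace (M x) ^ CARD('n) * (1 / norm (G x)) ^ CARD('n))"
    and "compact A" and "set_integrable lborel A (\<lambda>x. trace (M x) ^ CARD('n) * (1 / norm (G x)) ^ CARD('n))"
proof -
  have contG: "continuous_on UNIV G"
    using dG by (meson has_derivative_continuous_on has_derivative_at_withinI)
  have clpsd: "closed {y. psd (M y)}"
  proof -
    have "{y. psd (M y)} = (\<Inter>\<xi>. {y. 0 \<le> \<xi> \<bullet> (M y *v \<xi>)})" by (auto simp: psd_def)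
    moreover have "closed {y. 0 \<le> \<xi> \<bullet> (M y *v \<xi>)}" for \<xi>
      unfolding matrix_inner_expand
      by (intro closed_Collect_le continuous_intros continuous_on_component contM)
    ultimately show ?thesis by auto
  qed
  have "closed {y. psd (M y) \<and> c \<le> norm (G y) \<and> norm (G y) \<le> 1/2}"
    by (intro closed_Collect_conj closed_Collect_le continuous_intros contG clpsd)
  then have "compact (cball 0 r \<inter> {y. psd (M y) \<and> c \<le> norm (G y) \<and> norm (G y) \<le> 1/2})"
    by (intro compact_Int_closed) auto
  moreover have "A = cball 0 r \<inter> {y. psd (M y) \<and> c \<le> norm (G y) \<and> norm (G y) \<le> 1/2}"
    by (auto simp: A_def)
  ultimately show cA: "compact A" by simp
  have img: "G ` A = cball 0 (1/2) - ball 0 c"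
  proof
    show "G ` A \<subseteq> cball 0 (1/2) - ball 0 c" by (auto simp: A_def)
    show "cball 0 (1/2) - ball 0 c \<subseteq> G ` A"
    proof
      fix p :: "real^'n" assume p: "p \<in> cball 0 (1/2) - ball 0 c"
      have tilt: "v x0 - p \<bullet> x0 < v x - p \<bullet> x" if "x \<in> sphere 0 r" for x
      proof -
        have "norm p \<le> 1/2" using p by simp
        have "norm (x - x0) \<le> norm x + norm x0" by (rule norm_triangle_ineq4)
        also have "\<dots> < 2" using that x0 by auto
        finally have "norm (x - x0) < 2" .
        have "p \<bullet> (x - x0) \<le> norm p * norm (x - x0)" by (rule norm_cauchy_schwarz)
        also have "\<dots> \<le> 1/2 * norm (x - x0)"
          using \<open>norm p \<le> 1/2\<close> by (rule mult_right_mono) simp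
        finally have "p \<bullet> (x - x0) < 1" using \<open>norm (x - x0) < 2\<close> by simp
        then show ?thesis using bd[OF that] by (simp add: inner_diff_right)
      qed
      obtain y where "y \<in> ball 0 r" "G y = p" "psd (M y)"
        by (rule interior_minimum_tilted[OF dv dG x0(1) tilt])
      then show "p \<in> G ` A" using p by (auto simp: A_def intro!: image_eqI[of _ _ y])
    qed
  qed
  have contf: "continuous_on (G ` A) (\<lambda>p. (1 / norm p) ^ CARD('n))"
    unfolding img using \<open>c > 0\<close> by (intro continuous_intros) auto
  show "(LINT p:cball 0 (1/2) - ball 0 c|lborel. (1 / norm (p :: real^'n)) ^ CARD('n))
      \<le> fact CARD('n) * (LINT x:A|lborel. trace (M x) ^ CARD('n) * (1 / norm (G x)) ^ CARD('n))"
    unfolding img[symmetric]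
    by (rule area_inequality[OF cA dG]) (use contM sym contf in \<open>auto simp: A_def intro: continuous_on_subset\<close>)
  have "continuous_on A (\<lambda>x. trace (M x) ^ CARD('n) * (1 / norm (G x)) ^ CARD('n))"
    unfolding trace_def using \<open>c > 0\<close> continuous_on_subset[OF contM subset_UNIV] continuous_on_subset[OF contG subset_UNIV]
    by (intro continuous_intros continuous_on_component) (auto simp: A_def)
  then show "set_integrable lborel A (\<lambda>x. trace (M x) ^ CARD('n) * (1 / norm (G x)) ^ CARD('n))"
    unfolding set_integrable_def by (rule borel_integrable_compact[OF cA])
qed

section \<open>Passage to the limit for supersolutions in W^{2,n}\<close>

lemma has_derivative_vec_lambda:
  fixes f :: "'a::real_normed_vector \<Rightarrow> 'n::finite \<Rightarrow> real"
  assumes "\<And>i. ((\<lambda>x. f x i) has_derivative (\<lambda>t. f' t i)) (at x)"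
  shows "((\<lambda>x. \<chi> i. f x i) has_derivative (\<lambda>t. \<chi> i. f' t i)) (at x)"
  unfolding has_derivative_componentwise_within[of "\<lambda>x. \<chi> i. f x i"]
  using assms by (auto simp: Basis_vec_def inner_axis)

text \<open>With \<gamma>' fixed, \<open>abp_smooth\<close> applies to every mollification, and its
  integrand is dominated by \<open>\<Psi> k\<close>. As the radius shrinks, the integral of
  \<open>\<Psi> k\<close> tends along a subsequence to the drift term alone.\<close>

lemma measure_estimate:
  fixes lam Lam \<gamma> \<gamma>' :: real and a :: "real^'n \<Rightarrow> real^'n^'n" and b :: "real^'n \<Rightarrow> real^'n"
    and u :: "real^'n \<Rightarrow> real" and Du :: "real^'n \<Rightarrow> real^'n" and D2u :: "real^'n \<Rightarrow> real^'n^'n"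
  assumes lam: "0 < lam" "lam \<le> Lam"
    and ell: "AE x in lebesgue_on (ball 0 1). transpose (a x) = a x
          \<and> loewner_le (mat lam) (a x) \<and> loewner_le (a x) (mat Lam)"
    and b: "b \<in> Lp_space (real CARD('n)) (ball 0 1)"
    and \<gamma>: "0 \<le> \<gamma>" "\<gamma> < \<gamma>'"
    and u: "u \<in> sobolev 2 (real CARD('n)) (ball 0 1)" "continuous_on (cball 0 1) u"
    and Du: "is_weak_gradient (ball 0 1) u Du" and D2u: "is_weak_hessian (ball 0 1) u D2u"
    and super: "large_gradient_supersolution (ball 0 1) \<gamma> a b Du D2u"
    and bdry: "\<forall>x\<in>sphere 0 1. u x \<ge> 0"
    and x0: "x0 \<in> ball 0 1" "u x0 < - 1"
  shows "(LINT p:cball 0 (1/2) - ball 0 \<gamma>'|lborel. (1 / norm (p :: real^'n)) ^ CARD('n))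
      \<le> fact CARD('n) * ((1 / lam) ^ CARD('n) * (4 ^ CARD('n) * Lp_norm (real CARD('n)) (ball 0 1) b ^ CARD('n)))"
proof -
  define n where "n = CARD('n)"
  have n1: "n \<ge> 1" by (simp add: n_def Suc_leI)
  \<comment> \<open>Three losses of \<kappa> must fit into the excess 4 \<kappa>: the mollification
    error at \<open>x0\<close>, the one on the sphere, and the retreat from the unit sphere.\<close>
  define \<kappa> where "\<kappa> = (- u x0 - 1) / 4"
  have \<kappa>: "\<kappa> > 0" "u x0 = - 1 - 4 * \<kappa>" using x0(2) by (simp_all add: \<kappa>_def field_simps)
  have nx0: "norm x0 < 1" using x0(1) by simp
  obtain r \<delta> where r: "norm x0 < r" "0 < r" "r < 1" and \<delta>: "\<delta> > 0"
    and ubd: "\<And>x. x \<in> sphere 0 r \<Longrightarrow> u x \<ge> - \<kappa>"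
    and ucl: "\<And>x y. x \<in> cball 0 1 \<Longrightarrow> y \<in> cball 0 1 \<Longrightarrow> dist x y < \<delta> \<Longrightarrow> \<bar>u x - u y\<bar> \<le> \<kappa>"
    using uniform_boundary_layer[OF u(2) bdry \<kappa>(1) nx0] by blast
  define R where "R = (r + 1) / 2"
  have R: "r < R" "R < 1" using r by (auto simp: R_def)
  \<comment> \<open>Radii below \<delta> keep the mollification within \<kappa> of \<open>u\<close>;
    radii below \<open>R - r\<close> keep the kernels inside \<open>ball 0 R\<close>, where the
    representatives are valid.\<close>
  define m where "m = min \<delta> (R - r)"
  have m: "m > 0" "m \<le> \<delta>" "m \<le> R - r" using \<delta> R by (auto simp: m_def)
  define d where "d k = m / real (k + 2)" for k
  have d0: "d k > 0" for k using m(1) by (simp add: d_def)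
  have dm: "d k < m" for k using m(1) by (simp add: d_def divide_less_eq)
  have d\<delta>: "d k < \<delta>" and dR: "d k < R - r" for k
    using less_le_trans[OF dm m(2)] less_le_trans[OF dm m(3)] by blast+
  have dlim: "d \<longlonglongrightarrow> 0"
    unfolding d_def using LIMSEQ_ignore_initial_segment[OF lim_const_over_n, of m 2] by simp
  have yR: "norm y + d k < R" if "y \<in> cball 0 r" for y :: "real^'n" and k
    using that dR[of k] by simp

  \<comment> \<open>By continuity of \<open>u\<close> the cut-off is Borel as it stands, so no
    change on a null set intervenes and pointwise comparison with \<open>u\<close> remains
    possible.\<close>
  define h where "h x = indicator (cball 0 R) x * u x" for x
  have hi: "integrable lborel h"
    unfolding h_def
    using borel_integrable_compact[OF compact_cball continuous_on_subset[OF u(2) subset_cball], of R] R by simp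
  note hm = borel_measurable_integrable_borel[OF hi]
  have hu: "AE x in lebesgue. x \<in> ball 0 R \<longrightarrow> h x = u x" by (simp add: h_def)

  have g_ex: "\<exists>f. integrable lborel f \<and> (AE x in lebesgue. x \<in> ball 0 R \<longrightarrow> f x = Du x $ i)" for i
  proof -
    have "has_weak_deriv (ball 0 1) [i] u (\<lambda>x. Du x $ i)" using Du by (simp add: is_weak_gradient_def)
    from sobolev_representative[OF u(1) _ this n1[unfolded n_def] R(2)]
    show ?thesis by auto
  qed
  define g where "g i = (SOME f. integrable lborel f \<and> (AE x in lebesgue. x \<in> ball 0 R \<longrightarrow> f x = Du x $ i))" for i
  have g: "integrable lborel (g i)" "AE x in lebesgue. x \<in> ball 0 R \<longrightarrow> g i x = Du x $ i" for i
    using someI_ex[OF g_ex[of i], folded g_def] by blast+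
  have w_ex: "\<exists>f. integrable lborel f \<and> integrable lborel (\<lambda>x. \<bar>f x\<bar> ^ n) \<and>
      (AE x in lebesgue. x \<in> ball 0 R \<longrightarrow> f x = D2u x $ i $ j)" for i j
  proof -
    have "has_weak_deriv (ball 0 1) [i, j] u (\<lambda>x. D2u x $ i $ j)" using D2u by (simp add: is_weak_hessian_def)
    from sobolev_representative[OF u(1) _ this n1[unfolded n_def] R(2)]
    show ?thesis by (auto simp: n_def)
  qed
  define w where "w i j = (SOME f. integrable lborel f \<and> integrable lborel (\<lambda>x. \<bar>f x\<bar> ^ n) \<and>
      (AE x in lebesgue. x \<in> ball 0 R \<longrightarrow> f x = D2u x $ i $ j))" for i j
  have w: "integrable lborel (w i j)" "integrable lborel (\<lambda>x. \<bar>w i j x\<bar> ^ n)"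
    "AE x in lebesgue. x \<in> ball 0 R \<longrightarrow> w i j x = D2u x $ i $ j" for i j
    using someI_ex[OF w_ex[of i j], folded w_def] by blast+
  obtain \<beta> where \<beta>: "\<beta> \<in> borel_measurable borel" "AE x in lebesgue. \<beta> x = indicator (ball 0 1) x * norm (b x)"
    "integrable lborel (\<lambda>x. \<beta> x ^ n)" "(LINT x|lborel. \<beta> x ^ n) = Lp_norm (real n) (ball 0 1) b ^ n"
    by (rule Lp_norm_representative[OF b[folded n_def] n1])

  define \<rho> where "\<rho> k = (mollifier (d k) :: real^'n \<Rightarrow> real)" for k
  \<comment> \<open>Each derivative in the centre \<open>y\<close> changes the sign of the kernel
    derivative: one minus for the gradient, two cancelling ones for the Hessian.\<close>
  define G where "G k y = (\<chi> i. - conv h (pderiv_at i (\<rho> k)) y)" for k y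
  define M where "M k y = (\<chi> i j. conv h (pderiv_at j (pderiv_at i (\<rho> k))) y)" for k y
  have \<rho>cl: "\<rho> k \<in> bump_class 0 ((d k)\<^sup>2)" for k unfolding \<rho>_def by (rule mollifier_in_class)
  have \<rho>cl1: "pderiv_at i (\<rho> k) \<in> bump_class 0 ((d k)\<^sup>2)" for i k using bump_class_pderiv[OF \<rho>cl] by blast
  have \<rho>cl2: "pderiv_at j (pderiv_at i (\<rho> k)) \<in> bump_class 0 ((d k)\<^sup>2)" for i j k using bump_class_pderiv[OF \<rho>cl1] by blast
  have dv: "(conv h (\<rho> k) has_derivative (\<lambda>t. t \<bullet> G k x)) (at x)" for k x
    using conv_bump_has_derivative[OF hi \<rho>cl d0, of k x] by (simp add: G_def inner_vec_def)
  have dG: "(G k has_derivative (\<lambda>t. M k x *v t)) (at x)" for k x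
  proof -
    have "((\<lambda>y. - conv h (pderiv_at i (\<rho> k)) y) has_derivative (\<lambda>t. - (\<Sum>j\<in>UNIV. t $ j * - conv h (pderiv_at j (pderiv_at i (\<rho> k))) x))) (at x)" for i
      by (rule has_derivative_minus[OF conv_bump_has_derivative[OF hi \<rho>cl1 d0]])
    then have "((\<lambda>y. \<chi> i. - conv h (pderiv_at i (\<rho> k)) y) has_derivative
      (\<lambda>t. \<chi> i. - (\<Sum>j\<in>UNIV. t $ j * - conv h (pderiv_at j (pderiv_at i (\<rho> k))) x))) (at x)"
      by (rule has_derivative_vec_lambda)
    moreover have "(\<lambda>t. \<chi> i. - (\<Sum>j\<in>UNIV. t $ j * - conv h (pderiv_at j (pderiv_at i (\<rho> k))) x)) = (\<lambda>t. M k x *v t)"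
      by (simp add: M_def matrix_vector_mult_def fun_eq_iff vec_eq_iff sum_negf mult.commute)
    ultimately show ?thesis by (simp add: G_def[abs_def])
  qed
  have contM: "continuous_on UNIV (M k)" for k
  proof -
    have "continuous_on UNIV (conv h (pderiv_at j (pderiv_at i (\<rho> k))))" for i j
      by (intro continuous_at_imp_continuous_on ballI
          has_derivative_continuous[OF conv_bump_has_derivative[OF hi \<rho>cl2 d0]])
    then show ?thesis unfolding M_def by (intro continuous_on_vec_lambda)
  qed
  have Mw: "M k y $ i $ j = conv (w i j) (\<rho> k) y" if y: "y \<in> cball 0 r" for k y i j
  proof -
    have wd: "has_weak_deriv (ball 0 1) [i, j] u (\<lambda>x. D2u x $ i $ j)" using D2u by (simp add: is_weak_hessian_def)
    \<comment> \<open>Differentiating the i-th gradient component in direction j yields the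
      derivatives in the opposite order from \<open>iter_pderiv [i, j]\<close>.\<close>
    have "M k y $ i $ j = conv h (pderiv_at i (pderiv_at j (\<rho> k))) y"
      unfolding M_def \<rho>_def by (simp add: mollifier_pderiv2_commute[of i j])
    also have "\<dots> = conv h (iter_pderiv [i, j] (mollifier (d k))) y" by (simp add: \<rho>_def)
    also have "\<dots> = (- 1) ^ length [i, j] * conv (w i j) (mollifier (d k)) y"
      by (rule conv_weak_deriv[OF wd hm borel_measurable_integrable_borel[OF w(1)] hu w(3) d0 yR[OF y]]) (use R in simp)
    finally show ?thesis by (simp add: \<rho>_def)
  qed
  have Gg: "G k y $ i = conv (g i) (\<rho> k) y" if y: "y \<in> cball 0 r" for k y i
  proof -
    have wd: "has_weak_deriv (ball 0 1) [i] u (\<lambda>x. Du x $ i)" using Du by (simp add: is_weak_gradient_def)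
    have "G k y $ i = - conv h (iter_pderiv [i] (mollifier (d k))) y" by (simp add: G_def \<rho>_def)
    also have "\<dots> = - ((- 1) ^ length [i] * conv (g i) (mollifier (d k)) y)"
      by (subst conv_weak_deriv[OF wd hm borel_measurable_integrable_borel[OF g(1)] hu g(2) d0 yR[OF y]]) (use R in simp_all)
    finally show ?thesis by (simp add: \<rho>_def)
  qed
  have symM: "transpose (M k y) = M k y" for k y
    unfolding M_def \<rho>_def by (simp add: transpose_def vec_eq_iff mollifier_pderiv2_commute)
  have close: "\<bar>conv h (\<rho> k) y - u y\<bar> \<le> \<kappa>" if y: "y \<in> cball 0 r" for k y
    unfolding \<rho>_def
  proof (rule conv_mollifier_close[OF hi d0])
    fix z :: "real^'n" assume z: "norm z < d k"
    have "norm (z + y) < R" using norm_triangle_ineq[of z y] z yR[OF y, of k] by simp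
    then have "h (z + y) = u (z + y)" "z + y \<in> cball 0 1" using R by (auto simp: h_def)
    moreover have "dist (z + y) y < \<delta>" using z d\<delta>[of k] by (simp add: dist_norm)
    moreover have "y \<in> cball 0 1" using y r by simp
    ultimately show "\<bar>h (z + y) - u y\<bar> \<le> \<kappa>" using ucl by simp
  qed
  have x0r: "x0 \<in> cball 0 r" using r by simp
  have bd: "conv h (\<rho> k) x0 + 1 \<le> conv h (\<rho> k) x" if x: "x \<in> sphere 0 r" for k x
    using close[OF x0r, of k] close[of x k] ubd[OF x] \<kappa> x by (simp add: abs_le_iff)

  define A where "A k = {y \<in> cball 0 r. psd (M k y) \<and> \<gamma>' \<le> norm (G k y) \<and> norm (G k y) \<le> 1/2}" for k
  define P where "P = (LINT p:cball 0 (1/2) - ball 0 \<gamma>'|lborel. (1 / norm (p :: real^'n)) ^ n)"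
  have \<gamma>'0: "\<gamma>' > 0" using \<gamma> by simp
  have abp: "P \<le> fact n * (LINT x:A k|lborel. trace (M k x) ^ n * (1 / norm (G k x)) ^ n)"
    "set_integrable lborel (A k) (\<lambda>x. trace (M k x) ^ n * (1 / norm (G k x)) ^ n)" for k
    unfolding P_def n_def A_def
    using abp_smooth(1,3)[OF dv dG contM symM x0r r(3) bd \<gamma>'0] by blast+

  define K where "K = (2 * Lam / \<gamma>') ^ n"
  have K0: "K \<ge> 0" using lam \<gamma>'0 by (simp add: K_def)
  \<comment> \<open>The cost of turning the n-th power of a sum over all matrix entries into a sum
    of n-th powers.\<close>
  define c where "c = real (CARD('n \<times> 'n)) ^ n"
  define q where "q k x = (\<Sum>i\<in>UNIV. \<bar>conv (g i) (\<rho> k) x - g i x\<bar>)" for k x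
  define W where "W k x = (\<Sum>i\<in>UNIV. \<Sum>j\<in>UNIV. \<bar>conv (w i j) (\<rho> k) x - w i j x\<bar> ^ n)" for k x
  define H where "H x = (\<Sum>i\<in>UNIV. \<Sum>j\<in>UNIV. \<bar>w i j x\<bar> ^ n)" for x
  define E where "E k = {x. q k x \<ge> \<gamma>' - \<gamma>}" for k
  define \<Psi> where "\<Psi> k x = (1 / lam) ^ n * (4 ^ n * \<beta> x ^ n + K * c * (W k x + indicator (E k) x * H x))" for k x
  have dsum: "(\<Sum>i\<in>UNIV. \<Sum>j\<in>UNIV. f i j) ^ n \<le> c * (\<Sum>i\<in>UNIV. \<Sum>j\<in>UNIV. f i j ^ n)"
    if "\<And>i j. 0 \<le> f i j" for f :: "'n \<Rightarrow> 'n \<Rightarrow> real"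
    using sum_power_le[of "UNIV :: ('n \<times> 'n) set" "\<lambda>(i, j). f i j" n] that
    by (simp add: sum.cartesian_product c_def UNIV_Times_UNIV[symmetric] case_prod_beta del: UNIV_Times_UNIV)
  have Wi: "integrable lborel (W k)" for k
    unfolding W_def \<rho>_def by (intro Bochner_Integration.integrable_sum mollify_integrable w d0)
  have Hi: "integrable lborel H"
    unfolding H_def by (intro Bochner_Integration.integrable_sum w)
  have qi: "integrable lborel (q k)" for k
    unfolding q_def \<rho>_def using mollify_integrable[of "g _" 1, OF g(1) _ d0] g(1)
    by (intro Bochner_Integration.integrable_sum) simp
  have W0: "W k x \<ge> 0" and H0: "H x \<ge> 0" and q0: "q k x \<ge> 0" for k x
    unfolding W_def H_def q_def by (intro sum_nonneg; simp)+
  have Wlim: "(\<lambda>k. LINT x|lborel. W k x) \<longlonglongrightarrow> 0"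
  proof -
    have "(LINT x|lborel. W k x) = (\<Sum>i\<in>UNIV. \<Sum>j\<in>UNIV. LINT x|lborel. \<bar>conv (w i j) (\<rho> k) x - w i j x\<bar> ^ n)" for k
      unfolding W_def \<rho>_def
      by (simp add: Bochner_Integration.integral_sum Bochner_Integration.integrable_sum mollify_integrable w d0)
    moreover have "(\<lambda>k. \<Sum>i\<in>UNIV. \<Sum>j\<in>UNIV. LINT x|lborel. \<bar>conv (w i j) (\<rho> k) x - w i j x\<bar> ^ n) \<longlonglongrightarrow> 0"
      unfolding \<rho>_def by (intro tendsto_null_sum mollify_tendsto w n1 d0 dlim)
    ultimately show ?thesis by simp
  qed
  have qlim: "(\<lambda>k. LINT x|lborel. \<bar>q k x\<bar>) \<longlonglongrightarrow> 0"
  proof -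
    have "(LINT x|lborel. \<bar>q k x\<bar>) = (\<Sum>i\<in>UNIV. LINT x|lborel. \<bar>conv (g i) (\<rho> k) x - g i x\<bar>)" for k
    proof -
      have "integrable lborel (\<lambda>x. \<bar>conv (g i) (\<rho> k) x - g i x\<bar>)" for i
        using mollify_integrable[of "g i" 1, OF g(1) _ d0] g(1) by (simp add: \<rho>_def)
      then show ?thesis using q0 unfolding q_def by (simp add: Bochner_Integration.integral_sum)
    qed
    moreover have "(\<lambda>k. \<Sum>i\<in>UNIV. LINT x|lborel. \<bar>conv (g i) (\<rho> k) x - g i x\<bar>) \<longlonglongrightarrow> 0"
    proof (rule tendsto_null_sum)
      fix i
      show "(\<lambda>k. LINT x|lborel. \<bar>conv (g i) (\<rho> k) x - g i x\<bar>) \<longlonglongrightarrow> 0"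
        using mollify_tendsto[of "g i" 1, OF g(1) _ _ d0 dlim] g(1) by (simp add: \<rho>_def)
    qed
    ultimately show ?thesis by simp
  qed
  have \<gamma>\<gamma>: "\<gamma>' - \<gamma> > 0" using \<gamma> by simp
  \<comment> \<open>Since \<open>P\<close> is bounded for every \<open>k\<close>, convergence along
    a subsequence is enough.\<close>
  obtain s where s: "strict_mono s" "(\<lambda>k. LINT x|lborel. indicator (E (s k)) x * H x) \<longlonglongrightarrow> 0"
    "\<And>k. integrable lborel (\<lambda>x. indicator (E k) x * H x)"
    using L1_tendsto_bad_set_subseq[OF qi qlim Hi \<gamma>\<gamma>, folded E_def] by blast

  have point: "AE x in lborel. indicator (A k) x *\<^sub>R (trace (M k x) ^ n * (1 / norm (G k x)) ^ n) \<le> \<Psi> k x" for k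
  proof -
    have AEell: "AE x in lebesgue. x \<in> ball 0 1 \<longrightarrow> transpose (a x) = a x
          \<and> loewner_le (mat lam) (a x) \<and> loewner_le (a x) (mat Lam)"
      using ell by (subst (asm) AE_restrict_space_iff) auto
    have AEsup: "AE x in lebesgue. x \<in> ball 0 1 \<longrightarrow> norm (Du x) > \<gamma> \<longrightarrow> nondiv_op a b Du D2u x \<le> 0"
      using super unfolding large_gradient_supersolution_def by (subst (asm) AE_restrict_space_iff) auto
    have AEg: "AE x in lebesgue. \<forall>i. x \<in> ball 0 R \<longrightarrow> g i x = Du x $ i"
      by (subst AE_all_countable) (use g(2) in blast)
    have AEw: "AE x in lebesgue. \<forall>i j. x \<in> ball 0 R \<longrightarrow> w i j x = D2u x $ i $ j"
      by (subst AE_all_countable, intro allI, subst AE_all_countable) (use w(3) in blast)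
    have "AE x in lebesgue. indicator (A k) x *\<^sub>R (trace (M k x) ^ n * (1 / norm (G k x)) ^ n) \<le> \<Psi> k x"
      using AEell AEsup AEg AEw \<beta>(2)
    proof eventually_elim
      case (elim x)
      have \<beta>0: "\<beta> x \<ge> 0" using elim(5) by simp
      show ?case
      proof (cases "x \<in> A k")
        case False
        then show ?thesis
          unfolding \<Psi>_def using lam K0 W0 H0 \<beta>0 by (simp add: c_def)
      next
        case True
        then have xr: "x \<in> cball 0 r" and psdM: "psd (M k x)" and Gx: "\<gamma>' \<le> norm (G k x)"
          by (auto simp: A_def)
        have xR: "x \<in> ball 0 R" "x \<in> ball 0 1" using xr R by auto
        have gx: "g i x = Du x $ i" and wx: "w i j x = D2u x $ i $ j" for i j
          using elim(3,4) xR by auto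
        have \<beta>x: "\<beta> x = norm (b x)" using elim(5) xR by simp
        have ax: "loewner_le (mat lam) (a x)" "loewner_le (a x) (mat Lam)" "transpose (a x) = a x"
          using elim(1) xR by auto
        have pde: "(\<Sum>i\<in>UNIV. \<Sum>j\<in>UNIV. a x $ i $ j * D2u x $ i $ j) + (\<Sum>i\<in>UNIV. b x $ i * Du x $ i) \<le> 0"
          if "norm (Du x) > \<gamma>"
          using elim(2) xR that by (simp add: nondiv_op_def)
        have qx: "norm (G k x - Du x) \<le> q k x"
          using norm_le_l1_cart[of "G k x - Du x"] by (simp add: q_def Gg[OF xr] gx)
        have "trace (M k x) ^ n * (1 / norm (G k x)) ^ n
          \<le> (1 / lam) ^ n * (4 ^ n * norm (b x) ^ n + K * ((\<Sum>i\<in>UNIV. \<Sum>j\<in>UNIV. \<bar>M k x $ i $ j - D2u x $ i $ j\<bar>) ^ n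
              + (if q k x \<ge> \<gamma>' - \<gamma> then (\<Sum>i\<in>UNIV. \<Sum>j\<in>UNIV. \<bar>D2u x $ i $ j\<bar>) ^ n else 0)))"
          unfolding K_def
          by (rule supersolution_trace_bound[OF lam ax psdM symM \<gamma> Gx pde qx])
        also have "\<dots> \<le> \<Psi> k x"
        proof -
          have 1: "(\<Sum>i\<in>UNIV. \<Sum>j\<in>UNIV. \<bar>M k x $ i $ j - D2u x $ i $ j\<bar>) ^ n \<le> c * W k x"
            using dsum[of "\<lambda>i j. \<bar>M k x $ i $ j - D2u x $ i $ j\<bar>"] by (simp add: W_def Mw[OF xr] wx)
          have 2: "(if q k x \<ge> \<gamma>' - \<gamma> then (\<Sum>i\<in>UNIV. \<Sum>j\<in>UNIV. \<bar>D2u x $ i $ j\<bar>) ^ n else 0)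
              \<le> c * (indicator (E k) x * H x)"
            using dsum[of "\<lambda>i j. \<bar>D2u x $ i $ j\<bar>"] by (simp add: H_def E_def wx)
          have "K * ((\<Sum>i\<in>UNIV. \<Sum>j\<in>UNIV. \<bar>M k x $ i $ j - D2u x $ i $ j\<bar>) ^ n
              + (if q k x \<ge> \<gamma>' - \<gamma> then (\<Sum>i\<in>UNIV. \<Sum>j\<in>UNIV. \<bar>D2u x $ i $ j\<bar>) ^ n else 0))
              \<le> K * (c * W k x + c * (indicator (E k) x * H x))"
            by (intro mult_left_mono add_mono 1 2 K0)
          also have "\<dots> = K * c * (W k x + indicator (E k) x * H x)" by (simp add: algebra_simps)
          finally show ?thesis
            unfolding \<Psi>_def \<beta>x using lam by (intro mult_left_mono add_left_mono) auto
        qed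
        finally show ?thesis using True by simp
      qed
    qed
    then show ?thesis by (simp add: AE_completion_iff)
  qed
  have \<Psi>i: "integrable lborel (\<Psi> k)" for k
    unfolding \<Psi>_def
    by (intro integrable_mult_right Bochner_Integration.integrable_add \<beta>(3) Wi s(3))
  have \<Psi>int: "(LINT x|lborel. \<Psi> k x) = (1 / lam) ^ n * (4 ^ n * Lp_norm (real n) (ball 0 1) b ^ n
      + K * c * ((LINT x|lborel. W k x) + (LINT x|lborel. indicator (E k) x * H x)))" for k
    unfolding \<Psi>_def using \<beta>(3,4) Wi[of k] s(3)[of k] by simp
  have bound: "P \<le> fact n * (LINT x|lborel. \<Psi> k x)" for k
  proof -
    have "(LINT x:A k|lborel. trace (M k x) ^ n * (1 / norm (G k x)) ^ n) \<le> (LINT x|lborel. \<Psi> k x)"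
      unfolding set_lebesgue_integral_def
      by (rule integral_mono_AE[OF _ \<Psi>i point]) (use abp(2)[of k] in \<open>simp add: set_integrable_def\<close>)
    then have "fact n * (LINT x:A k|lborel. trace (M k x) ^ n * (1 / norm (G k x)) ^ n) \<le> fact n * (LINT x|lborel. \<Psi> k x)"
      by (rule mult_left_mono) simp
    with abp(1)[of k] show ?thesis by linarith
  qed
  \<comment> \<open>\<open>K\<close> and \<open>c\<close> are independent of \<open>k\<close>, so
    however large, they multiply quantities that vanish in the limit.\<close>
  have "(\<lambda>k. fact n * (LINT x|lborel. \<Psi> (s k) x)) \<longlonglongrightarrow>
      fact n * ((1 / lam) ^ n * (4 ^ n * Lp_norm (real n) (ball 0 1) b ^ n + K * c * (0 + 0)))"
    unfolding \<Psi>int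
    by (intro tendsto_intros s(2) LIMSEQ_subseq_LIMSEQ[OF Wlim s(1), unfolded o_def])
  then have "P \<le> fact n * ((1 / lam) ^ n * (4 ^ n * Lp_norm (real n) (ball 0 1) b ^ n + K * c * (0 + 0)))"
    by (rule LIMSEQ_le_const) (use bound in blast)
  then show ?thesis by (simp add: P_def n_def)
qed

theorem proposition5p2:
  fixes lam Lam S :: real
  assumes "CARD('n::finite) \<ge> 2"
    and "0 < lam" and "lam \<le> Lam" and "S \<ge> 0"
  shows "\<exists>\<epsilon>>0. \<forall>(a :: real^'n \<Rightarrow> real^'n^'n) (b :: real^'n \<Rightarrow> real^'n) (\<gamma> :: real)
      (u :: real^'n \<Rightarrow> real) (Du :: real^'n \<Rightarrow> real^'n) (D2u :: real^'n \<Rightarrow> real^'n^'n).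
      a \<in> borel_measurable (lebesgue_on (ball 0 1)) \<longrightarrow>
      (AE x in lebesgue_on (ball 0 1). transpose (a x) = a x
          \<and> loewner_le (mat lam) (a x) \<and> loewner_le (a x) (mat Lam)) \<longrightarrow>
      b \<in> Lp_space (real CARD('n)) (ball 0 1) \<longrightarrow>
      Lp_norm (real CARD('n)) (ball 0 1) b = S \<longrightarrow>
      0 \<le> \<gamma> \<longrightarrow> \<gamma> < \<epsilon> \<longrightarrow>
      u \<in> sobolev 2 (real CARD('n)) (ball 0 1) \<longrightarrow>
      continuous_on (cball 0 1) u \<longrightarrow>
      is_weak_gradient (ball 0 1) u Du \<longrightarrow>
      is_weak_hessian (ball 0 1) u D2u \<longrightarrow>
      large_gradient_supersolution (ball 0 1) \<gamma> a b Du D2u \<longrightarrow>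
      (\<forall>x\<in>sphere 0 1. u x \<ge> 0) \<longrightarrow>
      (SUP x\<in>ball 0 1. neg_part u x) \<le> 1"
proof -
  define n where "n = CARD('n)"
  define \<omega> where "\<omega> = measure lborel (cball (0::real^'n) 1) / 2"
  have "\<omega> > 0" unfolding \<omega>_def by (simp add: content_cball_pos)
  \<comment> \<open>The bound of \<open>measure_estimate\<close> at drift norm \<open>S\<close>;
    \<open>N\<close> is the number of annuli whose total weight exceeds it.\<close>
  define C where "C = fact n * ((1 / lam) ^ n * (4 ^ n * S ^ n))"
  obtain N where N: "C < real N * \<omega>"
    using \<open>\<omega> > 0\<close> reals_Archimedean3 by blast
  define \<epsilon> :: real where "\<epsilon> = (1/2) ^ (N + 1)"
  have "\<epsilon> > 0" by (simp add: \<epsilon>_def)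
  show ?thesis
  proof (rule exI[of _ \<epsilon>], intro conjI allI impI)
    show "\<epsilon> > 0" by fact
    fix a :: "real^'n \<Rightarrow> real^'n^'n" and b :: "real^'n \<Rightarrow> real^'n" and \<gamma> :: real
      and u :: "real^'n \<Rightarrow> real" and Du :: "real^'n \<Rightarrow> real^'n" and D2u :: "real^'n \<Rightarrow> real^'n^'n"
    assume ell: "AE x in lebesgue_on (ball 0 1). transpose (a x) = a x
          \<and> loewner_le (mat lam) (a x) \<and> loewner_le (a x) (mat Lam)"
      and b: "b \<in> Lp_space (real CARD('n)) (ball 0 1)" "Lp_norm (real CARD('n)) (ball 0 1) b = S"
      and \<gamma>: "0 \<le> \<gamma>" "\<gamma> < \<epsilon>"
      and u: "u \<in> sobolev 2 (real CARD('n)) (ball 0 1)" "continuous_on (cball 0 1) u"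
        "is_weak_gradient (ball 0 1) u Du" "is_weak_hessian (ball 0 1) u D2u"
        "large_gradient_supersolution (ball 0 1) \<gamma> a b Du D2u" "\<forall>x\<in>sphere 0 1. u x \<ge> 0"
    \<comment> \<open>Strictly above \<gamma>, as the limit argument demands, positive even for
      \<gamma> = 0, and small enough for \<open>N\<close> annuli to fit.\<close>
    define \<gamma>' where "\<gamma>' = (\<gamma> + \<epsilon>) / 2"
    have "\<gamma> < \<gamma>'" "\<gamma>' \<le> \<epsilon>" "0 < \<gamma>'"
      using \<gamma> by (auto simp: \<gamma>'_def)
    then have \<gamma>': "\<gamma> < \<gamma>'" "\<gamma>' \<le> (1/2) ^ (N + 1)" "0 < \<gamma>'"
      by (simp_all only: \<epsilon>_def)
    have "neg_part u x \<le> 1" if x: "x \<in> ball 0 1" for x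
    proof (rule ccontr)
      assume "\<not> neg_part u x \<le> 1"
      then have "u x < - 1" by (auto simp: neg_part_def min_def split: if_splits)
      have "real N * \<omega> \<le> (LINT p:cball 0 (1/2) - ball 0 \<gamma>'|lborel. (1 / norm (p :: real^'n)) ^ CARD('n))"
        unfolding \<omega>_def by (rule annulus_integral_ge[OF \<gamma>'(3,2)])
      also have "\<dots> \<le> C"
        using measure_estimate[OF assms(2,3) ell b(1) \<gamma>(1) \<gamma>'(1) u x \<open>u x < - 1\<close>]
        by (simp add: C_def n_def b(2))
      finally show False using N by simp
    qed
    then show "(SUP x\<in>ball 0 1. neg_part u x) \<le> 1"
      by (intro cSUP_least) auto
  qed
qed


end
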